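(* Let $\mathcal H^{vrg}$ be the Hopf algebra of vertex partitioned ribbon graphs up to joins and isomorphism, and let $\alpha(\mathbf a,\mathbf b)=\exp_*(\delta_{\mathbf a})*\exp_*(\delta_{\mathbf b})$ with $\delta_{\mathbf a}=x_1\delta_b+x_2\delta_o+\sqrt{x_2x_3}\,\delta_n+x_3\delta_l$ and $\delta_{\mathbf b}=y_1\delta_b+y_2\delta_o+\sqrt{y_2y_3}\,\delta_n+y_3\delta_l$. Then for every vertex partitioned ribbon graph $(G,\mathcal P)$ with edge set $E$, $$\alpha(\mathbf a,\mathbf b)(G,\mathcal P)=y_1^{r(G_{/\mathcal P})}y_2^{|E|-\rho(G)}y_3^{\rho(G)-r(G_{/\mathcal P})}\sum_{A\subseteq E}\Big(\frac{x_1}{y_1}\Big)^{r(A_{/\mathcal P})}\Big(\frac{x_2}{y_2}\Big)^{|A|-\rho(A)}\Big(\frac{x_3}{y_3}\Big)^{\rho(A)-r(A_{/\mathcal P})}.$$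
   Context: A ribbon graph $G=(V,E)$ is a surface with boundary given as a union of vertex discs and edge discs, meeting in disjoint line segments, each segment on the boundary of exactly one vertex and one edge, each edge containing exactly two segments; considered up to structure-preserving homeomorphism. Ribbon graph deletion removes an edge; contraction of $e$ with incident vertices $u,v$ attaches a disc along each boundary component of $e\cup u\cup v$ and deletes the interior of $e\cup u\cup v$ (new discs are vertices). A vertex partitioned ribbon graph $(G,\mathcal P)$ is a ribbon graph with a partition $\mathcal P$ of $V$. Deletion: $(G,\mathcal P)\backslash e=(G\backslash e,\mathcal P)$. Contraction: $(G,\mathcal P)/e=(G/e,\mathcal P')$ where, if $e$ has ends $u,v$ in blocks $P_u,P_v$, $\mathcal P'$ replaces $P_u,P_v$ by the single block $((P_u\cup P_v)\setminus\{u,v\})\cup W$, $W$ the set of vertices created by the contraction. $(G,\mathcal P)$ is the join of $(G_1,\mathcal P_1)$, $(G_2,\mathcal P_2)$ if $G=G_1\vee G_2$ (a ribbon graph join: $G=G_1\cup G_2$, $G_1\cap G_2$ a single vertex $v$ with an arc on $v$ where all edges of $G_1$ at $v$ meet it and none of $G_2$) and $\mathcal P_i$ is the restriction of $\mathcal P$ to $V(G_i)$. $\mathcal H^{vrg}$ is the free module (over a field of characteristic 0) spanned by equivalence classes under isomorphism and identifying a join with the disjoint union, graded by number of edges, with multiplication disjoint union, counit $1$ on edgeless classes and $0$ otherwise, and coproduct $\Delta(G,\mathcal P)=\sum_{A\subseteq E}(G,\mathcal P)\backslash A^c\otimes(G,\mathcal P)/A$. $\delta_b,\delta_o,\delta_n,\delta_l$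 are the linear maps equal to $1$ respectively on: a non-loop edge with vertices $u,v$ and partition $\{\{u\},\{v\}\}$; an orientable loop on one vertex; a non-orientable loop on one vertex; a non-loop edge with partition $\{\{u,v\}\}$; and $0$ on all other classes. $f*g=m\circ(f\otimes g)\circ\Delta$, $\exp_*(\delta)=\sum_{k\ge0}\delta^{*k}/k!$ with $\delta^{*0}=\varepsilon$. For $A\subseteq E$: $f(A)$ is the number of boundary components of the spanning ribbon subgraph $(V,A)$, $\rho(A)=\frac12(|A|+|V|-f(A))$, $\rho(G)=\rho(E)$; $A_{/\mathcal P}$ is the abstract graph obtained from the underlying graph of $(V,A)$ by identifying the vertices in each block of $\mathcal P$, $G_{/\mathcal P}=E_{/\mathcal P}$, and $r(H)$ is the number of vertices minus the number of components of a graph $H$.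
   Formalization: In a join, a block of P meeting both V(G_1) and V(G_2) is also required to contain the common vertex, and edgeless (G,P) are identified with the unit; without these conditions the identification up to joins makes the coproduct ill-defined or the formula false. *)

theory Defs
  imports Complex_Main "HOL-Library.Poly_Mapping" "HOL-Library.Disjoint_Sets"
begin

section \<open>Ribbon graphs\<close>

text \<open>
  A ribbon graph is encoded by the line segments on the boundaries of its vertex discs.
  The points of \<open>pts\<close> are the end points of these segments: \<open>seg\<close> exchanges the two ends of a
  segment, and \<open>arc\<close> exchanges the two ends of each arc of a vertex boundary that runs between
  consecutive segments.  Thus the boundary circles of the vertex discs are the orbits of
  \<open>\<langle>seg, arc\<rangle>\<close>.
  The points in \<open>live\<close> are those on segments where an edge disc is attached, and \<open>side\<close> exchanges
  the two ends of each free side of an edge disc.  Segments outside \<open>live\<close> carry no edge; they are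
  invisible to isomorphisms (see \<open>vrg_iso\<close>) and are there so that a vertex without edges has
  a point, hence so that each vertex disc can be named by the set of points on its boundary.
\<close>

record ribbon_graph =
  pts :: "nat set"
  seg :: "nat \<Rightarrow> nat"
  arc :: "nat \<Rightarrow> nat"
  live :: "nat set"
  side :: "nat \<Rightarrow> nat"

definition pairing_on :: "nat set \<Rightarrow> (nat \<Rightarrow> nat) \<Rightarrow> bool" where
  "pairing_on D f \<longleftrightarrow> (\<forall>p\<in>D. f p \<in> D \<and> f p \<noteq> p \<and> f (f p) = p)"

definition ribbon :: "ribbon_graph \<Rightarrow> bool" where
  "ribbon G \<longleftrightarrow> finite (pts G) \<and> pairing_on (pts G) (seg G) \<and> pairing_on (pts G) (arc G)
     \<and> live G \<subseteq> pts G \<and> pairing_on (live G) (seg G) \<and> pairing_on (live G) (side G)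
     \<and> (\<forall>p\<in>live G. side G p \<noteq> seg G p \<and> side G (seg G p) = seg G (side G p))"

definition circles :: "nat set \<Rightarrow> (nat \<Rightarrow> nat) \<Rightarrow> (nat \<Rightarrow> nat) \<Rightarrow> nat set set" where
  "circles D f g =
     (\<lambda>p. {q. (p, q) \<in> ({(x, f x) | x. x \<in> D} \<union> {(x, g x) | x. x \<in> D})\<^sup>*}) ` D"

definition vertices :: "ribbon_graph \<Rightarrow> nat set set" where
  "vertices G = circles (pts G) (seg G) (arc G)"

text \<open>An edge disc is named by its four corners.\<close>

definition edges :: "ribbon_graph \<Rightarrow> nat set set" where
  "edges G = (\<lambda>p. {p, seg G p, side G p, seg G (side G p)}) ` live G"

definition ends :: "ribbon_graph \<Rightarrow> nat set \<Rightarrow> nat set set" where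
  "ends G e = {v \<in> vertices G. v \<inter> e \<noteq> {}}"

text \<open>The boundary of the surface follows the vertex discs, except that at a segment carrying an
  edge disc it turns off along the side of that disc.\<close>

definition boundary_components :: "ribbon_graph \<Rightarrow> nat set set" where
  "boundary_components G =
     circles (pts G) (\<lambda>p. if p \<in> live G then side G p else seg G p) (arc G)"

definition spanning :: "ribbon_graph \<Rightarrow> nat set set \<Rightarrow> ribbon_graph" where
  "spanning G A = G\<lparr>live := \<Union>A\<rparr>"

definition rho :: "ribbon_graph \<Rightarrow> nat set set \<Rightarrow> rat" where
  "rho G A = (of_nat (card A) + of_nat (card (vertices G))
              - of_nat (card (boundary_components (spanning G A)))) / 2"


section \<open>Vertex partitioned ribbon graphs\<close>

type_synonym part_ribbon_graph = "ribbon_graph \<times> nat set set set"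

definition vrg :: "part_ribbon_graph \<Rightarrow> bool" where
  "vrg X \<longleftrightarrow> ribbon (fst X) \<and> partition_on (vertices (fst X)) (snd X)"

definition delete :: "nat set \<Rightarrow> part_ribbon_graph \<Rightarrow> part_ribbon_graph" where
  "delete e X = ((fst X)\<lparr>live := live (fst X) - e\<rparr>, snd X)"

text \<open>
  Replacing \<open>seg\<close> by \<open>side\<close> on the corners of \<open>e\<close> turns the boundary circles of the ends of \<open>e\<close>
  into the boundary components of the union of \<open>e\<close> and its ends, which bound the new vertex discs.
\<close>

definition contract_ribbon :: "nat set \<Rightarrow> ribbon_graph \<Rightarrow> ribbon_graph" where
  "contract_ribbon e G =
     G\<lparr>seg := (\<lambda>p. if p \<in> e then side G p else seg G p), live := live G - e\<rparr>"

definition contract_partition ::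
  "nat set \<Rightarrow> ribbon_graph \<Rightarrow> nat set set set \<Rightarrow> nat set set set" where
  "contract_partition e G P =
     {B \<in> P. B \<inter> ends G e = {}} \<union>
     {(\<Union>{B \<in> P. B \<inter> ends G e \<noteq> {}} - ends G e) \<union> ends (contract_ribbon e G) e}"

definition contract :: "nat set \<Rightarrow> part_ribbon_graph \<Rightarrow> part_ribbon_graph" where
  "contract e X = (contract_ribbon e (fst X), contract_partition e (fst X) (snd X))"

text \<open>Deletion or contraction of a finite set of edges, one after another; the order is
  immaterial.\<close>

definition for_edges ::
  "(nat set \<Rightarrow> part_ribbon_graph \<Rightarrow> part_ribbon_graph) \<Rightarrow>
    nat set set \<Rightarrow> part_ribbon_graph \<Rightarrow> part_ribbon_graph" where
  "for_edges f A X = fold f (SOME es. distinct es \<and> set es = A) X"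


section \<open>Isomorphism, disjoint union and join\<close>

text \<open>\<open>(p, q) \<in> free_arcs G\<close> if \<open>q\<close> is the first point of \<open>live G\<close> met when moving from \<open>p\<close> along
  the vertex boundary, away from the segment of \<open>p\<close>.\<close>

definition free_arcs :: "ribbon_graph \<Rightarrow> (nat \<times> nat) set" where
  "free_arcs G = {(p, q). p \<in> live G \<and> q \<in> live G \<and>
     (arc G p, q) \<in> {(x, arc G (seg G x)) | x. x \<in> pts G - live G}\<^sup>*}"

definition vrg_iso :: "part_ribbon_graph \<Rightarrow> part_ribbon_graph \<Rightarrow> bool" where
  "vrg_iso X Y \<longleftrightarrow> (case (X, Y) of ((G, P), (H, Q)) \<Rightarrow> \<exists>\<phi> \<psi>.
     bij_betw \<phi> (vertices G) (vertices H) \<and>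
     bij_betw \<psi> (live G) (live H) \<and>
     (\<forall>v\<in>vertices G. \<psi> ` (v \<inter> live G) = \<phi> v \<inter> live H) \<and>
     (\<forall>p\<in>live G. \<psi> (seg G p) = seg H (\<psi> p) \<and> \<psi> (side G p) = side H (\<psi> p)) \<and>
     (\<forall>p\<in>live G. \<forall>q\<in>live G. (p, q) \<in> free_arcs G \<longleftrightarrow> (\<psi> p, \<psi> q) \<in> free_arcs H) \<and>
     (\<lambda>B. \<phi> ` B) ` P = Q)"

text \<open>Disjoint union, on the even and the odd numbers.\<close>

definition sum_fun :: "(nat \<Rightarrow> nat) \<Rightarrow> (nat \<Rightarrow> nat) \<Rightarrow> nat \<Rightarrow> nat" where
  "sum_fun f g n = (if even n then 2 * f (n div 2) else 2 * g (n div 2) + 1)"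

definition sum_set :: "nat set \<Rightarrow> nat set \<Rightarrow> nat set" where
  "sum_set S T = (\<lambda>n. 2 * n) ` S \<union> (\<lambda>n. 2 * n + 1) ` T"

definition disjoint_union :: "part_ribbon_graph \<Rightarrow> part_ribbon_graph \<Rightarrow> part_ribbon_graph" where
  "disjoint_union X Y = (case (X, Y) of ((G, P), (H, Q)) \<Rightarrow>
     (\<lparr>pts = sum_set (pts G) (pts H), seg = sum_fun (seg G) (seg H),
       arc = sum_fun (arc G) (arc H), live = sum_set (live G) (live H),
       side = sum_fun (side G) (side H)\<rparr>,
      (\<lambda>B. (\<lambda>v. (\<lambda>n. 2 * n) ` v) ` B) ` P \<union> (\<lambda>B. (\<lambda>v. (\<lambda>n. 2 * n + 1) ` v) ` B) ` Q))"

definition sub_ribbon :: "ribbon_graph \<Rightarrow> nat set set \<Rightarrow> nat set set \<Rightarrow> ribbon_graph" where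
  "sub_ribbon G U A = G\<lparr>pts := \<Union>U, live := \<Union>A\<rparr>"

definition restrict_partition :: "'a set set \<Rightarrow> 'a set \<Rightarrow> 'a set set" where
  "restrict_partition P U = {B \<inter> U | B. B \<in> P \<and> B \<inter> U \<noteq> {}}"

text \<open>
  \<open>S\<close> is the set of end points of the segments of \<open>v\<close> that lie on the arc separating the two sides
  of the ribbon graph join: a set of segments of a circle is contiguous iff at most two arcs
  lead out of it.

  The last condition makes \<open>P\<close> the union of its two restrictions, glued along the
  blocks that contain \<open>v\<close>.  It is needed for the coproduct to be defined modulo joins:
  a path \<open>u\<^sub>1 v u\<^sub>2\<close> with partition \<open>{{u\<^sub>1, u\<^sub>2}, {v}}\<close> and the disjoint union of its two
  edges \<open>u\<^sub>1 v\<close> and \<open>v u\<^sub>2\<close>, where all blocks are singletons, have inequivalent contractions.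
\<close>

definition is_join ::
  "part_ribbon_graph \<Rightarrow> part_ribbon_graph \<Rightarrow> part_ribbon_graph \<Rightarrow> bool" where
  "is_join X X1 X2 \<longleftrightarrow> (case X of (G, P) \<Rightarrow> \<exists>V1 V2 E1 E2 v S.
     V1 \<union> V2 = vertices G \<and> V1 \<inter> V2 = {v} \<and>
     E1 \<union> E2 = edges G \<and> E1 \<inter> E2 = {} \<and>
     (\<forall>e\<in>E1. ends G e \<subseteq> V1) \<and> (\<forall>e\<in>E2. ends G e \<subseteq> V2) \<and>
     S \<subseteq> v \<and> seg G ` S \<subseteq> S \<and> card {p \<in> S. arc G p \<notin> S} \<le> 2 \<and>
     v \<inter> \<Union>E1 \<subseteq> S \<and> S \<inter> \<Union>E2 = {} \<and>
     X1 = (sub_ribbon G V1 E1, restrict_partition P V1) \<and>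
     X2 = (sub_ribbon G V2 E2, restrict_partition P V2) \<and>
     (\<forall>B\<in>P. B \<inter> V1 \<noteq> {} \<and> B \<inter> V2 \<noteq> {} \<longrightarrow> v \<in> B))"

text \<open>
  The edgeless classes are identified with the unit, so that the Hopf algebra is connected.  Given
  the rule for joins, what this adds is that isolated vertices can be dropped from the blocks of a
  partition.  Such vertices arise when an orientable loop is contracted: contracting one of the two
  petals of a plane bouquet leaves a loop and an isolated vertex in one block, and the
  value of \<open>\<delta>\<^sub>o\<close> on it must be \<open>1\<close>.
\<close>

inductive vrg_equiv :: "part_ribbon_graph \<Rightarrow> part_ribbon_graph \<Rightarrow> bool" where
  iso: "vrg X \<Longrightarrow> vrg Y \<Longrightarrow> vrg_iso X Y \<Longrightarrow> vrg_equiv X Y"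
| join: "vrg X \<Longrightarrow> is_join X X1 X2 \<Longrightarrow> vrg_equiv X (disjoint_union X1 X2)"
| edgeless: "vrg X \<Longrightarrow> vrg Z \<Longrightarrow> edges (fst Z) = {} \<Longrightarrow> vrg_equiv (disjoint_union X Z) X"
| sym: "vrg_equiv X Y \<Longrightarrow> vrg_equiv Y X"
| trans: "vrg_equiv X Y \<Longrightarrow> vrg_equiv Y Z \<Longrightarrow> vrg_equiv X Z"

lemma vrg_iso_refl: "vrg_iso X X"
  unfolding vrg_iso_def
  by (cases X) (auto intro!: exI[of _ id])

quotient_type vrg_class = part_ribbon_graph / partial: vrg_equiv
proof (rule part_equivpI)
  have "vrg (\<lparr>pts = {}, seg = id, arc = id, live = {}, side = id\<rparr>, {})"
    by (simp add: vrg_def ribbon_def pairing_on_def vertices_def circles_def partition_on_def)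
  then show "\<exists>X. vrg_equiv X X"
    by (blast intro: vrg_equiv.iso vrg_iso_refl)
  show "symp vrg_equiv" by (blast intro: sympI vrg_equiv.sym)
  show "transp vrg_equiv" by (blast intro: transpI vrg_equiv.trans)
qed


section \<open>The coalgebra and convolution\<close>

text \<open>The Hopf algebra is the free module \<open>vrg_class \<Rightarrow>\<^sub>0 'k\<close>, its tensor square is the free module
  on pairs of classes, and \<open>rep_vrg_class\<close> picks a representative of a class.\<close>

definition linear_extension :: "('b \<Rightarrow> 'k) \<Rightarrow> ('b \<Rightarrow>\<^sub>0 'k) \<Rightarrow> 'k::field_char_0" where
  "linear_extension g h = (\<Sum>c\<in>Poly_Mapping.keys h. Poly_Mapping.lookup h c * g c)"

definition vrg_basis :: "part_ribbon_graph \<Rightarrow> vrg_class \<Rightarrow>\<^sub>0 'k::field_char_0" where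
  "vrg_basis X = Poly_Mapping.single (abs_vrg_class X) 1"

definition coproduct :: "(vrg_class \<Rightarrow>\<^sub>0 'k) \<Rightarrow> vrg_class \<times> vrg_class \<Rightarrow>\<^sub>0 'k::field_char_0" where
  "coproduct h = (\<Sum>c\<in>Poly_Mapping.keys h. let X = rep_vrg_class c; E = edges (fst X) in
     \<Sum>A\<in>Pow E. Poly_Mapping.single
       (abs_vrg_class (for_edges delete (E - A) X), abs_vrg_class (for_edges contract A X))
       (Poly_Mapping.lookup h c))"

definition counit :: "(vrg_class \<Rightarrow>\<^sub>0 'k) \<Rightarrow> 'k::field_char_0" where
  "counit = linear_extension (\<lambda>c. if edges (fst (rep_vrg_class c)) = {} then 1 else 0)"

text \<open>\<open>m \<circ> (f \<otimes> g)\<close>, where \<open>m\<close> is the multiplication of the field.\<close>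

definition tensor_mult ::
  "((vrg_class \<Rightarrow>\<^sub>0 'k) \<Rightarrow> 'k) \<Rightarrow> ((vrg_class \<Rightarrow>\<^sub>0 'k) \<Rightarrow> 'k) \<Rightarrow>
    (vrg_class \<times> vrg_class \<Rightarrow>\<^sub>0 'k) \<Rightarrow> 'k::field_char_0" where
  "tensor_mult f g =
     linear_extension (\<lambda>(c, d). f (Poly_Mapping.single c 1) * g (Poly_Mapping.single d 1))"

definition convolution ::
  "((vrg_class \<Rightarrow>\<^sub>0 'k) \<Rightarrow> 'k) \<Rightarrow> ((vrg_class \<Rightarrow>\<^sub>0 'k) \<Rightarrow> 'k) \<Rightarrow>
    (vrg_class \<Rightarrow>\<^sub>0 'k) \<Rightarrow> 'k::field_char_0" where
  "convolution f g = tensor_mult f g \<circ> coproduct"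

primrec conv_power ::
  "((vrg_class \<Rightarrow>\<^sub>0 'k) \<Rightarrow> 'k) \<Rightarrow> nat \<Rightarrow> (vrg_class \<Rightarrow>\<^sub>0 'k) \<Rightarrow> 'k::field_char_0" where
  "conv_power f 0 = counit"
| "conv_power f (Suc k) = convolution f (conv_power f k)"

text \<open>If \<open>f\<close> vanishes on the edgeless classes, its \<open>k\<close>-th power vanishes on all classes with fewer
  than \<open>k\<close> edges, so only finitely many terms of the sum are nonzero.\<close>

definition conv_exp ::
  "((vrg_class \<Rightarrow>\<^sub>0 'k) \<Rightarrow> 'k) \<Rightarrow> (vrg_class \<Rightarrow>\<^sub>0 'k) \<Rightarrow> 'k::field_char_0" where
  "conv_exp f h = Sum_any (\<lambda>k. conv_power f k h / fact k)"


section \<open>The functionals\<close>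

text \<open>An edge with segments \<open>{0, 1}\<close> and \<open>{2, 3}\<close>, attached to two vertices or to a single one.\<close>

definition flip :: "nat \<Rightarrow> nat" where
  "flip p = (if even p then p + 1 else p - 1)"

definition nonloop_edge :: ribbon_graph where
  "nonloop_edge = \<lparr>pts = {0, 1, 2, 3}, seg = flip, arc = flip, live = {0, 1, 2, 3},
     side = id(0 := 2, 2 := 0, 1 := 3, 3 := 1)\<rparr>"

definition orientable_loop :: ribbon_graph where
  "orientable_loop = \<lparr>pts = {0, 1, 2, 3}, seg = flip,
     arc = id(1 := 2, 2 := 1, 3 := 0, 0 := 3), live = {0, 1, 2, 3},
     side = id(1 := 2, 2 := 1, 3 := 0, 0 := 3)\<rparr>"

definition nonorientable_loop :: ribbon_graph where
  "nonorientable_loop = \<lparr>pts = {0, 1, 2, 3}, seg = flip,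
     arc = id(1 := 2, 2 := 1, 3 := 0, 0 := 3), live = {0, 1, 2, 3},
     side = id(0 := 2, 2 := 0, 1 := 3, 3 := 1)\<rparr>"

definition indicator_functional ::
  "part_ribbon_graph \<Rightarrow> (vrg_class \<Rightarrow>\<^sub>0 'k) \<Rightarrow> 'k::field_char_0" where
  "indicator_functional X = linear_extension (\<lambda>c. if c = abs_vrg_class X then 1 else 0)"

definition delta_b :: "(vrg_class \<Rightarrow>\<^sub>0 'k) \<Rightarrow> 'k::field_char_0" where
  "delta_b = indicator_functional (nonloop_edge, {{{0, 1}}, {{2, 3}}})"

definition delta_o :: "(vrg_class \<Rightarrow>\<^sub>0 'k) \<Rightarrow> 'k::field_char_0" where
  "delta_o = indicator_functional (orientable_loop, {{{0, 1, 2, 3}}})"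

definition delta_n :: "(vrg_class \<Rightarrow>\<^sub>0 'k) \<Rightarrow> 'k::field_char_0" where
  "delta_n = indicator_functional (nonorientable_loop, {{{0, 1, 2, 3}}})"

definition delta_l :: "(vrg_class \<Rightarrow>\<^sub>0 'k) \<Rightarrow> 'k::field_char_0" where
  "delta_l = indicator_functional (nonloop_edge, {{{0, 1}, {2, 3}}})"

text \<open>\<open>s\<close> and \<open>t\<close> are the chosen square roots of \<open>z\<^sub>2\<close> and \<open>z\<^sub>3\<close>, so that \<open>s * t\<close> stands for the
  square root of \<open>z\<^sub>2 z\<^sub>3\<close>.\<close>

definition delta ::
  "'k \<Rightarrow> 'k \<Rightarrow> 'k \<Rightarrow> 'k \<Rightarrow> 'k \<Rightarrow> (vrg_class \<Rightarrow>\<^sub>0 'k) \<Rightarrow> 'k::field_char_0" where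
  "delta z1 z2 z3 s t h =
     z1 * delta_b h + z2 * delta_o h + s * t * delta_n h + z3 * delta_l h"

text \<open>For a half-integer \<open>q\<close>, the \<open>q\<close>-th power of \<open>s\<^sup>2\<close>, formed with the square root \<open>s\<close>.\<close>

definition half_power :: "'k::field_char_0 \<Rightarrow> rat \<Rightarrow> 'k" where
  "half_power s q = s powi \<lfloor>2 * q\<rfloor>"


section \<open>Abstract graphs and rank\<close>

record ('v, 'e) multigraph =
  verts :: "'v set"
  edge_set :: "'e set"
  edge_ends :: "'e \<Rightarrow> 'v set"

definition components :: "('v, 'e) multigraph \<Rightarrow> 'v set set" where
  "components H =
     verts H // {(x, y). x \<in> verts H \<and> y \<in> verts H \<and>
       (x, y) \<in> {(a, b). \<exists>e\<in>edge_set H. a \<in> edge_ends H e \<and> b \<in> edge_ends H e}\<^sup>*}"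

definition graph_rank :: "('v, 'e) multigraph \<Rightarrow> nat" where
  "graph_rank H = card (verts H) - card (components H)"

definition underlying_graph :: "ribbon_graph \<Rightarrow> (nat set, nat set) multigraph" where
  "underlying_graph G = \<lparr>verts = vertices G, edge_set = edges G, edge_ends = ends G\<rparr>"

definition identify_blocks :: "('v, 'e) multigraph \<Rightarrow> 'v set set \<Rightarrow> ('v set, 'e) multigraph" where
  "identify_blocks H P = \<lparr>verts = P, edge_set = edge_set H,
     edge_ends = (\<lambda>e. {B \<in> P. B \<inter> edge_ends H e \<noteq> {}})\<rparr>"

definition part_rank :: "ribbon_graph \<Rightarrow> nat set set set \<Rightarrow> nat set set \<Rightarrow> nat" where
  "part_rank G P A = graph_rank (identify_blocks (underlying_graph (spanning G A)) P)"

end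

theory Submission
  imports Defs
begin

text \<open>
  Both \<open>\<rho>\<close> and the rank of \<open>A\<^bsub>/\<P>\<^esub>\<close> can be read off from numbers of orbits of relations on the
  points of the ribbon graph: \<open>2 \<rho>(A)\<close> is \<open>|A|\<close> plus the drop in the number of boundary components,
  and the rank is the drop in the number of classes into which the blocks fall when they are linked
  along the edges in \<open>A\<close>.  Hence both are additive under contraction,
  \<open>\<rho>(G/A, B) + \<rho>(G, A) = \<rho>(G, A \<union> B)\<close>, and the monomial
  \<open>w(G) = z\<^sub>1\<^bsup>r\<^esup> z\<^sub>2\<^bsup>|E| - \<rho>\<^esup> z\<^sub>3\<^bsup>\<rho> - r\<^esup>\<close> satisfies \<open>w(G) = w(G\A\<^sup>c) w(G/A)\<close> for every \<open>A\<close>.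
  Both are also invariant under the equivalence, so that representatives of classes can be chosen
  freely.  On a single edge \<open>w\<close> is \<open>\<delta>\<close>, and by induction the \<open>k\<close>-th convolution power of \<open>\<delta>\<close> is
  \<open>k! w\<close> on ribbon graphs with \<open>k\<close> edges and \<open>0\<close> on all others.  So \<open>w\<close> is the convolution exponential
  of \<open>\<delta>\<close>, and the theorem is the product of two such monomials summed over \<open>A\<close>.
\<close>

section \<open>Orbits of relations\<close>

text \<open>Under the join relation the orbit counts are not invariants: cutting a vertex in two
  raises each of them by one, for every edge subset alike. Only the drops from the empty subset
  survive, and they have to agree subset by subset, since the coproduct is a sum over edge subsets
  of an arbitrarily chosen representative. The main obstacle is that \<open>rho\<close> can be
  half-integral while exponents must add up even if \<open>z2\<close> or \<open>z3\<close> vanishes.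
  So the exponents of the square roots have to be natural numbers. Contracting one edge at a time
  reduces this to a single edge, where it is read off from a classification into the four classes on
  which the functionals live. One parity argument carries the topology: a component of two partial
  pairings is a circle or a path, so it has an even number of loose ends. It shows that the two arcs
  leading out of one side of a join lie on the same boundary component, and that the corners of
  edges are paired off by the free arcs of the vertices.\<close>

definition orbs :: "'a set \<Rightarrow> ('a \<times> 'a) set \<Rightarrow> 'a set set" where
  "orbs D R = (\<lambda>p. R\<^sup>* `` {p}) ` D"

definition step :: "'a set \<Rightarrow> ('a \<Rightarrow> 'a) \<Rightarrow> ('a \<Rightarrow> 'a) \<Rightarrow> ('a \<times> 'a) set" where
  "step D f g = {(x, f x) | x. x \<in> D} \<union> {(x, g x) | x. x \<in> D}"

text \<open>The orbits of this relation are the connected components of the hypergraph with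
  hyperedges \<open>F\<close>.\<close>

definition linked :: "'a set set \<Rightarrow> ('a \<times> 'a) set" where
  "linked F = (\<Union>S\<in>F. S \<times> S)"

lemma circles_eq_orbs: "circles D f g = orbs D (step D f g)"
  by (simp add: circles_def orbs_def step_def Image_singleton)

lemma sym_linked: "sym (linked F)"
  by (auto simp: linked_def sym_def)

lemma linkedI: "S \<in> F \<Longrightarrow> x \<in> S \<Longrightarrow> y \<in> S \<Longrightarrow> (x, y) \<in> linked F"
  by (auto simp: linked_def)

lemma step_fst: "x \<in> D \<Longrightarrow> (x, f x) \<in> step D f g"
  and step_snd: "x \<in> D \<Longrightarrow> (x, g x) \<in> step D f g"
  by (auto simp: step_def)

lemma stepE:
  assumes "(x, y) \<in> step D f g"
  obtains "x \<in> D" "y = f x" | "x \<in> D" "y = g x"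
  using assms by (auto simp: step_def)

lemma pairing_onD:
  assumes "pairing_on D f" "x \<in> D"
  shows "f x \<in> D" "f x \<noteq> x" "f (f x) = x"
  using assms by (auto simp: pairing_on_def)

lemma sym_step:
  assumes "pairing_on D f" "pairing_on D g"
  shows "sym (step D f g)"
proof (rule symI)
  fix x y assume "(x, y) \<in> step D f g"
  then show "(y, x) \<in> step D f g"
    by (cases rule: stepE)
       (metis assms pairing_onD(1,3) step_fst step_snd)+
qed

lemma step_subset: "pairing_on D f \<Longrightarrow> pairing_on D g \<Longrightarrow> step D f g \<subseteq> D \<times> D"
  by (auto simp: step_def pairing_on_def)

lemma rtrancl_closed:
  assumes "(x, y) \<in> R\<^sup>*" "x \<in> D" "\<And>a b. (a, b) \<in> R \<Longrightarrow> a \<in> D \<Longrightarrow> b \<in> D"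
  shows "y \<in> D"
  using assms by (induction rule: rtrancl_induct) auto

lemma rtrancl_map:
  assumes "(x, y) \<in> R\<^sup>*" "\<And>a b. (a, b) \<in> R \<Longrightarrow> (g a, g b) \<in> S\<^sup>*"
  shows "(g x, g y) \<in> S\<^sup>*"
  using assms(1) by (induction rule: rtrancl_induct) (auto intro: rtrancl_trans assms(2))

lemma rtrancl_3: "(a, b) \<in> R \<Longrightarrow> (b, c) \<in> R \<Longrightarrow> (c, d) \<in> R \<Longrightarrow> (a, d) \<in> R\<^sup>*"
  by (rule rtrancl_into_rtrancl[OF rtrancl_into_rtrancl[OF r_into_rtrancl]])

lemma rtrancl_sym: "sym R \<Longrightarrow> (x, y) \<in> R\<^sup>* \<Longrightarrow> (y, x) \<in> R\<^sup>*"
  by (meson sym_rtrancl symD)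

lemma rtrancl_Image_eq:
  assumes "sym R" "(x, y) \<in> R\<^sup>*"
  shows "R\<^sup>* `` {x} = R\<^sup>* `` {y}"
  using assms by (auto intro: rtrancl_trans dest: rtrancl_sym)

lemma orbs_cong: "R\<^sup>* = S\<^sup>* \<Longrightarrow> orbs D R = orbs D S"
  by (simp add: orbs_def)

lemma rtrancl_eqI: "R \<subseteq> S\<^sup>* \<Longrightarrow> S \<subseteq> R\<^sup>* \<Longrightarrow> R\<^sup>* = S\<^sup>*"
  by (simp add: rtrancl_subset_rtrancl subset_antisym)

lemma finite_orbs: "finite D \<Longrightarrow> finite (orbs D R)"
  by (simp add: orbs_def)

lemma orbs_subset:
  assumes "R \<subseteq> D \<times> D" "C \<in> orbs D R"
  shows "C \<subseteq> D"
proof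
  fix x assume "x \<in> C"
  with assms obtain p where "p \<in> D" "(p, x) \<in> R\<^sup>*" by (auto simp: orbs_def)
  then show "x \<in> D" using assms(1) by (auto elim: rtrancl_closed)
qed

lemma partition_on_orbs:
  assumes "R \<subseteq> D \<times> D" "sym R"
  shows "partition_on D (orbs D R)"
proof (rule partition_onI)
  show "\<Union> (orbs D R) = D"
    using orbs_subset[OF assms(1)] by (auto simp: orbs_def)
  show "{} \<notin> orbs D R" by (auto simp: orbs_def)
  fix p q assume "p \<in> orbs D R" "q \<in> orbs D R" "p \<noteq> q"
  then show "disjnt p q"
    using assms(2) by (auto simp: orbs_def disjnt_def) (meson rtrancl_sym rtrancl_trans)+
qed

lemma orb_eq:
  assumes "sym R" "C \<in> orbs D R" "x \<in> C"
  shows "C = R\<^sup>* `` {x}"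
  using assms rtrancl_Image_eq[OF assms(1)] by (auto simp: orbs_def)

lemma orbs_closed_mem:
  assumes "C \<in> orbs D R" "x \<in> C" "(x, y) \<in> R\<^sup>*"
  shows "y \<in> C"
  using assms by (auto simp: orbs_def intro: rtrancl_trans)

text \<open>Sending an orbit \<open>C\<close> of \<open>R'\<close> to the
  \<open>R\<close>-saturation of its image under \<open>h\<close> reaches every orbit of
  \<open>R\<close>: the orbit of \<open>g x\<close> goes to the orbit of \<open>x\<close>.
  Equalities of orbit counts come from two uses with \<open>g\<close> and \<open>h\<close>
  exchanged.\<close>

lemma card_orbs_le:
  assumes "finite D'" "sym R" "sym R'"
    and g: "\<And>x. x \<in> D \<Longrightarrow> g x \<in> D'"
    and h: "\<And>x y. (x, y) \<in> R' \<Longrightarrow> (h x, h y) \<in> R\<^sup>*"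
    and hg: "\<And>x. x \<in> D \<Longrightarrow> (h (g x), x) \<in> R\<^sup>*"
  shows "card (orbs D R) \<le> card (orbs D' R')"
proof (rule surj_card_le)
  show "finite (orbs D' R')" using assms(1) by (rule finite_orbs)
  show "orbs D R \<subseteq> (\<lambda>C. R\<^sup>* `` (h ` C)) ` orbs D' R'"
  proof
    fix C assume "C \<in> orbs D R"
    then obtain x where x: "x \<in> D" "C = R\<^sup>* `` {x}" by (auto simp: orbs_def)
    have "R\<^sup>* `` (h ` (R'\<^sup>* `` {g x})) = R\<^sup>* `` {x}"
    proof
      show "R\<^sup>* `` (h ` (R'\<^sup>* `` {g x})) \<subseteq> R\<^sup>* `` {x}"
      proof
        fix z assume "z \<in> R\<^sup>* `` (h ` (R'\<^sup>* `` {g x}))"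
        then obtain y where y: "(g x, y) \<in> R'\<^sup>*" "(h y, z) \<in> R\<^sup>*" by auto
        have "(h (g x), h y) \<in> R\<^sup>*" using y(1) h by (rule rtrancl_map)
        then show "z \<in> R\<^sup>* `` {x}"
          using hg[OF x(1)] y(2) assms(2) by (auto intro: rtrancl_trans rtrancl_sym)
      qed
      have "h (g x) \<in> h ` (R'\<^sup>* `` {g x})" by auto
      then show "R\<^sup>* `` {x} \<subseteq> R\<^sup>* `` (h ` (R'\<^sup>* `` {g x}))"
        using hg[OF x(1)] by (auto intro: rtrancl_trans)
    qed
    then show "C \<in> (\<lambda>C. R\<^sup>* `` (h ` C)) ` orbs D' R'"
      using x g by (auto simp: orbs_def)
  qed
qed

lemma card_orbs_insert:
  assumes "finite D" "sym R" "a \<in> D" "b \<in> D" "(a, b) \<notin> R\<^sup>*"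
  shows "card (orbs D (R \<union> {(a, b), (b, a)})) + 1 = card (orbs D R)"
proof -
  define S where "S = R \<union> {(a, b), (b, a)}"
  define A where "A = R\<^sup>* `` {a}"
  define B where "B = R\<^sup>* `` {b}"
  have symS: "sym S" using assms(2) by (auto simp: S_def sym_def)
  have RS: "R\<^sup>* \<subseteq> S\<^sup>*" unfolding S_def by (rule rtrancl_mono) blast
  \<comment> \<open>A path that crosses the new link has entered \<open>A\<close> or
    \<open>B\<close>, and it cannot leave their union.\<close>
  have reach: "y \<in> A \<union> B \<or> (x, y) \<in> R\<^sup>*" if "(x, y) \<in> S\<^sup>*" for x y
    using that
  proof (induction rule: rtrancl_induct)
    case (step y z)
    then show ?case
      by (auto simp: S_def A_def B_def intro: rtrancl.rtrancl_into_rtrancl)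
  qed auto
  have reach2: "x \<in> A \<union> B" if "(x, y) \<in> S\<^sup>*" "y \<in> A \<union> B" for x y
    using reach[OF rtrancl_sym[OF symS that(1)]] that(2)
    by (auto simp: A_def B_def intro: rtrancl_trans rtrancl_sym[OF assms(2)])
  have out: "S\<^sup>* `` {x} = R\<^sup>* `` {x}" if "x \<notin> A \<union> B" for x
    using reach reach2 that RS by blast
  have ab: "S\<^sup>* `` {x} = A \<union> B" if "x \<in> A \<union> B" for x
  proof -
    have "(a, b) \<in> S\<^sup>*" by (auto simp: S_def)
    moreover have "(x, a) \<in> S\<^sup>* \<or> (x, b) \<in> S\<^sup>*"
      using that RS rtrancl_sym[OF assms(2)] by (auto simp: A_def B_def)
    ultimately have xab: "(x, a) \<in> S\<^sup>*" "(x, b) \<in> S\<^sup>*"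
      using symS by (meson rtrancl_sym rtrancl_trans)+
    have "A \<union> B \<subseteq> S\<^sup>* `` {x}"
      using xab RS by (auto simp: A_def B_def intro: rtrancl_trans)
    moreover have "S\<^sup>* `` {x} \<subseteq> A \<union> B"
      using reach2 that symS by (blast dest: rtrancl_sym)
    ultimately show ?thesis by blast
  qed
  have AB: "A \<in> orbs D R" "B \<in> orbs D R" "A \<noteq> B"
    using assms by (auto simp: A_def B_def orbs_def)
  have inA: "C \<in> {A, B}" if "C \<in> orbs D R" "x \<in> C" "x \<in> A \<union> B" for C x
    using orb_eq[OF assms(2)] AB that by blast
  have "orbs D S = insert (A \<union> B) (orbs D R - {A, B})"
  proof
    show "orbs D S \<subseteq> insert (A \<union> B) (orbs D R - {A, B})"
    proof
      fix C assume "C \<in> orbs D S"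
      then obtain x where x: "x \<in> D" "C = S\<^sup>* `` {x}" by (auto simp: orbs_def)
      show "C \<in> insert (A \<union> B) (orbs D R - {A, B})"
      proof (cases "x \<in> A \<union> B")
        case True then show ?thesis using ab x by auto
      next
        case False
        then have "C = R\<^sup>* `` {x}" "x \<in> C" using out x by auto
        with x False show ?thesis by (auto simp: orbs_def)
      qed
    qed
    show "insert (A \<union> B) (orbs D R - {A, B}) \<subseteq> orbs D S"
    proof -
      have "a \<in> A" by (auto simp: A_def)
      then have "A \<union> B = S\<^sup>* `` {a}" using ab by simp
      then have "A \<union> B \<in> orbs D S" using assms(3) by (auto simp: orbs_def)
      moreover have "C \<in> orbs D S" if C: "C \<in> orbs D R - {A, B}" for C
      proof -
        obtain x where x: "x \<in> D" "C = R\<^sup>* `` {x}" using C by (auto simp: orbs_def)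
        then have "x \<notin> A \<union> B" using inA[of C x] C by auto
        then show ?thesis using x out by (auto simp: orbs_def)
      qed
      ultimately show ?thesis by auto
    qed
  qed
  moreover have "A \<union> B \<notin> orbs D R - {A, B}"
  proof
    assume asm: "A \<union> B \<in> orbs D R - {A, B}"
    have "a \<in> A \<union> B" by (auto simp: A_def)
    then show False using inA[of "A \<union> B" a] asm by auto
  qed
  moreover have "card (orbs D R - {A, B}) + 2 = card (orbs D R)"
  proof -
    have "card {A, B} \<le> card (orbs D R)" using AB by (intro card_mono finite_orbs assms) auto
    moreover have "card (orbs D R - {A, B}) = card (orbs D R) - card {A, B}"
      using AB by (intro card_Diff_subset) auto
    ultimately show ?thesis using AB(3) by simp
  qed
  ultimately show ?thesis using finite_orbs[OF assms(1)] by (simp add: S_def)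
qed

lemma even_card_pairing:
  assumes "finite D" "pairing_on D f"
  shows "even (card D)"
  using assms
proof (induction "card D" arbitrary: D rule: less_induct)
  case less
  show ?case
  proof (cases "D = {}")
    case False
    then obtain x where x: "x \<in> D" by auto
    note p = pairing_onD[OF less.prems(2)]
    have "pairing_on (D - {x, f x}) f"
      unfolding pairing_on_def using p x by (metis Diff_iff insert_iff empty_iff)
    moreover have c: "card D = card (D - {x, f x}) + 2"
    proof -
      have sub: "{x, f x} \<subseteq> D" and two: "card {x, f x} = 2" using p[OF x] x by auto
      have "card {x, f x} \<le> card D" using sub less.prems(1) by (rule card_mono[rotated])
      then show ?thesis using card_Diff_subset[OF _ sub] two by simp
    qed
    ultimately show ?thesis using less.hyps[of "D - {x, f x}"] less.prems(1) by simp
  qed simp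
qed

text \<open>The points of \<open>K\<close>, which \<open>g\<close> leaves unmatched, are the ends of paths.\<close>

lemma even_card_ends:
  assumes D: "finite D" and f: "pairing_on D f" and gg: "\<And>x. x \<in> D - K \<Longrightarrow> g x \<in> D - K"
    "\<And>x. x \<in> D - K \<Longrightarrow> g x \<noteq> x" "\<And>x. x \<in> D - K \<Longrightarrow> g (g x) = x"
    and C: "C = ({(x, f x) | x. x \<in> D} \<union> {(x, g x) | x. x \<in> D - K})\<^sup>* `` {a}" and a: "a \<in> D"
  shows "even (card (C \<inter> K))"
proof -
  let ?R = "{(x, f x) | x. x \<in> D} \<union> {(x, g x) | x. x \<in> D - K}"
  have CD: "C \<subseteq> D"
  proof
    fix x assume "x \<in> C"
    then have "(a, x) \<in> ?R\<^sup>*" by (simp add: C)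
    then show "x \<in> D" using a by (rule rtrancl_closed) (use f gg in \<open>auto simp: pairing_on_def\<close>)
  qed
  have cl: "y \<in> C" if "x \<in> C" "(x, y) \<in> ?R" for x y
    using that unfolding C by (auto intro: rtrancl.rtrancl_into_rtrancl)
  have "pairing_on C f"
    unfolding pairing_on_def using CD cl pairing_onD[OF f] by blast
  then have "even (card C)" using CD D by (blast intro: even_card_pairing finite_subset)
  moreover have "pairing_on (C - K) g"
    unfolding pairing_on_def using CD cl gg by blast
  then have "even (card (C - K))" using CD D by (blast intro: even_card_pairing finite_subset)
  moreover have "card C = card (C - K) + card (C \<inter> K)"
    using CD D by (metis card_Int_Diff add.commute finite_subset)
  ultimately show ?thesis by simp
qed

section \<open>Points, edges and boundary of a ribbon graph\<close>

lemma ribbonD: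
  assumes "ribbon G"
  shows "finite (pts G)" "pairing_on (pts G) (seg G)" "pairing_on (pts G) (arc G)"
    "live G \<subseteq> pts G" "pairing_on (live G) (seg G)" "pairing_on (live G) (side G)"
    "\<And>p. p \<in> live G \<Longrightarrow> side G p \<noteq> seg G p"
    "\<And>p. p \<in> live G \<Longrightarrow> side G (seg G p) = seg G (side G p)"
  using assms by (auto simp: ribbon_def)

definition corners :: "ribbon_graph \<Rightarrow> nat \<Rightarrow> nat set" where
  "corners G p = {p, seg G p, side G p, seg G (side G p)}"

lemma edges_eq: "edges G = corners G ` live G"
  by (simp add: edges_def corners_def)

lemma vertices_eq: "vertices G = orbs (pts G) (step (pts G) (seg G) (arc G))"
  by (simp add: vertices_def circles_eq_orbs)

lemma corners_cases:
  assumes "q \<in> corners G p"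
  obtains "q = p" | "q = seg G p" | "q = side G p" | "q = seg G (side G p)"
  using assms by (auto simp: corners_def)

lemma corners_subset_live:
  assumes "ribbon G" "p \<in> live G"
  shows "corners G p \<subseteq> live G"
  using assms(2) pairing_onD(1)[OF ribbonD(5)[OF assms(1)]] pairing_onD(1)[OF ribbonD(6)[OF assms(1)]]
  unfolding corners_def by blast

text \<open>On \<open>live\<close>, \<open>seg\<close> and \<open>side\<close> are commuting
  involutions, so the corners of an edge are an orbit of a Klein four-group and each of them
  recovers the edge.\<close>

lemma corners_eq:
  assumes "ribbon G" "p \<in> live G" "q \<in> corners G p"
  shows "corners G q = corners G p"
proof -
  note s = pairing_onD[OF ribbonD(5)[OF assms(1)]]
  note t = pairing_onD[OF ribbonD(6)[OF assms(1)]]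
  note c = ribbonD(8)[OF assms(1)]
  have "side G (side G p) = p" "seg G (seg G p) = p" "side G (seg G p) = seg G (side G p)"
    "side G p \<in> live G" using assms(2) s t c by blast+
  moreover from this have "seg G (seg G (side G p)) = side G p"
    "side G (seg G (side G p)) = seg G p" using s c by metis+
  ultimately show ?thesis using assms(3) by (elim corners_cases) (auto simp: corners_def)
qed

lemma partition_on_edges:
  assumes "ribbon G"
  shows "partition_on (live G) (edges G)"
proof (rule partition_onI)
  show "\<Union> (edges G) = live G"
  proof
    show "\<Union> (edges G) \<subseteq> live G" using corners_subset_live[OF assms] by (auto simp: edges_eq)
    show "live G \<subseteq> \<Union> (edges G)" unfolding edges_eq corners_def by blast
  qed
  show "{} \<notin> edges G" by (auto simp: edges_eq corners_def)
  fix e f assume "e \<in> edges G" "f \<in> edges G" "e \<noteq> f"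
  then show "disjnt e f"
    using corners_eq[OF assms] unfolding edges_eq disjnt_def by blast
qed

lemma partition_on_vertices:
  assumes "ribbon G"
  shows "partition_on (pts G) (vertices G)"
  unfolding vertices_eq using ribbonD[OF assms]
  by (intro partition_on_orbs step_subset sym_step)

lemma finite_edges: "ribbon G \<Longrightarrow> finite (edges G)"
  using ribbonD(1,4)[of G] by (auto simp: edges_eq intro: finite_subset)

lemma finite_vertices: "ribbon G \<Longrightarrow> finite (vertices G)"
  using ribbonD(1) by (auto simp: vertices_eq intro: finite_orbs)

lemma partition_on_mem_eq:
  "partition_on D P \<Longrightarrow> A \<in> P \<Longrightarrow> B \<in> P \<Longrightarrow> x \<in> A \<Longrightarrow> x \<in> B \<Longrightarrow> A = B"
  by (metis IntI disjointD emptyE partition_onD2)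

lemma vertex_closed:
  assumes "ribbon G" "v \<in> vertices G" "x \<in> v"
  shows "seg G x \<in> v" "arc G x \<in> v" "x \<in> pts G"
proof -
  show "x \<in> pts G" using partition_on_vertices[OF assms(1)] assms(2,3) by (auto simp: partition_on_def)
  then have "(x, seg G x) \<in> step (pts G) (seg G) (arc G)" "(x, arc G x) \<in> step (pts G) (seg G) (arc G)"
    by (auto intro: step_fst step_snd)
  then show "seg G x \<in> v" "arc G x \<in> v"
    using orbs_closed_mem[OF assms(2)[unfolded vertices_eq] assms(3)] by blast+
qed

lemma edge_closed:
  assumes "ribbon G" "e \<in> edges G" "x \<in> e"
  shows "seg G x \<in> e" "side G x \<in> e" "x \<in> live G" "x \<in> pts G" "e = corners G x"
proof -
  from assms obtain p where p: "p \<in> live G" "e = corners G p" by (auto simp: edges_eq)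
  then show x: "x \<in> live G" using assms corners_subset_live by blast
  then show "x \<in> pts G" using ribbonD(4)[OF assms(1)] by auto
  show e: "e = corners G x" using corners_eq[OF assms(1) p(1)] p(2) assms(3) by simp
  show "seg G x \<in> e" "side G x \<in> e" unfolding e by (auto simp: corners_def)
qed

lemma edge_of_point:
  assumes "ribbon G" "x \<in> live G"
  shows "corners G x \<in> edges G" "x \<in> corners G x"
  using assms by (auto simp: edges_eq corners_def)

lemma edges_Union_closed:
  assumes "ribbon G" "A \<subseteq> edges G" "x \<in> \<Union>A"
  shows "seg G x \<in> \<Union>A" "side G x \<in> \<Union>A" "x \<in> live G"
  using assms edge_closed[OF assms(1)] by blast+

lemma edges_Union_closed_out:
  assumes "ribbon G" "A \<subseteq> edges G" "x \<in> pts G - \<Union>A"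
  shows "seg G x \<in> pts G - \<Union>A"
proof -
  note p = pairing_onD[OF ribbonD(2)[OF assms(1)]]
  show ?thesis using edges_Union_closed[OF assms(1,2), of "seg G x"] p[of x] assms(3) by auto
qed

lemma edge_disjoint_Union:
  assumes "ribbon G" "A \<subseteq> edges G" "e \<in> edges G" "x \<in> e" "x \<in> \<Union>A"
  shows "e \<in> A"
  using assms partition_on_mem_eq[OF partition_on_edges[OF assms(1)], of e] by blast

lemma Union_edges_Diff:
  assumes "ribbon G" "A \<subseteq> edges G"
  shows "\<Union>(edges G - A) = live G - \<Union>A"
proof -
  have "\<Union>(edges G) = live G" using partition_on_edges[OF assms(1)] by (simp add: partition_on_def)
  then show ?thesis using assms(2) edge_disjoint_Union[OF assms] by blast
qed

section \<open>Boundary components of spanning subgraphs\<close>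

definition turn :: "ribbon_graph \<Rightarrow> nat set set \<Rightarrow> nat \<Rightarrow> nat" where
  "turn G A p = (if p \<in> \<Union>A then side G p else seg G p)"

text \<open>The subset \<open>A\<close> is a parameter of the turning rule on a fixed graph.
  Contraction of an edge then amounts to inserting it into \<open>A\<close>, with the set of points
  unchanged.\<close>

definition bd_rel :: "ribbon_graph \<Rightarrow> nat set set \<Rightarrow> (nat \<times> nat) set" where
  "bd_rel G A = step (pts G) (turn G A) (arc G)"

definition num_bd :: "ribbon_graph \<Rightarrow> nat set set \<Rightarrow> nat" where
  "num_bd G A = card (orbs (pts G) (bd_rel G A))"

lemma card_boundary_components: "card (boundary_components (spanning G A)) = num_bd G A"
proof -
  have "(\<lambda>p. if p \<in> live (spanning G A) then side (spanning G A) p else seg (spanning G A) p) = turn G A"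
    by (auto simp: spanning_def turn_def)
  then show ?thesis
    unfolding boundary_components_def circles_eq_orbs num_bd_def bd_rel_def by (simp add: spanning_def)
qed

lemma pairing_on_turn:
  assumes "ribbon G" "A \<subseteq> edges G"
  shows "pairing_on (pts G) (turn G A)"
  unfolding pairing_on_def
proof
  fix p assume p: "p \<in> pts G"
  note s = pairing_onD[OF ribbonD(2)[OF assms(1)]]
  note t = pairing_onD[OF ribbonD(6)[OF assms(1)]]
  show "turn G A p \<in> pts G \<and> turn G A p \<noteq> p \<and> turn G A (turn G A p) = p"
  proof (cases "p \<in> \<Union>A")
    case True
    then show ?thesis
      using edges_Union_closed[OF assms True] edges_Union_closed(3)[OF assms] t[of p] ribbonD(4)[OF assms(1)]
      by (auto simp: turn_def)
  next
    case False
    then show ?thesis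
      using edges_Union_closed_out[OF assms, of p] s[of p] p by (auto simp: turn_def)
  qed
qed

lemma sym_bd_rel:
  assumes "ribbon G" "A \<subseteq> edges G"
  shows "sym (bd_rel G A)"
  unfolding bd_rel_def by (intro sym_step pairing_on_turn assms ribbonD)

lemma num_bd_empty: "num_bd G {} = card (vertices G)"
proof -
  have "turn G {} = seg G" by (auto simp: turn_def)
  then show ?thesis by (simp add: num_bd_def bd_rel_def vertices_eq)
qed

lemma rho_eq:
  "rho G A = (of_nat (card A) + of_nat (num_bd G {}) - of_nat (num_bd G A)) / 2"
  by (simp add: rho_def card_boundary_components num_bd_empty)

text \<open>The graph on the blocks is replaced by links between points: within a block, and between
  the corners of an edge. Its components are thereby counted on the same set \<open>pts G\<close> as
  the boundary components, a set that contraction preserves although it changes vertices and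
  blocks.\<close>

definition block_rel :: "nat set set set \<Rightarrow> nat set set \<Rightarrow> (nat \<times> nat) set" where
  "block_rel P A = linked (Union ` P \<union> A)"

definition num_blocks :: "ribbon_graph \<Rightarrow> nat set set set \<Rightarrow> nat set set \<Rightarrow> nat" where
  "num_blocks G P A = card (orbs (pts G) (block_rel P A))"

lemma sym_block_rel: "sym (block_rel P A)"
  by (simp add: block_rel_def sym_linked)

lemma block_rel_block: "B \<in> P \<Longrightarrow> v \<in> B \<Longrightarrow> w \<in> B \<Longrightarrow> x \<in> v \<Longrightarrow> y \<in> w \<Longrightarrow> (x, y) \<in> block_rel P A"
  by (auto simp: block_rel_def intro!: linkedI)

lemma block_rel_edge: "e \<in> A \<Longrightarrow> x \<in> e \<Longrightarrow> y \<in> e \<Longrightarrow> (x, y) \<in> block_rel P A"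
  by (auto simp: block_rel_def intro!: linkedI)

lemma block_relE:
  assumes "(x, y) \<in> block_rel P A"
  obtains (block) B v w where "B \<in> P" "v \<in> B" "w \<in> B" "x \<in> v" "y \<in> w"
    | (edge) e where "e \<in> A" "x \<in> e" "y \<in> e"
  using assms by (auto simp: block_rel_def linked_def)

lemma vrgD:
  assumes "vrg (G, P)"
  shows "ribbon G" "partition_on (vertices G) P"
  using assms by (auto simp: vrg_def)

lemma vrg_blockD:
  assumes "vrg (G, P)" "B \<in> P" "v \<in> B"
  shows "v \<in> vertices G"
  using vrgD[OF assms(1)] assms(2,3) by (auto simp: partition_on_def)

lemma vrg_point_block:
  assumes "vrg (G, P)" "x \<in> pts G"
  obtains v B where "x \<in> v" "v \<in> B" "B \<in> P" "v \<in> vertices G"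
  using assms vrgD[OF assms(1)] partition_on_vertices[OF vrgD(1)[OF assms(1)]]
  unfolding partition_on_def by (metis UnionE)

lemma vertex_nonempty: "ribbon G \<Longrightarrow> v \<in> vertices G \<Longrightarrow> v \<noteq> {}"
  using partition_on_vertices by (auto simp: partition_on_def)

lemma block_rel_subset:
  assumes "vrg (G, P)" "A \<subseteq> edges G"
  shows "block_rel P A \<subseteq> pts G \<times> pts G"
proof -
  have "x \<in> pts G \<and> y \<in> pts G" if "(x, y) \<in> block_rel P A" for x y
    using that
    by (cases rule: block_relE)
       (use assms vrg_blockD[OF assms(1)] vertex_closed(3) edge_closed(4) vrgD[OF assms(1)] in blast)+
  then show ?thesis by auto
qed

lemma edges_spanning:
  assumes rb: "ribbon G" and A: "A \<subseteq> edges G"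
  shows "edges (spanning G A) = A"
proof
  have "e = corners G p" if "p \<in> e" "e \<in> A" for e p
    using edge_closed(5)[OF rb] that A by blast
  then have "corners G p \<in> A" if "p \<in> \<Union>A" for p using that by auto
  moreover have "edges (spanning G A) = corners G ` \<Union>A"
    by (simp add: edges_def spanning_def corners_def image_def)
  ultimately show "edges (spanning G A) \<subseteq> A" by auto
  show "A \<subseteq> edges (spanning G A)"
  proof
    fix e assume e: "e \<in> A"
    then obtain p where "p \<in> e" using A by (auto simp: edges_eq corners_def)
    then have "e = corners G p" "p \<in> \<Union>A" using e A edge_closed(5)[OF rb] by blast+
    then show "e \<in> edges (spanning G A)"
      using \<open>edges (spanning G A) = corners G ` \<Union>A\<close> by auto
  qed
qed

text \<open>Both inequalities follow from \<open>card_orbs_le\<close>, sending a block to some point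
  \<open>g B\<close> of it and a point to its block \<open>h x\<close>. Two blocks adjacent through
  \<open>e\<close> correspond to three links between points: inside the first block, across
  \<open>e\<close>, inside the second block.\<close>

lemma card_components_identify:
  assumes X: "vrg (G, P)" and A: "A \<subseteq> edges G"
  shows "card (components (identify_blocks (underlying_graph (spanning G A)) P)) = num_blocks G P A"
proof -
  note rb = vrgD(1)[OF X]
  note ed = edges_spanning[OF rb A]
  have en: "ends (spanning G A) = ends G"
    by (auto simp: ends_def vertices_def spanning_def fun_eq_iff)
  define R where "R = {(a, b). \<exists>e\<in>A. a \<in> {B \<in> P. B \<inter> ends G e \<noteq> {}} \<and> b \<in> {B \<in> P. B \<inter> ends G e \<noteq> {}}}"
  have RP: "R \<subseteq> P \<times> P" and symR: "sym R" by (auto simp: R_def sym_def)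
  have "components (identify_blocks (underlying_graph (spanning G A)) P) =
      P // {(x, y). x \<in> P \<and> y \<in> P \<and> (x, y) \<in> R\<^sup>*}"
    by (simp add: components_def identify_blocks_def underlying_graph_def ed en R_def)
  also have "\<dots> = orbs P R"
  proof -
    have cl: "y \<in> P" if "(x, y) \<in> R\<^sup>*" "x \<in> P" for x y
      using that by (rule rtrancl_closed) (use RP in blast)
    have "{(x, y). x \<in> P \<and> y \<in> P \<and> (x, y) \<in> R\<^sup>*} `` {x} = R\<^sup>* `` {x}" if "x \<in> P" for x
      using that cl by blast
    then have "(\<lambda>x. {(x, y). x \<in> P \<and> y \<in> P \<and> (x, y) \<in> R\<^sup>*} `` {x}) ` P = (\<lambda>x. R\<^sup>* `` {x}) ` P"
      by (rule image_cong[OF refl])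
    then show ?thesis by (simp add: quotient_def orbs_def UNION_singleton_eq_range)
  qed
  finally have comp: "components (identify_blocks (underlying_graph (spanning G A)) P) = orbs P R" .
  have finP: "finite P"
    using finite_vertices[OF rb] vrgD(2)[OF X] by (rule finite_elements)
  define g where "g B = (SOME x. x \<in> \<Union>B)" for B :: "nat set set"
  have g: "g B \<in> \<Union>B" if "B \<in> P" for B
  proof -
    have "B \<noteq> {}" using vrgD(2)[OF X] that by (auto simp: partition_on_def)
    then obtain v where "v \<in> B" by auto
    then have "v \<noteq> {}" using vrg_blockD[OF X that] vertex_nonempty[OF rb] by auto
    with \<open>v \<in> B\<close> show ?thesis unfolding g_def some_in_eq by auto
  qed
  have gp: "g B \<in> pts G" if "B \<in> P" for B
    using g[OF that] vrg_blockD[OF X that] vertex_closed(3)[OF rb] by blast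
  define h where "h x = (SOME B. B \<in> P \<and> x \<in> \<Union>B)" for x
  have uniq: "B = B'" if "B \<in> P" "B' \<in> P" "x \<in> \<Union>B" "x \<in> \<Union>B'" for x B B'
  proof -
    from that obtain v v' where v: "v \<in> B" "v' \<in> B'" "x \<in> v" "x \<in> v'" by auto
    then have "v = v'"
      using partition_on_mem_eq[OF partition_on_vertices[OF rb]
          vrg_blockD[OF X that(1) v(1)] vrg_blockD[OF X that(2) v(2)]] by simp
    then show ?thesis using partition_on_mem_eq[OF vrgD(2)[OF X] that(1,2), of v] v by simp
  qed
  have h: "h x \<in> P" "x \<in> \<Union>(h x)" if "x \<in> pts G" for x
  proof -
    have "\<exists>B. B \<in> P \<and> x \<in> \<Union>B" using vrg_point_block[OF X that] by blast
    then show "h x \<in> P" "x \<in> \<Union>(h x)" unfolding h_def by (metis (mono_tags, lifting) someI_ex)+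
  qed
  have hB: "h x = B" if "B \<in> P" "x \<in> \<Union>B" for x B
  proof -
    have "x \<in> pts G" using that vrg_blockD[OF X] vertex_closed(3)[OF rb] by blast
    then show ?thesis using uniq[OF h(1) that(1) h(2) that(2)] by simp
  qed
  have "card (orbs P R) \<le> card (orbs (pts G) (block_rel P A))"
  proof (rule card_orbs_le[where g = g and h = h])
    fix x y assume xy: "(x, y) \<in> block_rel P A"
    then have pts: "x \<in> pts G" "y \<in> pts G" using block_rel_subset[OF X A] by auto
    from xy show "(h x, h y) \<in> R\<^sup>*"
    proof (cases rule: block_relE)
      case (block B v w)
      then have "h x = B" "h y = B" by (auto intro!: hB)
      then show ?thesis by simp
    next
      case (edge e)
      have "h z \<inter> ends G e \<noteq> {}" if "z \<in> e" "z \<in> pts G" for z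
      proof -
        from h[OF that(2)] obtain v where "v \<in> h z" "z \<in> v" by auto
        then have "v \<in> ends G e" using that vrg_blockD[OF X h(1)] by (auto simp: ends_def)
        then show ?thesis using \<open>v \<in> h z\<close> by auto
      qed
      then have "h x \<inter> ends G e \<noteq> {}" "h y \<inter> ends G e \<noteq> {}" using edge pts by simp_all
      then have "(h x, h y) \<in> R" using edge(1) h(1)[OF pts(1)] h(1)[OF pts(2)] unfolding R_def by blast
      then show ?thesis by blast
    qed
  qed (use symR sym_block_rel ribbonD(1)[OF rb] gp hB g in auto)
  moreover have "card (orbs (pts G) (block_rel P A)) \<le> card (orbs P R)"
  proof (rule card_orbs_le[where g = h and h = g])
    fix B B' assume "(B, B') \<in> R"
    then obtain e where e: "e \<in> A" "B \<in> P" "B \<inter> ends G e \<noteq> {}" "B' \<in> P" "B' \<inter> ends G e \<noteq> {}"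
      by (auto simp: R_def)
    then obtain v x v' x' where v: "v \<in> B" "x \<in> v" "x \<in> e" "v' \<in> B'" "x' \<in> v'" "x' \<in> e"
      by (auto simp: ends_def)
    have "(g B, x) \<in> block_rel P A" "(x', g B') \<in> block_rel P A" 
      using g[OF e(2)] g[OF e(4)] e v by (auto intro: block_rel_block)
    moreover have "(x, x') \<in> block_rel P A" using e v by (auto intro: block_rel_edge)
    ultimately show "(g B, g B') \<in> (block_rel P A)\<^sup>*" by (blast intro: rtrancl_3)
  next
    fix x assume x: "x \<in> pts G"
    have "(g (h x), x) \<in> block_rel P A"
      using g[OF h(1)[OF x]] h[OF x] by (auto intro: block_rel_block)
    then show "(g (h x), x) \<in> (block_rel P A)\<^sup>*" by blast
  qed (use symR sym_block_rel finP h in auto)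
  ultimately show ?thesis by (simp add: comp num_blocks_def)
qed

lemma num_blocks_empty:
  assumes "vrg (G, P)"
  shows "num_blocks G P {} = card P"
proof -
  have "components (identify_blocks (underlying_graph (spanning G {})) P) =
      P // {(x, y). x \<in> P \<and> y \<in> P \<and> (x, y) \<in> {}\<^sup>*}"
    by (simp add: components_def identify_blocks_def underlying_graph_def edges_def spanning_def)
  also have "\<dots> = (\<lambda>x. {x}) ` P" by (auto simp: quotient_def)
  finally show ?thesis
    using card_components_identify[OF assms, of "{}"] by (simp add: card_image inj_on_def)
qed

lemma num_blocks_antimono:
  assumes "vrg (G, P)" "A \<subseteq> B"
  shows "num_blocks G P B \<le> num_blocks G P A"
  unfolding num_blocks_def
proof (rule card_orbs_le[where g = id and h = id])
  fix x y assume "(x, y) \<in> block_rel P A"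
  then have "(x, y) \<in> block_rel P B" using assms(2) by (auto simp: block_rel_def linked_def)
  then show "(id x, id y) \<in> (block_rel P B)\<^sup>*" by auto
qed (use assms vrgD ribbonD(1) sym_block_rel in auto)

lemma part_rank_eq:
  assumes "vrg (G, P)" "A \<subseteq> edges G"
  shows "part_rank G P A = num_blocks G P {} - num_blocks G P A"
  using card_components_identify[OF assms] num_blocks_empty[OF assms(1)]
  by (simp add: part_rank_def graph_rank_def identify_blocks_def)

text \<open>The rank is a truncated difference of natural numbers; since linking along more edges
  cannot create classes, nothing is cut off, and the rank can be used additively.\<close>

lemma part_rank_add:
  assumes "vrg (G, P)" "A \<subseteq> edges G"
  shows "part_rank G P A + num_blocks G P A = num_blocks G P {}"
  using part_rank_eq[OF assms] num_blocks_antimono[OF assms(1), of "{}" A] by simp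

section \<open>Contraction and deletion\<close>

lemma contract_ribbon_simps [simp]:
  "pts (contract_ribbon e G) = pts G" "arc (contract_ribbon e G) = arc G"
  "side (contract_ribbon e G) = side G" "live (contract_ribbon e G) = live G - e"
  by (simp_all add: contract_ribbon_def)

lemma seg_contract_ribbon: "seg (contract_ribbon e G) = turn G {e}"
  by (simp add: contract_ribbon_def turn_def fun_eq_iff)

text \<open>The segment map of the contracted graph already follows the sides of \<open>e\<close>.
  All additivity of \<open>rho\<close> under contraction rests on this identity.\<close>

lemma turn_contract_ribbon: "turn (contract_ribbon e G) B = turn G (insert e B)"
  by (auto simp: turn_def seg_contract_ribbon fun_eq_iff)

lemma num_bd_contract: "num_bd (contract_ribbon e G) B = num_bd G (insert e B)"
  by (simp add: num_bd_def bd_rel_def turn_contract_ribbon)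

lemma ribbon_contract:
  assumes "ribbon G" "e \<in> edges G"
  shows "ribbon (contract_ribbon e G)"
proof -
  let ?H = "contract_ribbon e G"
  have e1: "{e} \<subseteq> edges G" using assms(2) by simp
  note s = pairing_onD[OF ribbonD(5)[OF assms(1)]]
  note t = pairing_onD[OF ribbonD(6)[OF assms(1)]]
  have seg: "seg ?H p = seg G p" if "p \<notin> e" for p
    using that by (simp add: seg_contract_ribbon turn_def)
  have out: "seg G p \<in> live G - e" "side G p \<in> live G - e" if "p \<in> live G - e" for p
    using that s[of p] t[of p] edge_closed[OF assms] by (metis Diff_iff)+
  have "pairing_on (pts G) (seg ?H)"
    unfolding seg_contract_ribbon using assms(1) e1 by (rule pairing_on_turn)
  moreover have "pairing_on (live G - e) (seg ?H)" "pairing_on (live G - e) (side G)"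
    unfolding pairing_on_def using s t out seg by auto
  moreover have "\<forall>p\<in>live G - e. side G p \<noteq> seg ?H p \<and> side G (seg ?H p) = seg ?H (side G p)"
    using out seg ribbonD(7,8)[OF assms(1)] by auto
  ultimately show ?thesis
    using ribbonD(1,3,4)[OF assms(1)] unfolding ribbon_def by auto
qed

lemma edges_contract:
  assumes "ribbon G" "e \<in> edges G"
  shows "edges (contract_ribbon e G) = edges G - {e}"
proof -
  have "corners (contract_ribbon e G) p = corners G p" if "p \<in> live G - e" for p
  proof -
    have "side G p \<notin> e"
      using that edge_closed(2)[OF assms, of "side G p"] pairing_onD(3)[OF ribbonD(6)[OF assms(1)]]
      by auto
    then show ?thesis using that by (simp add: corners_def seg_contract_ribbon turn_def)
  qed
  then have "edges (contract_ribbon e G) = corners G ` (live G - e)"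
    by (simp add: edges_eq)
  also have "\<dots> = edges G - {e}"
  proof
    show "corners G ` (live G - e) \<subseteq> edges G - {e}"
      using edge_of_point[OF assms(1)] by blast
    show "edges G - {e} \<subseteq> corners G ` (live G - e)"
    proof
      fix f assume f: "f \<in> edges G - {e}"
      then obtain p where p: "p \<in> live G" "f = corners G p" by (auto simp: edges_eq)
      moreover from this have "p \<notin> e"
        using f edge_closed(5)[OF assms] by blast
      ultimately show "f \<in> corners G ` (live G - e)" by auto
    qed
  qed
  finally show ?thesis .
qed

text \<open>Cut the path after its last \<open>f\<close>-step from a point of \<open>e\<close>,
  which ends in \<open>e\<close> again. From there on \<open>f\<close> and \<open>f'\<close> agree
  along it.\<close>

lemma orb_switch:
  assumes "(p, x) \<in> (step D f g)\<^sup>*" "p \<in> e" "\<And>y. y \<in> e \<Longrightarrow> f y \<in> e" "\<And>y. y \<notin> e \<Longrightarrow> f y = f' y"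
  shows "\<exists>q\<in>e. (q, x) \<in> (step D f' g)\<^sup>*"
  using assms(1)
proof (induction rule: rtrancl_induct)
  case base
  then show ?case using assms(2) by blast
next
  case (step y z)
  then obtain q where q: "q \<in> e" "(q, y) \<in> (step D f' g)\<^sup>*" by blast
  from step(2) show ?case
  proof (cases rule: stepE)
    case 1
    show ?thesis
    proof (cases "y \<in> e")
      case True
      then show ?thesis using assms(3) 1 by blast
    next
      case False
      then have "(y, z) \<in> step D f' g" using 1 assms(4) by (auto simp: step_def)
      then show ?thesis using q by (meson rtrancl.rtrancl_into_rtrancl)
    qed
  next
    case 2
    then have "(y, z) \<in> step D f' g" by (auto simp: step_def)
    then show ?thesis using q by (meson rtrancl.rtrancl_into_rtrancl)
  qed
qed

lemma orbs_switch_disjoint: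
  assumes "C \<in> orbs D (step D f g)" "C \<inter> e = {}" "\<And>y. y \<notin> e \<Longrightarrow> f y = f' y"
  shows "C \<in> orbs D (step D f' g)"
proof -
  obtain x where x: "x \<in> D" "C = (step D f g)\<^sup>* `` {x}" using assms(1) by (auto simp: orbs_def)
  have same: "(y, z) \<in> step D f g \<longleftrightarrow> (y, z) \<in> step D f' g" if "y \<in> C" for y z
  proof -
    have "f y = f' y" using that assms(2) by (intro assms(3)) auto
    then show ?thesis by (auto simp: step_def)
  qed
  have "(x, y) \<in> (step D f' g)\<^sup>*" if "(x, y) \<in> (step D f g)\<^sup>*" for y
    using that
  proof (induction rule: rtrancl_induct)
    case (step y z)
    then have "y \<in> C" by (simp add: x)
    then show ?case using step same by (meson rtrancl.rtrancl_into_rtrancl)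
  qed simp
  moreover have "(x, y) \<in> (step D f g)\<^sup>*" if "(x, y) \<in> (step D f' g)\<^sup>*" for y
    using that
  proof (induction rule: rtrancl_induct)
    case (step y z)
    then have "y \<in> C" by (simp add: x)
    then show ?case using step same by (meson rtrancl.rtrancl_into_rtrancl)
  qed simp
  ultimately have "C = (step D f' g)\<^sup>* `` {x}" using x by auto
  then show ?thesis using x by (auto simp: orbs_def)
qed

lemma Union_orbs_meeting:
  assumes "sym R" "e \<subseteq> D"
  shows "\<Union>{C \<in> orbs D R. C \<inter> e \<noteq> {}} = {x. \<exists>p\<in>e. (p, x) \<in> R\<^sup>*}"
proof
  show "\<Union>{C \<in> orbs D R. C \<inter> e \<noteq> {}} \<subseteq> {x. \<exists>p\<in>e. (p, x) \<in> R\<^sup>*}"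
    using orb_eq[OF assms(1)] by blast
  show "{x. \<exists>p\<in>e. (p, x) \<in> R\<^sup>*} \<subseteq> \<Union>{C \<in> orbs D R. C \<inter> e \<noteq> {}}"
    using assms(2) by (force simp: orbs_def)
qed

text \<open>Only circles through corners of \<open>e\<close> are affected. Before and after the
  contraction their union is the set of points reachable from \<open>e\<close>, which
  \<open>orb_switch\<close> shows to be the same; circles that avoid \<open>e\<close> are literally
  unchanged.\<close>

lemma contract_vertices:
  assumes "ribbon G" "e \<in> edges G"
  defines "H \<equiv> contract_ribbon e G"
  shows "\<Union>(ends H e) = \<Union>(ends G e)" "vertices H - ends H e = vertices G - ends G e"
    "e \<subseteq> \<Union>(ends G e)" "ends H e \<noteq> {}"
proof -
  let ?V = "step (pts G) (seg G) (arc G)" and ?W = "step (pts G) (turn G {e}) (arc G)"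
  have V: "vertices G = orbs (pts G) ?V" by (rule vertices_eq)
  have W: "vertices H = orbs (pts G) ?W" by (simp add: vertices_eq H_def seg_contract_ribbon)
  have e1: "{e} \<subseteq> edges G" using assms(2) by simp
  have sV: "sym ?V" and sW: "sym ?W"
    using assms(1) e1 by (auto intro!: sym_step pairing_on_turn ribbonD)
  have ep: "e \<subseteq> pts G" using edge_closed(4)[OF assms(1,2)] by blast
  have cl: "\<And>y. y \<in> e \<Longrightarrow> seg G y \<in> e" "\<And>y. y \<in> e \<Longrightarrow> turn G {e} y \<in> e"
    using edge_closed[OF assms(1,2)] by (auto simp: turn_def)
  have eq: "\<And>y. y \<notin> e \<Longrightarrow> seg G y = turn G {e} y" by (simp add: turn_def)
  have UV: "\<Union>(ends G e) = {x. \<exists>p\<in>e. (p, x) \<in> ?V\<^sup>*}"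
    unfolding ends_def V by (rule Union_orbs_meeting[OF sV ep])
  have UW: "\<Union>(ends H e) = {x. \<exists>p\<in>e. (p, x) \<in> ?W\<^sup>*}"
    unfolding ends_def W by (rule Union_orbs_meeting[OF sW ep])
  show U: "\<Union>(ends H e) = \<Union>(ends G e)"
    unfolding UV UW using cl eq by (auto intro: orb_switch)
  show e: "e \<subseteq> \<Union>(ends G e)" unfolding UV by blast
  have "e \<noteq> {}" using assms(2) by (auto simp: edges_eq corners_def)
  then show "ends H e \<noteq> {}" using e U by auto
  show "vertices H - ends H e = vertices G - ends G e"
    unfolding ends_def V W
    using orbs_switch_disjoint[where f = "seg G" and f' = "turn G {e}" and e = e and D = "pts G" and g = "arc G"]
      orbs_switch_disjoint[where f' = "seg G" and f = "turn G {e}" and e = e and D = "pts G" and g = "arc G"] eq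
    by auto
qed

lemma vrg_contract:
  assumes X: "vrg (G, P)" and e: "e \<in> edges G"
  shows "vrg (contract_ribbon e G, contract_partition e G P)"
proof -
  let ?H = "contract_ribbon e G"
  note rb = vrgD(1)[OF X] and pt = vrgD(2)[OF X]
  note cv = contract_vertices[OF rb e]
  define M where "M = \<Union>{B \<in> P. B \<inter> ends G e \<noteq> {}}"
  define N where "N = (M - ends G e) \<union> ends ?H e"
  have P': "contract_partition e G P = {B \<in> P. B \<inter> ends G e = {}} \<union> {N}"
    by (simp add: contract_partition_def N_def M_def)
  have UP: "\<Union>P = vertices G" using pt by (simp add: partition_on_def)
  have eV: "ends G e \<subseteq> vertices G" "ends ?H e \<subseteq> vertices ?H" by (auto simp: ends_def)
  have VH: "vertices ?H = (vertices G - ends G e) \<union> ends ?H e" using cv(2) eV by blast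
  have "partition_on (vertices ?H) (contract_partition e G P)"
  proof (rule partition_onI)
    have "\<Union>{B \<in> P. B \<inter> ends G e = {}} \<union> (M - ends G e) = vertices G - ends G e"
      unfolding M_def UP[symmetric] by blast
    then show "\<Union> (contract_partition e G P) = vertices ?H"
      unfolding P' VH N_def by blast
    show "{} \<notin> contract_partition e G P"
      using pt cv(4) by (auto simp: P' N_def partition_on_def)
    have BN: "disjnt B N" if B: "B \<in> P" "B \<inter> ends G e = {}" for B
    proof -
      have "B \<inter> M = {}"
        using partition_on_mem_eq[OF pt B(1)] B unfolding M_def by blast
      moreover have "B \<inter> ends ?H e = {}"
        using B UP cv(2) by blast
      ultimately show ?thesis by (auto simp: N_def disjnt_def)
    qed
    fix p q assume "p \<in> contract_partition e G P" "q \<in> contract_partition e G P" "p \<noteq> q"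
    moreover have "disjnt p q" if "p \<in> P" "q \<in> P" "p \<noteq> q"
      using partition_on_mem_eq[OF pt that(1,2)] that(3) by (auto simp: disjnt_def)
    ultimately show "disjnt p q" using BN by (auto simp: P' disjnt_sym)
  qed
  then show ?thesis using ribbon_contract[OF rb e] by (simp add: vrg_def)
qed

text \<open>The new block \<open>N\<close> ties together the blocks that contain the ends of
  \<open>e\<close>, and linking the corners of \<open>e\<close> in the old graph does the same. So
  the two relations have the same closure.\<close>

lemma num_blocks_contract:
  assumes X: "vrg (G, P)" and e: "e \<in> edges G"
  shows "num_blocks (contract_ribbon e G) (contract_partition e G P) B = num_blocks G P (insert e B)"
proof -
  let ?H = "contract_ribbon e G" and ?P = "contract_partition e G P"
  note rb = vrgD(1)[OF X] and pt = vrgD(2)[OF X]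
  note cv = contract_vertices[OF rb e]
  define N where "N = (\<Union>{B \<in> P. B \<inter> ends G e \<noteq> {}} - ends G e) \<union> ends ?H e"
  have P': "?P = {B \<in> P. B \<inter> ends G e = {}} \<union> {N}"
    by (simp add: contract_partition_def N_def)
  let ?R = "block_rel P (insert e B)" and ?S = "block_rel ?P B"
  \<comment> \<open>A new vertex lies in the union of the old ends of \<open>e\<close>, and a
    surviving vertex of \<open>N\<close> shares an old block with one of these ends; either way one
    link leads to a corner of \<open>e\<close>.\<close>
  have toe: "\<exists>p\<in>e. (x, p) \<in> ?R" if v: "v \<in> N" "x \<in> v" for v x
  proof (cases "v \<in> ends ?H e")
    case True
    then have "x \<in> \<Union>(ends G e)" using v cv(1) by blast
    then obtain u p where u: "u \<in> ends G e" "x \<in> u" "p \<in> u" "p \<in> e"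
      by (auto simp: ends_def)
    then obtain B0 where "B0 \<in> P" "u \<in> B0" using pt unfolding ends_def partition_on_def by blast
    then have "(x, p) \<in> ?R" using block_rel_block[OF _ _ _ u(2,3)] by blast
    then show ?thesis using u(4) by blast
  next
    case False
    then obtain B0 u where B0: "B0 \<in> P" "v \<in> B0" "u \<in> B0" "u \<in> ends G e" using v by (auto simp: N_def)
    then obtain p where p: "p \<in> u" "p \<in> e" by (auto simp: ends_def)
    then have "(x, p) \<in> ?R" using block_rel_block[OF B0(1-3) v(2) p(1)] by blast
    then show ?thesis using p(2) by blast
  qed
  have fromN: "\<exists>v\<in>N. x \<in> v" if "C \<in> P" "C \<inter> ends G e \<noteq> {}" "v \<in> C" "x \<in> v" for C v x
  proof (cases "v \<in> ends G e")
    case True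
    then have "x \<in> \<Union>(ends ?H e)" using cv(1) that by auto
    then show ?thesis by (auto simp: N_def)
  next
    case False
    then show ?thesis using that by (auto simp: N_def)
  qed
  have "?S \<subseteq> ?R\<^sup>*"
  proof (clarify)
    fix x y assume "(x, y) \<in> ?S"
    then show "(x, y) \<in> ?R\<^sup>*"
    proof (cases rule: block_relE)
      case (block C v w)
      show ?thesis
      proof (cases "C \<in> P")
        case True
        then show ?thesis using block by (auto intro: block_rel_block)
      next
        case False
        then have "C = N" using block P' by auto
        then obtain p where p: "p \<in> e" "(x, p) \<in> ?R" using toe block(2,4) by blast
        obtain q where q: "q \<in> e" "(y, q) \<in> ?R" using \<open>C = N\<close> toe block(3,5) by blast
        note pq = p q
        have "(p, q) \<in> ?R" using pq by (auto intro: block_rel_edge)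
        moreover have "(q, y) \<in> ?R" using symD[OF sym_block_rel pq(4)] .
        ultimately show ?thesis using pq(2) by (blast intro: rtrancl_3)
      qed
    next
      case (edge f)
      then have "(x, y) \<in> ?R" by (auto intro: block_rel_edge)
      then show ?thesis by blast
    qed
  qed
  moreover have "?R \<subseteq> ?S\<^sup>*"
  proof (clarify)
    fix x y assume "(x, y) \<in> ?R"
    then have "(x, y) \<in> ?S"
    proof (cases rule: block_relE)
      case (block C v w)
      show ?thesis
      proof (cases "C \<inter> ends G e = {}")
        case True
        then have "C \<in> ?P" using block P' by auto
        then show ?thesis using block(2-5) by (rule block_rel_block)
      next
        case False
        obtain v' where v': "v' \<in> N" "x \<in> v'" using fromN[OF block(1) False block(2,4)] by blast
        obtain w' where w': "w' \<in> N" "y \<in> w'" using fromN[OF block(1) False block(3,5)] by blast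
        have "N \<in> ?P" using P' by simp
        then show ?thesis using v'(1) w'(1) v'(2) w'(2) by (rule block_rel_block)
      qed
    next
      case (edge f)
      show ?thesis
      proof (cases "f = e")
        case True
        then have "x \<in> \<Union>(ends ?H e)" "y \<in> \<Union>(ends ?H e)" using edge cv(1,3) by auto
        then obtain v' w' where "v' \<in> N" "w' \<in> N" "x \<in> v'" "y \<in> w'" by (auto simp: N_def)
        moreover have "N \<in> ?P" using P' by simp
        ultimately show ?thesis by (metis block_rel_block)
      next
        case False
        then show ?thesis using edge by (auto intro: block_rel_edge)
      qed
    qed
    then show "(x, y) \<in> ?S\<^sup>*" by blast
  qed
  ultimately have "?R\<^sup>* = ?S\<^sup>*" by (intro rtrancl_eqI)
  then have "orbs (pts G) ?R = orbs (pts G) ?S" by (rule orbs_cong)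
  then show ?thesis by (simp add: num_blocks_def)
qed

text \<open>Boundary counts of the contracted graph are counts of the old one with \<open>e\<close>
  inserted, so only the baseline of the drop moves, from the empty subset to \<open>{e}\<close>; the
  number of edges changes by one on both sides.\<close>

lemma rho_contract:
  assumes "ribbon G" "e \<in> edges G" "B \<subseteq> edges G - {e}"
  shows "rho (contract_ribbon e G) B = rho G (insert e B) - rho G {e}"
proof -
  have "finite B" "e \<notin> B" using assms finite_subset[OF _ finite_edges[OF assms(1)], of B] by auto
  then show ?thesis by (simp add: rho_eq num_bd_contract field_simps)
qed

lemma part_rank_contract:
  assumes "vrg (G, P)" "e \<in> edges G" "B \<subseteq> edges G - {e}"
  shows "part_rank (contract_ribbon e G) (contract_partition e G P) B + part_rank G P {e} =
    part_rank G P (insert e B)"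
proof -
  let ?H = "contract_ribbon e G" and ?P = "contract_partition e G P"
  have "B \<subseteq> edges ?H" using assms(3) edges_contract[OF vrgD(1)[OF assms(1)] assms(2)] by simp
  then have "part_rank ?H ?P B + num_blocks G P (insert e B) = num_blocks G P {e}"
    using part_rank_add[OF vrg_contract[OF assms(1,2)]] num_blocks_contract[OF assms(1,2)] by simp
  moreover have "part_rank G P {e} + num_blocks G P {e} = num_blocks G P {}"
    "part_rank G P (insert e B) + num_blocks G P (insert e B) = num_blocks G P {}"
    using assms by (auto intro!: part_rank_add)
  ultimately show ?thesis by linarith
qed

text \<open>A contraction is remembered only through its edges and its two rank functions. Weights
  depend on nothing else, so the order of contraction picked by \<open>for_edges\<close> does not
  matter.\<close>

definition contraction_of :: "nat set set \<Rightarrow> part_ribbon_graph \<Rightarrow> part_ribbon_graph \<Rightarrow> bool" where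
  "contraction_of A X Y \<longleftrightarrow> vrg Y \<and> edges (fst Y) = edges (fst X) - A \<and>
    (\<forall>B\<subseteq>edges (fst Y). rho (fst Y) B + rho (fst X) A = rho (fst X) (B \<union> A) \<and>
     part_rank (fst Y) (snd Y) B + part_rank (fst X) (snd X) A = part_rank (fst X) (snd X) (B \<union> A))"

lemma contraction_ofD:
  assumes "contraction_of A X Y"
  shows "vrg Y" "edges (fst Y) = edges (fst X) - A"
    "B \<subseteq> edges (fst Y) \<Longrightarrow> rho (fst Y) B + rho (fst X) A = rho (fst X) (B \<union> A)"
    "B \<subseteq> edges (fst Y) \<Longrightarrow> part_rank (fst Y) (snd Y) B + part_rank (fst X) (snd X) A
      = part_rank (fst X) (snd X) (B \<union> A)"
  using assms by (auto simp: contraction_of_def)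

lemma fold_contract:
  assumes "vrg X" "distinct es" "set es \<subseteq> edges (fst X)"
  shows "contraction_of (set es) X (fold contract es X)"
  using assms
proof (induction es arbitrary: X)
  case Nil
  obtain G P where X: "X = (G, P)" by fastforce
  have "part_rank G P {} = 0" using part_rank_add[of G P "{}"] Nil X by simp
  then show ?case using Nil X by (simp add: contraction_of_def rho_eq)
next
  case (Cons e es)
  obtain G P where X: "X = (G, P)" by fastforce
  let ?X = "contract e X" and ?Z = "fold contract es (contract e X)"
  have e: "e \<in> edges G" and XG: "vrg (G, P)" and rb: "ribbon G"
    using Cons.prems X vrgD by auto
  have cX: "?X = (contract_ribbon e G, contract_partition e G P)" by (simp add: contract_def X)
  have eX: "edges (fst ?X) = edges G - {e}" by (simp add: cX edges_contract[OF rb e])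
  have es: "set es \<subseteq> edges G - {e}" using Cons.prems X by auto
  have "vrg ?X" using vrg_contract[OF XG e] by (simp add: cX)
  then have IH: "contraction_of (set es) ?X ?Z" using Cons.IH Cons.prems es eX by auto
  then have Z: "vrg ?Z" "edges (fst ?Z) = edges G - {e} - set es" using contraction_ofD(1,2)[OF IH] eX by simp_all
  have "rho (fst ?Z) B + rho G (insert e (set es)) = rho G (B \<union> insert e (set es)) \<and>
    part_rank (fst ?Z) (snd ?Z) B + part_rank G P (insert e (set es)) = part_rank G P (B \<union> insert e (set es))"
    if B: "B \<subseteq> edges (fst ?Z)" for B
  proof -
    \<comment> \<open>The single-edge formulas are used twice, for \<open>set es\<close> and for its
      union with \<open>B\<close>; in the difference the contribution of \<open>e\<close>
      cancels.\<close>
    have Bes: "B \<union> set es \<subseteq> edges G - {e}" using B Z(2) es by auto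
    show ?thesis
      using contraction_ofD(3,4)[OF IH B] rho_contract[OF rb e es] rho_contract[OF rb e Bes]
        part_rank_contract[OF XG e es] part_rank_contract[OF XG e Bes]
      by (simp add: cX)
  qed
  then show ?case using Z by (auto simp: X contraction_of_def)
qed

section \<open>Contracting and deleting a set of edges\<close>

lemma for_edges_enum:
  assumes "finite A"
  obtains es where "distinct es" "set es = A" "for_edges f A X = fold f es X"
  using someI_ex[of "\<lambda>es. distinct es \<and> set es = A"] finite_distinct_list[OF assms]
  unfolding for_edges_def by blast

lemma for_edges_contract:
  assumes "vrg X" "A \<subseteq> edges (fst X)"
  shows "contraction_of A X (for_edges contract A X)"
proof -
  have "finite A"
    using assms finite_subset[OF assms(2)] finite_edges by (auto simp: vrg_def)
  then obtain es where es: "distinct es" "set es = A" "for_edges contract A X = fold contract es X"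
    by (rule for_edges_enum)
  then show ?thesis using fold_contract[OF assms(1) es(1)] assms(2) by simp
qed

lemma fold_delete: "fold delete es (G, P) = (G\<lparr>live := live G - \<Union>(set es)\<rparr>, P)"
  by (induction es arbitrary: G) (auto simp: delete_def Diff_eq Int_assoc)

lemma for_edges_delete:
  assumes "ribbon G" "A \<subseteq> edges G"
  shows "for_edges delete (edges G - A) (G, P) = (spanning G A, P)"
proof -
  have "finite (edges G - A)" using finite_edges[OF assms(1)] by simp
  then obtain es where es: "set es = edges G - A" "for_edges delete (edges G - A) (G, P) = fold delete es (G, P)"
    by (rule for_edges_enum)
  have "\<Union>(edges G - A) = live G - \<Union>A" using assms by (rule Union_edges_Diff)
  moreover have "\<Union>A \<subseteq> live G" using edges_Union_closed[OF assms] by blast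
  ultimately show ?thesis
    unfolding es(2) fold_delete es(1) by (simp add: spanning_def double_diff)
qed

lemma ribbon_spanning:
  assumes "ribbon G" "A \<subseteq> edges G"
  shows "ribbon (spanning G A)"
proof -
  have A: "\<Union>A \<subseteq> live G" using edges_Union_closed[OF assms] by blast
  have "pairing_on (\<Union>A) (seg G)"
    unfolding pairing_on_def
    using edges_Union_closed(1,3)[OF assms] pairing_onD(2,3)[OF ribbonD(5)[OF assms(1)]] by simp
  moreover have "pairing_on (\<Union>A) (side G)"
    unfolding pairing_on_def
    using edges_Union_closed(2,3)[OF assms] pairing_onD(2,3)[OF ribbonD(6)[OF assms(1)]] by simp
  moreover have "\<Union>A \<subseteq> pts G" using A ribbonD(4)[OF assms(1)] by simp
  moreover have "\<forall>p\<in>\<Union>A. side G p \<noteq> seg G p \<and> side G (seg G p) = seg G (side G p)"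
    using A ribbonD(7,8)[OF assms(1)] by blast
  ultimately show ?thesis
    using ribbonD(1-3)[OF assms(1)] unfolding ribbon_def
    by (simp del: Union_iff add: spanning_def)
qed

lemma vrg_spanning: "vrg (G, P) \<Longrightarrow> A \<subseteq> edges G \<Longrightarrow> vrg (spanning G A, P)"
  using ribbon_spanning[of G A] by (simp add: vrg_def) (simp add: spanning_def vertices_def)

lemma spanning_spanning [simp]: "spanning (spanning G A) B = spanning G B"
  by (simp add: spanning_def)

lemma rho_spanning: "rho (spanning G A) B = rho G B"
  unfolding rho_def by simp (simp add: spanning_def vertices_def)

lemma part_rank_spanning: "part_rank (spanning G A) P B = part_rank G P B"
  by (simp add: part_rank_def)

section \<open>Invariance under isomorphism\<close>

text \<open>Agreement is required on every edge subset, because sums over subsets are to be moved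
  from a representative to another. Ranks are compared and not orbit counts, since joins and
  edgeless summands shift the counts.\<close>

definition same_ranks :: "part_ribbon_graph \<Rightarrow> part_ribbon_graph \<Rightarrow> bool" where
  "same_ranks X Y \<longleftrightarrow> vrg X \<and> vrg Y \<and>
     (\<exists>\<theta>. bij_betw \<theta> (edges (fst X)) (edges (fst Y)) \<and>
       (\<forall>A\<subseteq>edges (fst X). rho (fst Y) (\<theta> ` A) = rho (fst X) A \<and>
          part_rank (fst Y) (snd Y) (\<theta> ` A) = part_rank (fst X) (snd X) A))"

lemma same_ranks_sym:
  assumes "same_ranks X Y"
  shows "same_ranks Y X"
proof -
  obtain \<theta> where th: "bij_betw \<theta> (edges (fst X)) (edges (fst Y))"
    "\<And>A. A \<subseteq> edges (fst X) \<Longrightarrow> rho (fst Y) (\<theta> ` A) = rho (fst X) A \<and>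
          part_rank (fst Y) (snd Y) (\<theta> ` A) = part_rank (fst X) (snd X) A"
    using assms by (auto simp: same_ranks_def)
  let ?i = "inv_into (edges (fst X)) \<theta>"
  have "rho (fst X) (?i ` B) = rho (fst Y) B \<and>
      part_rank (fst X) (snd X) (?i ` B) = part_rank (fst Y) (snd Y) B"
    if "B \<subseteq> edges (fst Y)" for B
  proof -
    have "?i ` B \<subseteq> edges (fst X)" "\<theta> ` ?i ` B = B"
      using that th(1) image_inv_into_cancel[of \<theta> "edges (fst X)" "edges (fst Y)" B]
        image_mono[OF that, of ?i] bij_betw_inv_into[OF th(1)]
      by (simp_all add: bij_betw_def)
    then show ?thesis using th(2)[of "?i ` B"] by simp
  qed
  then show ?thesis
    using assms bij_betw_inv_into[OF th(1)] unfolding same_ranks_def by blast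
qed

lemma same_ranks_trans:
  assumes "same_ranks X Y" "same_ranks Y Z"
  shows "same_ranks X Z"
proof -
  obtain \<theta> where th: "bij_betw \<theta> (edges (fst X)) (edges (fst Y))"
    "\<And>A. A \<subseteq> edges (fst X) \<Longrightarrow> rho (fst Y) (\<theta> ` A) = rho (fst X) A \<and>
          part_rank (fst Y) (snd Y) (\<theta> ` A) = part_rank (fst X) (snd X) A"
    using assms by (auto simp: same_ranks_def)
  obtain \<eta> where et: "bij_betw \<eta> (edges (fst Y)) (edges (fst Z))"
    "\<And>A. A \<subseteq> edges (fst Y) \<Longrightarrow> rho (fst Z) (\<eta> ` A) = rho (fst Y) A \<and>
          part_rank (fst Z) (snd Z) (\<eta> ` A) = part_rank (fst Y) (snd Y) A"
    using assms by (auto simp: same_ranks_def)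
  have "bij_betw (\<eta> \<circ> \<theta>) (edges (fst X)) (edges (fst Z))"
    using th(1) et(1) by (rule bij_betw_trans)
  moreover have "rho (fst Z) ((\<eta> \<circ> \<theta>) ` A) = rho (fst X) A \<and>
      part_rank (fst Z) (snd Z) ((\<eta> \<circ> \<theta>) ` A) = part_rank (fst X) (snd X) A"
    if "A \<subseteq> edges (fst X)" for A
  proof -
    have "\<theta> ` A \<subseteq> edges (fst Y)" using that th(1) by (auto simp: bij_betw_def)
    then show ?thesis using th(2)[OF that] et(2)[of "\<theta> ` A"] by (simp add: image_comp[symmetric] del: o_apply)
  qed
  ultimately show ?thesis using assms unfolding same_ranks_def by blast
qed

text \<open>One step past a segment that carries no edge. The walk is deterministic and stops at the
  first point of \<open>live\<close>; a free arc is an \<open>arc\<close> step followed by such a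
  walk.\<close>

definition walk :: "ribbon_graph \<Rightarrow> (nat \<times> nat) set" where
  "walk G = {(x, arc G (seg G x)) | x. x \<in> pts G - live G}"

text \<open>The first live points met when leaving \<open>x\<close> in the two directions along the
  vertex boundary. The set is constant along a stretch of segments without edges, and it is empty
  exactly on vertices without edges.\<close>

definition nearby :: "ribbon_graph \<Rightarrow> nat \<Rightarrow> nat set" where
  "nearby G x = {q \<in> live G. (x, q) \<in> (walk G)\<^sup>* \<or> (arc G x, q) \<in> (walk G)\<^sup>*}"

definition vertex_of :: "ribbon_graph \<Rightarrow> nat \<Rightarrow> nat set" where
  "vertex_of G x = (step (pts G) (seg G) (arc G))\<^sup>* `` {x}"

lemma free_arcs_iff:
  "(p, q) \<in> free_arcs G \<longleftrightarrow> p \<in> live G \<and> q \<in> live G \<and> (arc G p, q) \<in> (walk G)\<^sup>*"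
  by (auto simp: free_arcs_def walk_def)

lemma walk_live:
  assumes "(p, q) \<in> (walk G)\<^sup>*" "p \<in> live G"
  shows "q = p"
  using assms by (cases rule: converse_rtranclE) (auto simp: walk_def)

lemma walk_nonlive:
  assumes "x \<in> pts G - live G" "q \<in> live G"
  shows "(x, q) \<in> (walk G)\<^sup>* \<longleftrightarrow> (arc G (seg G x), q) \<in> (walk G)\<^sup>*"
proof
  assume "(x, q) \<in> (walk G)\<^sup>*"
  then show "(arc G (seg G x), q) \<in> (walk G)\<^sup>*"
    using assms by (cases rule: converse_rtranclE) (auto simp: walk_def)
next
  have "(x, arc G (seg G x)) \<in> walk G" using assms by (auto simp: walk_def)
  then show "(arc G (seg G x), q) \<in> (walk G)\<^sup>* \<Longrightarrow> (x, q) \<in> (walk G)\<^sup>*"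
    by (rule converse_rtrancl_into_rtrancl)
qed

lemma seg_nonlive:
  assumes "ribbon G" "x \<in> pts G - live G"
  shows "seg G x \<in> pts G - live G"
  using assms(2) pairing_onD[OF ribbonD(2)[OF assms(1)]] pairing_onD[OF ribbonD(5)[OF assms(1)]]
  by (metis Diff_iff)

lemma nearby_arc:
  assumes "ribbon G" "x \<in> pts G"
  shows "nearby G (arc G x) = nearby G x"
  using pairing_onD[OF ribbonD(3)[OF assms(1)] assms(2)] by (auto simp: nearby_def)

lemma nearby_seg:
  assumes "ribbon G" "x \<in> pts G - live G"
  shows "nearby G (seg G x) = nearby G x"
proof -
  have "seg G (seg G x) = x" using pairing_onD(3)[OF ribbonD(2)[OF assms(1)]] assms(2) by simp
  then show ?thesis
    using walk_nonlive[OF assms(2)] walk_nonlive[OF seg_nonlive[OF assms]]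
    by (auto simp: nearby_def)
qed

lemma nearby_live:
  assumes "p \<in> live G"
  shows "nearby G p = insert p {q. (p, q) \<in> free_arcs G}"
  using assms walk_live[of p _ G] by (auto simp: nearby_def free_arcs_iff)

text \<open>A segment outside \<open>live\<close> carries no edge of any \<open>A\<close>, so in
  every spanning subgraph the boundary runs along it. Hence moving a point to a nearby live one
  keeps its boundary component, whatever \<open>A\<close> is.\<close>

lemma walk_subset_bd_rel:
  assumes "ribbon G" "A \<subseteq> edges G"
  shows "(walk G)\<^sup>* \<subseteq> (bd_rel G A)\<^sup>*"
proof (rule rtrancl_subset_rtrancl, rule subsetI)
  fix z assume "z \<in> walk G"
  then obtain x where x: "z = (x, arc G (seg G x))" "x \<in> pts G - live G" by (auto simp: walk_def)
  then have "x \<notin> \<Union>A" using edges_Union_closed(3)[OF assms] by blast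
  then have "turn G A x = seg G x" by (simp add: turn_def)
  then have "(x, seg G x) \<in> bd_rel G A" "(seg G x, arc G (seg G x)) \<in> bd_rel G A"
    using x seg_nonlive[OF assms(1)] by (auto simp: bd_rel_def step_def)
  then show "z \<in> (bd_rel G A)\<^sup>*" using x(1) by (meson converse_rtrancl_into_rtrancl r_into_rtrancl)
qed

lemma nearby_bd_rel:
  assumes "ribbon G" "A \<subseteq> edges G" "x \<in> pts G" "q \<in> nearby G x"
  shows "(x, q) \<in> (bd_rel G A)\<^sup>*"
proof -
  have "(x, arc G x) \<in> bd_rel G A" using assms(3) by (auto simp: bd_rel_def step_def)
  then show ?thesis
    using assms(4) walk_subset_bd_rel[OF assms(1,2)] 
    by (auto simp: nearby_def intro: converse_rtrancl_into_rtrancl)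
qed

lemma vertex_of_mem: "x \<in> vertex_of G x"
  by (auto simp: vertex_of_def)

lemma vertex_of_vertex: "x \<in> pts G \<Longrightarrow> vertex_of G x \<in> vertices G"
  by (auto simp: vertex_of_def vertices_eq orbs_def)

lemma vertex_of_eq:
  assumes "ribbon G" "v \<in> vertices G" "x \<in> v"
  shows "vertex_of G x = v"
  using assms partition_on_mem_eq[OF partition_on_vertices[OF assms(1)]]
    vertex_of_mem vertex_of_vertex vertex_closed(3)[OF assms] by metis

lemma vertex_of_eq_bd_rel: "(x, y) \<in> (bd_rel G {})\<^sup>* \<longleftrightarrow> y \<in> vertex_of G x"
proof -
  have "turn G {} = seg G" by (auto simp: turn_def)
  then show ?thesis by (simp add: bd_rel_def vertex_of_def)
qed

lemma nearby_vertex_of: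
  assumes "ribbon G" "x \<in> pts G"
  shows "nearby G x \<subseteq> vertex_of G x \<inter> live G"
  using nearby_bd_rel[OF assms(1) empty_subsetI assms(2)]
  by (auto simp: vertex_of_eq_bd_rel nearby_def)

text \<open>The boundary of a vertex disc without edges is itself a boundary component, for every
  \<open>A\<close>.\<close>

lemma nearby_empty:
  assumes "ribbon G" "A \<subseteq> edges G" "x \<in> pts G" "nearby G x = {}" "y \<in> vertex_of G x"
  shows "(x, y) \<in> (bd_rel G A)\<^sup>* \<and> nearby G y = {} \<and> y \<in> pts G"
proof -
  have "(x, y) \<in> (step (pts G) (seg G) (arc G))\<^sup>*" using assms(5) by (simp add: vertex_of_def)
  then show ?thesis
  proof (induction rule: rtrancl_induct)
    case base
    then show ?case using assms(3,4) by simp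
  next
    case (step y z)
    then have y: "y \<notin> live G" using nearby_live by fastforce
    then have "y \<notin> \<Union>A" using edges_Union_closed(3)[OF assms(1,2)] by blast
    then have "turn G A y = seg G y" by (simp add: turn_def)
    then have "(y, z) \<in> bd_rel G A" using step(2) by (auto simp: bd_rel_def step_def)
    moreover have "nearby G z = nearby G y" "z \<in> pts G"
      using step y nearby_seg[OF assms(1)] nearby_arc[OF assms(1)] ribbonD(2,3)[OF assms(1)]
      by (auto elim!: stepE dest: pairing_onD)
    ultimately show ?case using step by (auto intro: rtrancl.rtrancl_into_rtrancl)
  qed
qed

section \<open>Transport of points along an isomorphism\<close>

definition iso_data ::
  "part_ribbon_graph \<Rightarrow> part_ribbon_graph \<Rightarrow> (nat set \<Rightarrow> nat set) \<Rightarrow> (nat \<Rightarrow> nat) \<Rightarrow> bool" where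
  "iso_data X Y \<phi> \<psi> \<longleftrightarrow> (case (X, Y) of ((G, P), (H, Q)) \<Rightarrow>
     bij_betw \<phi> (vertices G) (vertices H) \<and>
     bij_betw \<psi> (live G) (live H) \<and>
     (\<forall>v\<in>vertices G. \<psi> ` (v \<inter> live G) = \<phi> v \<inter> live H) \<and>
     (\<forall>p\<in>live G. \<psi> (seg G p) = seg H (\<psi> p) \<and> \<psi> (side G p) = side H (\<psi> p)) \<and>
     (\<forall>p\<in>live G. \<forall>q\<in>live G. (p, q) \<in> free_arcs G \<longleftrightarrow> (\<psi> p, \<psi> q) \<in> free_arcs H) \<and>
     (\<lambda>B. \<phi> ` B) ` P = Q)"

lemma vrg_iso_iff: "vrg_iso X Y \<longleftrightarrow> (\<exists>\<phi> \<psi>. iso_data X Y \<phi> \<psi>)"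
  by (cases X; cases Y) (simp add: vrg_iso_def iso_data_def)

lemma iso_dataD:
  assumes "iso_data (G, P) (H, Q) \<phi> \<psi>"
  shows "bij_betw \<phi> (vertices G) (vertices H)" "bij_betw \<psi> (live G) (live H)"
    "\<And>v. v \<in> vertices G \<Longrightarrow> \<psi> ` (v \<inter> live G) = \<phi> v \<inter> live H"
    "\<And>p. p \<in> live G \<Longrightarrow> \<psi> (seg G p) = seg H (\<psi> p)"
    "\<And>p. p \<in> live G \<Longrightarrow> \<psi> (side G p) = side H (\<psi> p)"
    "\<And>p q. p \<in> live G \<Longrightarrow> q \<in> live G \<Longrightarrow> (\<psi> p, \<psi> q) \<in> free_arcs H \<longleftrightarrow> (p, q) \<in> free_arcs G"
    "(\<lambda>B. \<phi> ` B) ` P = Q" "\<And>p. p \<in> live G \<Longrightarrow> \<psi> p \<in> live H"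
  using assms by (auto simp: iso_data_def bij_betw_def)

lemma iso_data_sym:
  assumes X: "vrg (G, P)" and Y: "vrg (H, Q)" and iso: "iso_data (G, P) (H, Q) \<phi> \<psi>"
  shows "iso_data (H, Q) (G, P) (inv_into (vertices G) \<phi>) (inv_into (live G) \<psi>)"
proof -
  let ?f = "inv_into (vertices G) \<phi>" and ?s = "inv_into (live G) \<psi>"
  note d = iso_dataD[OF iso]
  have f: "\<phi> (?f w) = w" "?f w \<in> vertices G" if "w \<in> vertices H" for w
    using that d(1) by (auto simp: bij_betw_def f_inv_into_f inv_into_into)
  have f': "?f (\<phi> v) = v" if "v \<in> vertices G" for v
    using that d(1) by (auto simp: bij_betw_def)
  have s: "\<psi> (?s q) = q" "?s q \<in> live G" if "q \<in> live H" for q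
    using that d(2) by (auto simp: bij_betw_def f_inv_into_f inv_into_into)
  have s': "?s (\<psi> p) = p" if "p \<in> live G" for p
    using that d(2) by (auto simp: bij_betw_def)
  have "?s ` (w \<inter> live H) = ?f w \<inter> live G" if "w \<in> vertices H" for w
  proof -
    have "w \<inter> live H = \<psi> ` (?f w \<inter> live G)" using d(3)[OF f(2)[OF that]] f(1)[OF that] by simp
    then have "?s ` (w \<inter> live H) = (\<lambda>p. ?s (\<psi> p)) ` (?f w \<inter> live G)" by (simp add: image_image)
    also have "\<dots> = ?f w \<inter> live G" using s' by simp
    finally show ?thesis .
  qed
  moreover have "?s (seg H q) = seg G (?s q)" "?s (side H q) = side G (?s q)" if "q \<in> live H" for q
  proof -
    have "seg G (?s q) \<in> live G" "side G (?s q) \<in> live G"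
      using s(2)[OF that] ribbonD(5,6)[OF vrgD(1)[OF X]] by (auto dest: pairing_onD)
    then show "?s (seg H q) = seg G (?s q)" "?s (side H q) = side G (?s q)"
      using d(4,5)[OF s(2)[OF that]] s(1)[OF that] s' by metis+
  qed
  moreover have "(p, q) \<in> free_arcs H \<longleftrightarrow> (?s p, ?s q) \<in> free_arcs G"
    if "p \<in> live H" "q \<in> live H" for p q
    using d(6)[OF s(2)[OF that(1)] s(2)[OF that(2)]] s(1) that by simp
  moreover have "(\<lambda>B. ?f ` B) ` Q = P"
  proof -
    have "?f ` \<phi> ` B = B" if "B \<in> P" for B
    proof -
      have "?f (\<phi> v) = v" if "v \<in> B" for v using f' vrg_blockD[OF X \<open>B \<in> P\<close> that] by simp
      then show ?thesis by (simp add: image_image)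
    qed
    then show ?thesis unfolding d(7)[symmetric] by (simp add: image_image)
  qed
  ultimately show ?thesis
    using bij_betw_inv_into[OF d(1)] bij_betw_inv_into[OF d(2)] unfolding iso_data_def by auto
qed

lemma iso_inverse_image:
  assumes X: "vrg (G, P)" and iso: "iso_data (G, P) (H, Q) \<phi> \<psi>" and A: "A \<subseteq> edges G"
  shows "(\<lambda>e. inv_into (live G) \<psi> ` e) ` (\<lambda>e. \<psi> ` e) ` A = A"
proof -
  have "inv_into (live G) \<psi> ` \<psi> ` e = e" if "e \<in> A" for e
  proof -
    have "inv_into (live G) \<psi> (\<psi> p) = p" if "p \<in> e" for p
      using iso_dataD(2)[OF iso] edge_closed(3)[OF vrgD(1)[OF X]] A \<open>e \<in> A\<close> that
      by (auto simp: bij_betw_def)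
    then show ?thesis by (simp add: image_image)
  qed
  then show ?thesis by (simp add: image_image)
qed

text \<open>Isomorphisms only see the points in \<open>live\<close>, so a point is first moved along its vertex to a
  point of \<open>live\<close>.  If the vertex has none, any point of the image vertex will do.\<close>

definition transport ::
  "ribbon_graph \<Rightarrow> (nat set \<Rightarrow> nat set) \<Rightarrow> (nat \<Rightarrow> nat) \<Rightarrow> nat \<Rightarrow> nat" where
  "transport G \<phi> \<psi> x = (if nearby G x = {} then SOME y. y \<in> \<phi> (vertex_of G x)
     else \<psi> (SOME q. q \<in> nearby G x))"

lemma transport_nonempty:
  assumes "nearby G x \<noteq> {}"
  obtains q where "q \<in> nearby G x" "transport G \<phi> \<psi> x = \<psi> q"
proof
  show "(SOME q. q \<in> nearby G x) \<in> nearby G x" using assms by (simp add: some_in_eq)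
  show "transport G \<phi> \<psi> x = \<psi> (SOME q. q \<in> nearby G x)" using assms by (simp add: transport_def)
qed

context
  fixes G P H Q \<phi> \<psi>
  assumes X: "vrg (G, P)" and Y: "vrg (H, Q)" and iso: "iso_data (G, P) (H, Q) \<phi> \<psi>"
begin

lemma transport_vertex:
  assumes "x \<in> pts G"
  shows "transport G \<phi> \<psi> x \<in> \<phi> (vertex_of G x)" "\<phi> (vertex_of G x) \<in> vertices H"
    "vertex_of H (transport G \<phi> \<psi> x) = \<phi> (vertex_of G x)" "transport G \<phi> \<psi> x \<in> pts H"
proof -
  note d = iso_dataD[OF iso]
  have v: "vertex_of G x \<in> vertices G" using assms by (rule vertex_of_vertex)
  show vH: "\<phi> (vertex_of G x) \<in> vertices H" using d(1) v by (auto simp: bij_betw_def)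
  show tr: "transport G \<phi> \<psi> x \<in> \<phi> (vertex_of G x)"
  proof (cases "nearby G x = {}")
    case True
    then show ?thesis
      using vertex_nonempty[OF vrgD(1)[OF Y] vH] by (simp add: transport_def some_in_eq)
  next
    case False
    then obtain q where q: "q \<in> nearby G x" "transport G \<phi> \<psi> x = \<psi> q" by (rule transport_nonempty)
    then have "q \<in> vertex_of G x \<inter> live G" using nearby_vertex_of[OF vrgD(1)[OF X] assms] by blast
    then show ?thesis using d(3)[OF v] q(2) by blast
  qed
  show "vertex_of H (transport G \<phi> \<psi> x) = \<phi> (vertex_of G x)"
    using vrgD(1)[OF Y] vH tr by (rule vertex_of_eq)
  show "transport G \<phi> \<psi> x \<in> pts H" using vrgD(1)[OF Y] vH tr by (rule vertex_closed(3))
qed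

text \<open>Even a live point need not be sent to \<open>\<psi> p\<close>, as the choice in
  \<open>transport\<close> may pick the other end of its free arc. The two images are on one
  boundary component.\<close>

lemma transport_live:
  assumes "p \<in> live G"
  obtains q where "q = p \<or> (p, q) \<in> free_arcs G" "q \<in> live G" "transport G \<phi> \<psi> p = \<psi> q"
proof -
  have "nearby G p \<noteq> {}" using nearby_live[OF assms] by auto
  then obtain q where q: "q \<in> nearby G p" "transport G \<phi> \<psi> p = \<psi> q" by (rule transport_nonempty)
  then have "q = p \<or> (p, q) \<in> free_arcs G" using nearby_live[OF assms] by auto
  then show thesis using that q assms by (auto simp: free_arcs_iff)
qed

lemma free_arcs_bd_rel:
  assumes "ribbon K" "A \<subseteq> edges K" "(p, q) \<in> free_arcs K"
  shows "(p, q) \<in> (bd_rel K A)\<^sup>*"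
proof -
  have "p \<in> live K" using assms(3) by (simp add: free_arcs_iff)
  then show ?thesis
    using assms nearby_live[of p K] ribbonD(4)[OF assms(1)] by (intro nearby_bd_rel) auto
qed

lemma iso_edges:
  shows "bij_betw (\<lambda>e. \<psi> ` e) (edges G) (edges H)"
proof -
  note d = iso_dataD[OF iso] and rG = vrgD(1)[OF X] and rH = vrgD(1)[OF Y]
  have "\<psi> ` corners G p = corners H (\<psi> p)" if "p \<in> live G" for p
    using that d(4,5) pairing_onD(1)[OF ribbonD(6)[OF rG]] by (simp add: corners_def)
  then have "(\<lambda>e. \<psi> ` e) ` edges G = corners H ` \<psi> ` live G"
    by (simp add: edges_eq image_image)
  also have "\<psi> ` live G = live H" using d(2) by (simp add: bij_betw_def)
  finally have "(\<lambda>e. \<psi> ` e) ` edges G = edges H" by (simp add: edges_eq)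
  moreover have "inj_on (\<lambda>e. \<psi> ` e) (edges G)"
  proof (rule inj_onI)
    fix e f assume "e \<in> edges G" "f \<in> edges G" "\<psi> ` e = \<psi> ` f"
    moreover have "inj_on \<psi> (live G)" using d(2) by (simp add: bij_betw_def)
    moreover have "e \<subseteq> live G" "f \<subseteq> live G" using calculation edge_closed(3)[OF rG] by blast+
    ultimately show "e = f" by (simp add: inj_on_image_eq_iff)
  qed
  ultimately show ?thesis by (simp add: bij_betw_def)
qed

lemma turn_iso:
  assumes "A \<subseteq> edges G" "p \<in> live G"
  shows "turn H ((\<lambda>e. \<psi> ` e) ` A) (\<psi> p) = \<psi> (turn G A p)"
proof -
  note d = iso_dataD[OF iso]
  have "\<Union>A \<subseteq> live G" using edges_Union_closed(3)[OF vrgD(1)[OF X] assms(1)] by blast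
  then have "\<psi> p \<in> \<psi> ` \<Union>A \<longleftrightarrow> p \<in> \<Union>A"
    using d(2) assms(2) by (auto simp: bij_betw_def dest: inj_onD)
  moreover have "\<Union>((\<lambda>e. \<psi> ` e) ` A) = \<psi> ` \<Union>A" by blast
  ultimately show ?thesis using d(4,5)[OF assms(2)] by (simp add: turn_def)
qed

text \<open>A step along an arc, or along a segment without edge, changes neither the nearby points
  nor the vertex, so the transported point stays the same. Only a step at a live segment moves it,
  and there \<psi> commutes with \<open>turn\<close>; the discrepancy between \<open>\<psi>\<close>
  and \<open>transport\<close> is a free arc at either end.\<close>

lemma transport_bd_rel:
  assumes A: "A \<subseteq> edges G" and xy: "(x, y) \<in> bd_rel G A"
  defines "A' \<equiv> (\<lambda>e. \<psi> ` e) ` A"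
  shows "(transport G \<phi> \<psi> x, transport G \<phi> \<psi> y) \<in> (bd_rel H A')\<^sup>*"
proof -
  note d = iso_dataD[OF iso] and rG = vrgD(1)[OF X] and rH = vrgD(1)[OF Y]
  have A': "A' \<subseteq> edges H" using iso_edges A unfolding A'_def bij_betw_def by blast
  have same: "transport G \<phi> \<psi> x = transport G \<phi> \<psi> y"
    if "x \<in> pts G" "nearby G y = nearby G x" "y \<in> vertex_of G x" for x y
    using that vertex_of_eq[OF rG vertex_of_vertex[OF that(1)] that(3)] by (simp add: transport_def)
  have near: "(\<psi> p, transport G \<phi> \<psi> p) \<in> (bd_rel H A')\<^sup>*" if p: "p \<in> live G" for p
  proof -
    obtain q where q: "q = p \<or> (p, q) \<in> free_arcs G" "q \<in> live G" "transport G \<phi> \<psi> p = \<psi> q"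
      using p by (rule transport_live)
    then have "\<psi> q = \<psi> p \<or> (\<psi> p, \<psi> q) \<in> free_arcs H" using d(6) p by auto
    then show ?thesis using free_arcs_bd_rel[OF rH A'] q(3) by auto
  qed
  have x: "x \<in> pts G" using xy by (auto simp: bd_rel_def step_def)
  have vx: "seg G x \<in> vertex_of G x" "arc G x \<in> vertex_of G x"
    using vertex_closed(1,2)[OF rG vertex_of_vertex[OF x] vertex_of_mem] .
  from xy have "y = turn G A x \<or> y = arc G x" by (auto simp: bd_rel_def step_def)
  then consider "y = arc G x" | "y = turn G A x" "x \<notin> live G" | "y = turn G A x" "x \<in> live G" by blast
  then show ?thesis
  proof cases
    case 1
    then have "transport G \<phi> \<psi> x = transport G \<phi> \<psi> y"
      using nearby_arc[OF rG x] vx x by (intro same) auto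
    then show ?thesis by simp
  next
    case 2
    have "x \<notin> \<Union>A" using edges_Union_closed(3)[OF rG A] 2 by blast
    then have "y = seg G x" using 2 by (simp add: turn_def)
    then have "transport G \<phi> \<psi> x = transport G \<phi> \<psi> y"
      using nearby_seg[OF rG] vx x 2 by (intro same) auto
    then show ?thesis by simp
  next
    case 3
    then have y: "y \<in> live G"
      using ribbonD(5,6)[OF rG] by (auto simp: turn_def dest: pairing_onD)
    have "\<psi> x \<in> pts H" using d(8)[OF 3(2)] ribbonD(4)[OF rH] by auto
    then have "(\<psi> x, turn H A' (\<psi> x)) \<in> bd_rel H A'" by (auto simp: bd_rel_def step_def)
    then have "(\<psi> x, \<psi> y) \<in> bd_rel H A'" using turn_iso[OF A 3(2)] 3(1) by (simp add: A'_def)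
    then show ?thesis
      using rtrancl_trans[OF rtrancl_sym[OF sym_bd_rel[OF rH A'] near[OF 3(2)]]
          rtrancl_trans[OF r_into_rtrancl near[OF y]]] by blast
  qed
qed

lemma vertex_in_block_rel:
  assumes "vrg (K, R)" "v \<in> vertices K" "x \<in> v" "y \<in> v"
  shows "(x, y) \<in> block_rel R A"
proof -
  obtain B where "B \<in> R" "v \<in> B" using vrgD(2)[OF assms(1)] assms(2) by (auto simp: partition_on_def)
  then show ?thesis using assms(3,4) by (auto intro: block_rel_block)
qed

text \<open>Here it suffices to land in the right vertex, since all points of a vertex are linked
  through its block. A link across an edge is realised between the images under \<psi>, with one
  link inside a vertex before and after.\<close>

lemma transport_block_rel:
  assumes A: "A \<subseteq> edges G" and xy: "(x, y) \<in> block_rel P A"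
  defines "A' \<equiv> (\<lambda>e. \<psi> ` e) ` A"
  shows "(transport G \<phi> \<psi> x, transport G \<phi> \<psi> y) \<in> (block_rel Q A')\<^sup>*"
proof -
  note d = iso_dataD[OF iso] and rG = vrgD(1)[OF X] and rH = vrgD(1)[OF Y]
  from block_rel_subset[OF X A] xy have pts: "x \<in> pts G" "y \<in> pts G" by auto
  note tv = transport_vertex
  from xy show ?thesis
  proof (cases rule: block_relE)
    case (block B v w)
    then have "vertex_of G x = v" "vertex_of G y = w"
      using vertex_of_eq[OF rG] vrg_blockD[OF X] by blast+
    then have "transport G \<phi> \<psi> x \<in> \<phi> v" "transport G \<phi> \<psi> y \<in> \<phi> w"
      using tv(1)[OF pts(1)] tv(1)[OF pts(2)] by auto
    moreover have "\<phi> ` B \<in> Q" using d(7) block(1) by auto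
    ultimately have "(transport G \<phi> \<psi> x, transport G \<phi> \<psi> y) \<in> block_rel Q A'"
      using block by (auto intro: block_rel_block)
    then show ?thesis by blast
  next
    case (edge e)
    have near: "(\<psi> p, transport G \<phi> \<psi> p) \<in> block_rel Q A'" if p: "p \<in> live G" for p
    proof -
      have pp: "p \<in> pts G" using p ribbonD(4)[OF rG] by auto
      have "\<psi> p \<in> \<phi> (vertex_of G p)"
        using d(3)[OF vertex_of_vertex[OF pp]] p vertex_of_mem[of p G] by blast
      then show ?thesis using vertex_in_block_rel[OF Y tv(2)[OF pp]] tv(1)[OF pp] by blast
    qed
    have e: "\<psi> ` e \<in> A'" using edge(1) by (simp add: A'_def)
    have l: "x \<in> live G" "y \<in> live G" using edge A edge_closed(3)[OF rG] by blast+
    have "(\<psi> x, \<psi> y) \<in> block_rel Q A'" using e edge by (auto intro: block_rel_edge)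
    then show ?thesis
      using rtrancl_3[OF symD[OF sym_block_rel near[OF l(1)]] _ near[OF l(2)]] by blast
  qed
qed

end

context
  fixes G P H Q \<phi> \<psi>
  assumes X: "vrg (G, P)" and Y: "vrg (H, Q)" and iso: "iso_data (G, P) (H, Q) \<phi> \<psi>"
begin

private abbreviation (input) "f' \<equiv> inv_into (vertices G) \<phi>"
private abbreviation (input) "s' \<equiv> inv_into (live G) \<psi>"

lemma transport_inverse_vertex:
  assumes x: "x \<in> pts G"
  shows "transport H f' s' (transport G \<phi> \<psi> x) \<in> vertex_of G x"
proof -
  note inv = iso_data_sym[OF X Y iso]
  have "transport H f' s' (transport G \<phi> \<psi> x) \<in> f' (\<phi> (vertex_of G x))"
    using transport_vertex(1)[OF Y X inv transport_vertex(4)[OF X Y iso x]]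
    by (simp only: transport_vertex(3)[OF X Y iso x])
  also have "f' (\<phi> (vertex_of G x)) = vertex_of G x"
    using iso_dataD(1)[OF iso] vertex_of_vertex[OF x] by (simp add: bij_betw_def)
  finally show ?thesis .
qed

text \<open>The round trip moves \<open>x\<close> to a nearby live point, then possibly along one
  free arc, and so stays on the boundary component. If the vertex has no edge, the trip ends
  somewhere on the same vertex, which is one component.\<close>

lemma transport_inverse_bd_rel:
  assumes A: "A \<subseteq> edges G" and x: "x \<in> pts G"
  shows "(transport H f' s' (transport G \<phi> \<psi> x), x) \<in> (bd_rel G A)\<^sup>*"
proof -
  note inv = iso_data_sym[OF X Y iso] and d = iso_dataD[OF iso]
  note rG = vrgD(1)[OF X] and rH = vrgD(1)[OF Y]
  have "(x, transport H f' s' (transport G \<phi> \<psi> x)) \<in> (bd_rel G A)\<^sup>*"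
  proof (cases "nearby G x = {}")
    case True
    then show ?thesis using transport_inverse_vertex[OF x] nearby_empty[OF rG A x] by blast
  next
    case False
    then obtain q where q: "q \<in> nearby G x" "transport G \<phi> \<psi> x = \<psi> q" by (rule transport_nonempty)
    then have ql: "q \<in> live G" by (simp add: nearby_def)
    then obtain r where r: "r = \<psi> q \<or> (\<psi> q, r) \<in> free_arcs H" "r \<in> live H"
      "transport H f' s' (\<psi> q) = s' r"
      using transport_live[OF Y X inv] d(8) by metis
    have s'q: "s' (\<psi> q) = q" using d(2) ql by (simp add: bij_betw_def)
    have "s' r = q \<or> (q, s' r) \<in> free_arcs G"
      using r iso_dataD(6)[OF inv d(8)[OF ql] r(2)] s'q by auto
    then have "(q, s' r) \<in> (bd_rel G A)\<^sup>*"
      using free_arcs_bd_rel[OF X Y iso rG A] by auto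
    then show ?thesis
      using nearby_bd_rel[OF rG A x q(1)] q(2) r(3) by (auto intro: rtrancl_trans)
  qed
  then show ?thesis using rtrancl_sym[OF sym_bd_rel[OF rG A]] by blast
qed

lemma iso_num_le:
  assumes A: "A \<subseteq> edges G"
  defines "A' \<equiv> (\<lambda>e. \<psi> ` e) ` A"
  shows "num_bd G A \<le> num_bd H A'" "num_blocks G P A \<le> num_blocks H Q A'"
proof -
  note inv = iso_data_sym[OF X Y iso] and d = iso_dataD[OF iso]
  note rG = vrgD(1)[OF X] and rH = vrgD(1)[OF Y]
  have A': "A' \<subseteq> edges H" using iso_edges[OF X Y iso] A unfolding A'_def bij_betw_def by blast
  have A_eq: "(\<lambda>e. s' ` e) ` A' = A" unfolding A'_def by (rule iso_inverse_image[OF X iso A])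
  show "num_bd G A \<le> num_bd H A'"
    unfolding num_bd_def
  proof (rule card_orbs_le[where g = "transport G \<phi> \<psi>" and h = "transport H f' s'"])
    show "(transport H f' s' x, transport H f' s' y) \<in> (bd_rel G A)\<^sup>*"
      if "(x, y) \<in> bd_rel H A'" for x y
      using transport_bd_rel[OF Y X inv A' that] by (simp add: A_eq)
  qed (use transport_inverse_bd_rel A A' rG rH transport_vertex(4)[OF X Y iso]
        in \<open>auto intro: sym_bd_rel ribbonD(1)\<close>)
  show "num_blocks G P A \<le> num_blocks H Q A'"
    unfolding num_blocks_def
  proof (rule card_orbs_le[where g = "transport G \<phi> \<psi>" and h = "transport H f' s'"])
    show "(transport H f' s' x, transport H f' s' y) \<in> (block_rel P A)\<^sup>*"
      if "(x, y) \<in> block_rel Q A'" for x y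
      using transport_block_rel[OF Y X inv A' that] by (simp add: A_eq)
    show "(transport H f' s' (transport G \<phi> \<psi> x), x) \<in> (block_rel P A)\<^sup>*" if "x \<in> pts G" for x
      using vertex_in_block_rel[OF X Y iso X vertex_of_vertex[OF that] transport_inverse_vertex[OF that]
          vertex_of_mem] by blast
  qed (use A A' rG rH transport_vertex(4)[OF X Y iso] sym_block_rel in \<open>auto intro: ribbonD(1)\<close>)
qed

end

text \<open>The inequality applied to the isomorphism and to its inverse, which carries the image of
  \<open>A\<close> back to \<open>A\<close>.\<close>

lemma iso_num_eq:
  assumes X: "vrg (G, P)" and Y: "vrg (H, Q)" and iso: "iso_data (G, P) (H, Q) \<phi> \<psi>"
    and A: "A \<subseteq> edges G"
  defines "A' \<equiv> (\<lambda>e. \<psi> ` e) ` A"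
  shows "num_bd H A' = num_bd G A" "num_blocks H Q A' = num_blocks G P A"
proof -
  note inv = iso_data_sym[OF X Y iso] and d = iso_dataD[OF iso]
  have A': "A' \<subseteq> edges H" using iso_edges[OF X Y iso] A unfolding A'_def bij_betw_def by blast
  have A_eq: "(\<lambda>e. inv_into (live G) \<psi> ` e) ` A' = A"
    unfolding A'_def by (rule iso_inverse_image[OF X iso A])
  show "num_bd H A' = num_bd G A" "num_blocks H Q A' = num_blocks G P A"
    using iso_num_le[OF X Y iso A] iso_num_le[OF Y X inv A'] unfolding A_eq by (simp_all add: A'_def)
qed

lemma same_ranks_iso:
  assumes "vrg X" "vrg Y" "vrg_iso X Y"
  shows "same_ranks X Y"
proof -
  obtain G P H Q where XY: "X = (G, P)" "Y = (H, Q)" by fastforce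
  then obtain \<phi> \<psi> where iso: "iso_data (G, P) (H, Q) \<phi> \<psi>" using assms(3) by (auto simp: vrg_iso_iff)
  have X: "vrg (G, P)" and Y: "vrg (H, Q)" using assms XY by auto
  note bij = iso_edges[OF X Y iso]
  have "rho H ((\<lambda>e. \<psi> ` e) ` A) = rho G A \<and> part_rank H Q ((\<lambda>e. \<psi> ` e) ` A) = part_rank G P A"
    if A: "A \<subseteq> edges G" for A
  proof -
    have sub: "(\<lambda>e. \<psi> ` e) ` A \<subseteq> edges H" using bij A unfolding bij_betw_def by blast
    have "card ((\<lambda>e. \<psi> ` e) ` A) = card A"
      using bij A by (intro card_image) (auto simp: bij_betw_def elim: inj_on_subset)
    then show ?thesis
      using iso_num_eq[OF X Y iso A] iso_num_eq[OF X Y iso, of "{}"]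
      by (simp add: rho_eq part_rank_eq[OF X A] part_rank_eq[OF Y sub])
  qed
  then show ?thesis using assms bij unfolding same_ranks_def XY by auto
qed

section \<open>Disjoint unions\<close>

abbreviation evens :: "nat \<Rightarrow> nat" where "evens n \<equiv> 2 * n"
abbreviation odds :: "nat \<Rightarrow> nat" where "odds n \<equiv> Suc (2 * n)"

definition sum_rel :: "(nat \<times> nat) set \<Rightarrow> (nat \<times> nat) set \<Rightarrow> (nat \<times> nat) set" where
  "sum_rel R S = {(evens x, evens y) | x y. (x, y) \<in> R} \<union> {(odds x, odds y) | x y. (x, y) \<in> S}"

lemma sum_fun_simps [simp]:
  "sum_fun f g (2 * n) = 2 * f n" "sum_fun f g (Suc (2 * n)) = Suc (2 * g n)"
  by (simp_all add: sum_fun_def)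

lemma evens_odds_neq [simp]: "2 * m \<noteq> Suc (2 * n)" "Suc (2 * n) \<noteq> 2 * m" for m n :: nat
  by presburger+

lemma sum_set_iff [simp]:
  "2 * n \<in> sum_set S T \<longleftrightarrow> n \<in> S" "Suc (2 * n) \<in> sum_set S T \<longleftrightarrow> n \<in> T"
  by (auto simp: sum_set_def)

lemma sum_setE:
  assumes "x \<in> sum_set S T"
  obtains y where "y \<in> S" "x = 2 * y" | y where "y \<in> T" "x = Suc (2 * y)"
  using assms by (auto simp: sum_set_def)

lemma sum_relE:
  assumes "(x, y) \<in> sum_rel R S"
  obtains a b where "(a, b) \<in> R" "x = 2 * a" "y = 2 * b"
    | a b where "(a, b) \<in> S" "x = Suc (2 * a)" "y = Suc (2 * b)"
  using assms by (auto simp: sum_rel_def)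

lemma sum_relI:
  "(x, y) \<in> R \<Longrightarrow> (2 * x, 2 * y) \<in> sum_rel R S"
  "(x, y) \<in> S \<Longrightarrow> (Suc (2 * x), Suc (2 * y)) \<in> sum_rel R S"
  by (auto simp: sum_rel_def)

lemma sym_sum_rel: "sym R \<Longrightarrow> sym S \<Longrightarrow> sym (sum_rel R S)"
  by (auto simp: sum_rel_def sym_def)

lemma sum_rel_rtrancl_evens: "(x, y) \<in> R\<^sup>* \<Longrightarrow> (2 * x, 2 * y) \<in> (sum_rel R S)\<^sup>*"
  by (erule rtrancl_map) (auto intro: sum_relI)

lemma sum_rel_rtrancl_odds: "(x, y) \<in> S\<^sup>* \<Longrightarrow> (Suc (2 * x), Suc (2 * y)) \<in> (sum_rel R S)\<^sup>*"
  by (erule rtrancl_map) (auto intro: sum_relI)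

lemma sum_rel_Image_evens: "(sum_rel R S)\<^sup>* `` {2 * x} = evens ` (R\<^sup>* `` {x})"
proof
  show "evens ` (R\<^sup>* `` {x}) \<subseteq> (sum_rel R S)\<^sup>* `` {2 * x}"
    using sum_rel_rtrancl_evens by auto
  have "\<exists>x'. y = 2 * x' \<and> (x, x') \<in> R\<^sup>*" if "(2 * x, y) \<in> (sum_rel R S)\<^sup>*" for y
    using that
  proof (induction rule: rtrancl_induct)
    case (step y z)
    then obtain x' where x': "y = 2 * x'" "(x, x') \<in> R\<^sup>*" by blast
    from step(2) show ?case
    proof (cases rule: sum_relE)
      case (1 a b)
      then have "a = x'" using x'(1) by simp
      then show ?thesis using 1 x'(2) by (auto intro: rtrancl_into_rtrancl)
    next
      case (2 a b)
      then show ?thesis using x' by simp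
    qed
  qed auto
  then show "(sum_rel R S)\<^sup>* `` {2 * x} \<subseteq> evens ` (R\<^sup>* `` {x})" by blast
qed

lemma sum_rel_Image_odds: "(sum_rel R S)\<^sup>* `` {Suc (2 * x)} = odds ` (S\<^sup>* `` {x})"
proof
  show "odds ` (S\<^sup>* `` {x}) \<subseteq> (sum_rel R S)\<^sup>* `` {Suc (2 * x)}"
    using sum_rel_rtrancl_odds by auto
  have "\<exists>x'. y = Suc (2 * x') \<and> (x, x') \<in> S\<^sup>*" if "(Suc (2 * x), y) \<in> (sum_rel R S)\<^sup>*" for y
    using that
  proof (induction rule: rtrancl_induct)
    case (step y z)
    then obtain x' where x': "y = Suc (2 * x')" "(x, x') \<in> S\<^sup>*" by blast
    from step(2) show ?case
    proof (cases rule: sum_relE)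
      case (1 a b)
      then show ?thesis using x' by simp
    next
      case (2 a b)
      then have "a = x'" using x'(1) by simp
      then show ?thesis using 2 x'(2) by (auto intro: rtrancl_into_rtrancl)
    qed
  qed auto
  then show "(sum_rel R S)\<^sup>* `` {Suc (2 * x)} \<subseteq> odds ` (S\<^sup>* `` {x})" by auto
qed

lemma orbs_sum: "orbs (sum_set D E) (sum_rel R S) =
    (\<lambda>C. evens ` C) ` orbs D R \<union> (\<lambda>C. odds ` C) ` orbs E S"
proof -
  have "orbs (sum_set D E) (sum_rel R S) =
      (\<lambda>x. (sum_rel R S)\<^sup>* `` {2 * x}) ` D \<union> (\<lambda>x. (sum_rel R S)\<^sup>* `` {Suc (2 * x)}) ` E"
    by (simp add: orbs_def sum_set_def image_Un image_image)
  then show ?thesis unfolding sum_rel_Image_evens sum_rel_Image_odds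
    by (simp add: orbs_def image_image)
qed

lemma inj_evens: "inj evens" and inj_odds: "inj odds"
  by (auto simp: inj_on_def)

lemma inj_image_evens: "inj (\<lambda>C. evens ` C)" and inj_image_odds: "inj (\<lambda>C. odds ` C)"
  using inj_image_eq_iff[OF inj_evens] inj_image_eq_iff[OF inj_odds] by (auto intro!: injI)

lemma evens_odds_images_disjoint:
  assumes "{} \<notin> A"
  shows "(\<lambda>C. evens ` C) ` A \<inter> (\<lambda>C. odds ` C) ` B = {}"
proof (rule ccontr)
  assume "(\<lambda>C. evens ` C) ` A \<inter> (\<lambda>C. odds ` C) ` B \<noteq> {}"
  then obtain C C' where C: "C \<in> A" "evens ` C = odds ` C'" by auto
  then obtain x where "x \<in> C" using assms by fastforce
  then have "2 * x \<in> odds ` C'" using C(2) by blast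
  then show False by auto
qed

lemma card_evens_odds_images:
  assumes "finite A" "finite B" "{} \<notin> A"
  shows "card ((\<lambda>C. evens ` C) ` A \<union> (\<lambda>C. odds ` C) ` B) = card A + card B"
  using assms inj_image_evens inj_image_odds evens_odds_images_disjoint[OF assms(3)]
  by (simp add: card_Un_disjoint card_image inj_on_subset[OF _ subset_UNIV])

lemma card_orbs_sum:
  assumes "finite D" "finite E"
  shows "card (orbs (sum_set D E) (sum_rel R S)) = card (orbs D R) + card (orbs E S)"
  unfolding orbs_sum using assms
  by (intro card_evens_odds_images finite_orbs) (auto simp: orbs_def)

lemma step_sum: "step (sum_set D E) (sum_fun f g) (sum_fun f' g') = sum_rel (step D f f') (step E g g')"
  by (auto simp: step_def sum_rel_def sum_set_def)

lemma linked_sum: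
  "linked ((\<lambda>C. evens ` C) ` F \<union> (\<lambda>C. odds ` C) ` F') = sum_rel (linked F) (linked F')"
  by (auto simp: linked_def sum_rel_def)

lemma pairing_on_sum:
  "pairing_on D f \<Longrightarrow> pairing_on E g \<Longrightarrow> pairing_on (sum_set D E) (sum_fun f g)"
  unfolding pairing_on_def by (auto elim!: sum_setE)

section \<open>Disjoint unions of vertex partitioned ribbon graphs\<close>

definition union_ribbon :: "ribbon_graph \<Rightarrow> ribbon_graph \<Rightarrow> ribbon_graph" where
  "union_ribbon G H = \<lparr>pts = sum_set (pts G) (pts H), seg = sum_fun (seg G) (seg H),
       arc = sum_fun (arc G) (arc H), live = sum_set (live G) (live H),
       side = sum_fun (side G) (side H)\<rparr>"

lemma union_ribbon_simps [simp]:
  "pts (union_ribbon G H) = sum_set (pts G) (pts H)"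
  "seg (union_ribbon G H) = sum_fun (seg G) (seg H)"
  "arc (union_ribbon G H) = sum_fun (arc G) (arc H)"
  "live (union_ribbon G H) = sum_set (live G) (live H)"
  "side (union_ribbon G H) = sum_fun (side G) (side H)"
  by (simp_all add: union_ribbon_def)

definition union_sets :: "nat set set \<Rightarrow> nat set set \<Rightarrow> nat set set" where
  "union_sets A B = (\<lambda>C. evens ` C) ` A \<union> (\<lambda>C. odds ` C) ` B"

definition union_partition :: "nat set set set \<Rightarrow> nat set set set \<Rightarrow> nat set set set" where
  "union_partition P Q = (\<lambda>B. (\<lambda>v. evens ` v) ` B) ` P \<union> (\<lambda>B. (\<lambda>v. odds ` v) ` B) ` Q"

lemma disjoint_union_eq:
  "disjoint_union (G, P) (H, Q) = (union_ribbon G H, union_partition P Q)"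
  by (simp add: disjoint_union_def union_ribbon_def union_partition_def)

lemma vertices_union: "vertices (union_ribbon G H) = union_sets (vertices G) (vertices H)"
  by (simp add: vertices_eq step_sum orbs_sum union_sets_def)

lemma edges_union: "edges (union_ribbon G H) = union_sets (edges G) (edges H)"
proof -
  have "corners (union_ribbon G H) (2 * p) = evens ` corners G p"
    "corners (union_ribbon G H) (Suc (2 * p)) = odds ` corners H p" for p
    by (simp_all add: corners_def)
  then show ?thesis by (simp add: edges_eq union_sets_def sum_set_def image_Un image_image)
qed

lemma ribbon_union:
  assumes "ribbon G" "ribbon H"
  shows "ribbon (union_ribbon G H)"
proof -
  note g = ribbonD[OF assms(1)] and h = ribbonD[OF assms(2)]
  have "live (union_ribbon G H) \<subseteq> pts (union_ribbon G H)"
    using g(4) h(4) by (auto elim!: sum_setE)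
  moreover have "\<forall>p\<in>live (union_ribbon G H).
      side (union_ribbon G H) p \<noteq> seg (union_ribbon G H) p \<and>
      side (union_ribbon G H) (seg (union_ribbon G H) p) = seg (union_ribbon G H) (side (union_ribbon G H) p)"
    using g(7,8) h(7,8) by (auto elim!: sum_setE)
  moreover have "finite (pts (union_ribbon G H))" using g(1) h(1) by (simp add: sum_set_def)
  ultimately show ?thesis
    using g(2,3,5,6) h(2,3,5,6) unfolding ribbon_def by (auto intro!: pairing_on_sum)
qed

lemma partition_on_Un:
  assumes "partition_on A P" "partition_on B Q" "A \<inter> B = {}"
  shows "partition_on (A \<union> B) (P \<union> Q)"
proof (rule partition_onI)
  show "\<Union> (P \<union> Q) = A \<union> B" "{} \<notin> P \<union> Q" using assms(1,2) by (auto simp: partition_on_def)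
  have "disjnt p q" if "p \<in> P" "q \<in> Q" for p q
    using assms that by (auto simp: partition_on_def disjnt_def)
  then show "disjnt p q" if "p \<in> P \<union> Q" "q \<in> P \<union> Q" "p \<noteq> q" for p q
    using assms(1,2) that partition_on_mem_eq[OF assms(1), of p q] partition_on_mem_eq[OF assms(2), of p q]
    by (auto simp: disjnt_def)
qed

lemma vrg_union:
  assumes "vrg (G, P)" "vrg (H, Q)"
  shows "vrg (union_ribbon G H, union_partition P Q)"
proof -
  note g = vrgD[OF assms(1)] and h = vrgD[OF assms(2)]
  have ne: "{} \<notin> (\<lambda>B. (\<lambda>v. evens ` v) ` B) ` P" "{} \<notin> (\<lambda>B. (\<lambda>v. odds ` v) ` B) ` Q"
    using g(2) h(2) by (auto simp: partition_on_def)
  have "partition_on ((\<lambda>v. evens ` v) ` vertices G) ((\<lambda>B. (\<lambda>v. evens ` v) ` B) ` P)"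
    using partition_on_inj_image[OF g(2), of "\<lambda>v. evens ` v"] inj_image_evens ne(1)
    by (simp add: inj_on_subset[OF _ subset_UNIV])
  moreover have "partition_on ((\<lambda>v. odds ` v) ` vertices H) ((\<lambda>B. (\<lambda>v. odds ` v) ` B) ` Q)"
    using partition_on_inj_image[OF h(2), of "\<lambda>v. odds ` v"] inj_image_odds ne(2)
    by (simp add: inj_on_subset[OF _ subset_UNIV])
  moreover have "(\<lambda>v. evens ` v) ` vertices G \<inter> (\<lambda>v. odds ` v) ` vertices H = {}"
    using vertex_nonempty[OF g(1)] by (intro evens_odds_images_disjoint) auto
  ultimately have "partition_on (vertices (union_ribbon G H)) (union_partition P Q)"
    unfolding vertices_union union_sets_def union_partition_def
    by (intro partition_on_Un)
  then show ?thesis using ribbon_union[OF g(1) h(1)] by (simp add: vrg_def)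
qed

lemma turn_union: "turn (union_ribbon G H) (union_sets A B) = sum_fun (turn G A) (turn H B)"
proof
  fix n
  have u: "\<Union>(union_sets A B) = sum_set (\<Union>A) (\<Union>B)"
    by (auto simp: union_sets_def sum_set_def)
  show "turn (union_ribbon G H) (union_sets A B) n = sum_fun (turn G A) (turn H B) n"
    unfolding turn_def u by (cases "even n") (auto elim!: evenE oddE)
qed

lemma bd_rel_union: "bd_rel (union_ribbon G H) (union_sets A B) = sum_rel (bd_rel G A) (bd_rel H B)"
  by (simp add: bd_rel_def turn_union step_sum)

lemma num_bd_union:
  assumes "ribbon G" "ribbon H"
  shows "num_bd (union_ribbon G H) (union_sets A B) = num_bd G A + num_bd H B"
  using ribbonD(1)[OF assms(1)] ribbonD(1)[OF assms(2)]
  by (simp add: num_bd_def bd_rel_union card_orbs_sum)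

lemma block_rel_union:
  "block_rel (union_partition P Q) (union_sets A B) = sum_rel (block_rel P A) (block_rel Q B)"
proof -
  have "Union ` union_partition P Q \<union> union_sets A B =
      (\<lambda>C. evens ` C) ` (Union ` P \<union> A) \<union> (\<lambda>C. odds ` C) ` (Union ` Q \<union> B)"
    by (auto simp: union_partition_def union_sets_def image_Un image_image image_Union)
  then show ?thesis unfolding block_rel_def by (simp only: linked_sum)
qed

lemma num_blocks_union:
  assumes "ribbon G" "ribbon H"
  shows "num_blocks (union_ribbon G H) (union_partition P Q) (union_sets A B) =
    num_blocks G P A + num_blocks H Q B"
  using ribbonD(1)[OF assms(1)] ribbonD(1)[OF assms(2)]
  by (simp add: num_blocks_def block_rel_union card_orbs_sum)

text \<open>The edgeless summand adds the same constants to the orbit counts for every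
  \<open>A\<close>, in particular for the empty one, so the drops are unaffected.\<close>

lemma same_ranks_edgeless:
  assumes "vrg X" "vrg Z" "edges (fst Z) = {}"
  shows "same_ranks (disjoint_union X Z) X"
proof (rule same_ranks_sym)
  obtain G P H Q where XZ: "X = (G, P)" "Z = (H, Q)" by fastforce
  have X: "vrg (G, P)" and Z: "vrg (H, Q)" and eH: "edges H = {}" using assms XZ by auto
  note rG = vrgD(1)[OF X] and rH = vrgD(1)[OF Z] and u = vrg_union[OF X Z]
  let ?K = "union_ribbon G H" and ?R = "union_partition P Q" and ?\<theta> = "\<lambda>C. evens ` C"
  have img: "?\<theta> ` A = union_sets A {}" for A by (simp add: union_sets_def)
  have emp: "{} = union_sets {} {}" by (simp add: union_sets_def)
  have bij: "bij_betw ?\<theta> (edges G) (edges ?K)"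
    using inj_image_evens by (auto simp: edges_union eH img bij_betw_def inj_on_subset[OF _ subset_UNIV])
  have "rho ?K (?\<theta> ` A) = rho G A \<and> part_rank ?K ?R (?\<theta> ` A) = part_rank G P A"
    if A: "A \<subseteq> edges G" for A
  proof
    have sub: "?\<theta> ` A \<subseteq> edges ?K" using bij A unfolding bij_betw_def by blast
    have "card (?\<theta> ` A) = card A"
      using inj_image_evens by (simp add: card_image inj_on_subset[OF _ subset_UNIV])
    then show "rho ?K (?\<theta> ` A) = rho G A"
      using num_bd_union[OF rG rH, of A "{}"] num_bd_union[OF rG rH, of "{}" "{}"]
      by (simp add: rho_eq img emp[symmetric])
    show "part_rank ?K ?R (?\<theta> ` A) = part_rank G P A"
      unfolding part_rank_eq[OF X A] part_rank_eq[OF u sub] 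
      using num_blocks_union[OF rG rH, of P Q A "{}"] num_blocks_union[OF rG rH, of P Q "{}" "{}"]
      by (simp add: img emp[symmetric])
  qed
  then show "same_ranks X (disjoint_union X Z)"
    using bij u X unfolding same_ranks_def XZ disjoint_union_eq by auto
qed

text \<open>Gluing two relations at a common point \<open>c\<close>, in the form shared by boundary
  components and blocks. \<open>W\<close> is their disjoint union with the two copies of
  \<open>c\<close> linked, and it has as many orbits as \<open>R\<close>: \<open>g\<close> places
  the points of \<open>T\<close> in the first copy and the others in the second, while
  \<open>h1\<close> and \<open>h2\<close> fold the copies back into \<open>D\<close>.\<close>

lemma card_orbs_wedge:
  fixes R :: "(nat \<times> nat) set" and T :: "nat set"
  assumes fin: "finite D" "finite D1" "finite D2" and sym: "sym R" "sym R1" "sym R2"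
    and c: "c \<in> D1" "c \<in> D2"
  defines "W \<equiv> sum_rel R1 R2 \<union> {(2 * c, Suc (2 * c)), (Suc (2 * c), 2 * c)}"
    and "g \<equiv> \<lambda>x. if x \<in> T then 2 * x else Suc (2 * x)"
  assumes T: "D \<inter> T \<subseteq> D1" "D - T \<subseteq> D2"
    and g: "\<And>x y. (x, y) \<in> R \<Longrightarrow> (g x, g y) \<in> W\<^sup>*"
    and h1: "\<And>x y. (x, y) \<in> R1 \<Longrightarrow> (h1 x, h1 y) \<in> R\<^sup>*"
    and h2: "\<And>x y. (x, y) \<in> R2 \<Longrightarrow> (h2 x, h2 y) \<in> R\<^sup>*"
    and hc: "h1 c = h2 c"
    and hT: "\<And>x. x \<in> D \<Longrightarrow> x \<in> T \<Longrightarrow> h1 x = x" "\<And>x. x \<in> D \<Longrightarrow> x \<notin> T \<Longrightarrow> h2 x = x"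
    and hD: "\<And>x. x \<in> D1 \<Longrightarrow> h1 x \<in> D" "\<And>x. x \<in> D2 \<Longrightarrow> h2 x \<in> D"
    and gh: "\<And>x. x \<in> D1 \<Longrightarrow> (g (h1 x), 2 * x) \<in> W\<^sup>*"
      "\<And>x. x \<in> D2 \<Longrightarrow> (g (h2 x), Suc (2 * x)) \<in> W\<^sup>*"
  shows "card (orbs D1 R1) + card (orbs D2 R2) = card (orbs D R) + 1"
proof -
  let ?S = "sum_set D1 D2"
  have finS: "finite ?S" using fin by (simp add: sum_set_def)
  have symS: "sym (sum_rel R1 R2)" using sym by (intro sym_sum_rel)
  then have symW: "sym W" by (auto simp: W_def sym_def)
  \<comment> \<open>Before the link is added the copies of \<open>c\<close> lie in different
    summands, so the link merges two orbits. This is the origin of the \<open>+ 1\<close>.\<close>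
  have "Suc (2 * c) \<notin> (sum_rel R1 R2)\<^sup>* `` {2 * c}" by (auto simp: sum_rel_Image_evens)
  then have "card (orbs ?S W) + 1 = card (orbs ?S (sum_rel R1 R2))"
    unfolding W_def using c finS symS by (intro card_orbs_insert) auto
  also have "\<dots> = card (orbs D1 R1) + card (orbs D2 R2)" using fin by (intro card_orbs_sum)
  finally have *: "card (orbs ?S W) + 1 = card (orbs D1 R1) + card (orbs D2 R2)" .
  define h where "h n = (if even n then h1 (n div 2) else h2 (n div 2))" for n :: nat
  have h: "h (2 * n) = h1 n" "h (Suc (2 * n)) = h2 n" for n by (simp_all add: h_def)
  have hW: "(h x, h y) \<in> R\<^sup>*" if "(x, y) \<in> W" for x y
    using that hc by (auto simp: W_def h elim!: sum_relE intro: h1 h2)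
  have hg: "h (g x) = x" if "x \<in> D" for x using hT that by (simp add: g_def h)
  have gh': "(g (h x), x) \<in> W\<^sup>*" if "x \<in> ?S" for x
    using that by (cases rule: sum_setE) (auto simp: h gh)
  have "card (orbs D R) \<le> card (orbs ?S W)"
  proof (rule card_orbs_le[where g = g and h = h])
    show "g x \<in> ?S" if "x \<in> D" for x using T that by (auto simp: g_def)
  qed (use finS sym symW hW hg in auto)
  moreover have "card (orbs ?S W) \<le> card (orbs D R)"
  proof (rule card_orbs_le[where g = h and h = g])
    show "h x \<in> D" if "x \<in> ?S" for x using that hD by (cases rule: sum_setE) (auto simp: h)
  qed (use fin sym symW g gh' in auto)
  ultimately show ?thesis using * by simp
qed

section \<open>Joins\<close>

lemma sub_ribbon_simps [simp]:
  "pts (sub_ribbon G U A) = \<Union>U" "seg (sub_ribbon G U A) = seg G" "arc (sub_ribbon G U A) = arc G"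
  "live (sub_ribbon G U A) = \<Union>A" "side (sub_ribbon G U A) = side G"
  by (simp_all add: sub_ribbon_def)

lemma edges_sub_ribbon:
  assumes "ribbon G" "A \<subseteq> edges G"
  shows "edges (sub_ribbon G U A) = A"
proof -
  have "edges (sub_ribbon G U A) = edges (spanning G A)"
    by (simp add: edges_def spanning_def)
  then show ?thesis using edges_spanning[OF assms] by simp
qed

lemma ribbon_sub_ribbon:
  assumes "ribbon G" "U \<subseteq> vertices G" "A \<subseteq> edges G" "\<Union>A \<subseteq> \<Union>U"
  shows "ribbon (sub_ribbon G U A)"
proof -
  note s = ribbon_spanning[OF assms(1,3)]
  have UD: "\<Union>U \<subseteq> pts G" using vertex_closed(3)[OF assms(1)] assms(2) by blast
  have cl: "seg G x \<in> \<Union>U" "arc G x \<in> \<Union>U" if "x \<in> \<Union>U" for x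
    using that assms(2) vertex_closed(1,2)[OF assms(1)] by blast+
  have "pairing_on (\<Union>U) (seg G)" "pairing_on (\<Union>U) (arc G)"
    unfolding pairing_on_def
    using cl UD pairing_onD(2,3)[OF ribbonD(2)[OF assms(1)]] pairing_onD(2,3)[OF ribbonD(3)[OF assms(1)]]
    by (meson subsetD)+
  moreover have "pairing_on (\<Union>A) (seg G)" "pairing_on (\<Union>A) (side G)"
    using ribbonD(5,6)[OF s] by (simp_all add: spanning_def)
  moreover have "\<forall>p\<in>\<Union>A. side G p \<noteq> seg G p \<and> side G (seg G p) = seg G (side G p)"
    using ribbonD(7,8)[OF s] by (simp add: spanning_def)
  moreover have "finite (\<Union>U)" using ribbonD(1)[OF assms(1)] UD by (rule finite_subset[rotated])
  ultimately show ?thesis using assms(4) unfolding ribbon_def by (simp del: Union_iff)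
qed

lemma vertices_sub_ribbon:
  assumes "ribbon G" "U \<subseteq> vertices G"
  shows "vertices (sub_ribbon G U A) = U"
proof -
  let ?S = "step (\<Union>U) (seg G) (arc G)" and ?T = "step (pts G) (seg G) (arc G)"
  have sub: "?S \<subseteq> ?T" using vertex_closed(3)[OF assms(1)] assms(2) by (auto simp: step_def)
  have cl: "y \<in> w \<and> (x, y) \<in> ?S\<^sup>*" if "(x, y) \<in> ?T\<^sup>*" "w \<in> U" "x \<in> w" for x y w
    using that(1)
  proof (induction rule: rtrancl_induct)
    case (step y z)
    then have "z \<in> w" using vertex_closed(1,2)[OF assms(1)] that(2) assms(2) by (auto elim!: stepE)
    moreover have "(y, z) \<in> ?S" using step that(2) by (auto simp: step_def)
    ultimately show ?case using step by (auto intro: rtrancl_into_rtrancl)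
  qed (use that in auto)
  have orb: "?S\<^sup>* `` {x} = w" if "w \<in> U" "x \<in> w" for x w
  proof -
    have "w = ?T\<^sup>* `` {x}"
      using vertex_of_eq[OF assms(1), of w x] that assms(2) by (auto simp: vertex_of_def)
    then show ?thesis using cl that rtrancl_mono[OF sub] by blast
  qed
  have "vertices (sub_ribbon G U A) = (\<lambda>x. ?S\<^sup>* `` {x}) ` \<Union>U" by (simp add: vertices_eq orbs_def)
  also have "\<dots> = U"
  proof
    show "(\<lambda>x. ?S\<^sup>* `` {x}) ` \<Union>U \<subseteq> U" using orb by auto
    show "U \<subseteq> (\<lambda>x. ?S\<^sup>* `` {x}) ` \<Union>U"
    proof
      fix w assume w: "w \<in> U"
      then obtain x where "x \<in> w" using vertex_nonempty[OF assms(1)] assms(2) by blast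
      then show "w \<in> (\<lambda>x. ?S\<^sup>* `` {x}) ` \<Union>U" using orb w by blast
    qed
  qed
  finally show ?thesis .
qed

lemma partition_on_restrict_partition:
  assumes "partition_on D P" "U \<subseteq> D"
  shows "partition_on U (restrict_partition P U)"
proof (rule partition_onI)
  show "\<Union> (restrict_partition P U) = U"
  proof -
    have "\<Union> (restrict_partition P U) = \<Union>P \<inter> U" unfolding restrict_partition_def by blast
    then show ?thesis using assms by (auto simp: partition_on_def)
  qed
  show "{} \<notin> restrict_partition P U" by (auto simp: restrict_partition_def)
  fix p q assume "p \<in> restrict_partition P U" "q \<in> restrict_partition P U" "p \<noteq> q"
  then obtain B C where BC: "p = B \<inter> U" "q = C \<inter> U" "B \<in> P" "C \<in> P" "B \<noteq> C"
    by (auto simp: restrict_partition_def)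
  then have "B \<inter> C = {}" using partition_on_mem_eq[OF assms(1) BC(3,4)] by blast
  then show "disjnt p q" using BC by (auto simp: disjnt_def)
qed

lemma vrg_sub_ribbon:
  assumes "vrg (G, P)" "U \<subseteq> vertices G" "A \<subseteq> edges G" "\<Union>A \<subseteq> \<Union>U"
  shows "vrg (sub_ribbon G U A, restrict_partition P U)"
  using ribbon_sub_ribbon[OF vrgD(1)[OF assms(1)] assms(2-4)]
    vertices_sub_ribbon[OF vrgD(1)[OF assms(1)] assms(2)]
    partition_on_restrict_partition[OF vrgD(2)[OF assms(1)] assms(2)]
  by (simp add: vrg_def)

lemma point_vertex:
  assumes "ribbon G" "x \<in> pts G"
  obtains w where "w \<in> vertices G" "x \<in> w"
  using vertex_of_vertex[OF assms(2)] vertex_of_mem by blast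

lemma edge_subset_ends:
  assumes "ribbon G" "e \<in> edges G"
  shows "e \<subseteq> \<Union>(ends G e)"
proof
  fix x assume x: "x \<in> e"
  then obtain w where "w \<in> vertices G" "x \<in> w"
    using point_vertex[OF assms(1)] edge_closed(4)[OF assms] by blast
  with x show "x \<in> \<Union>(ends G e)" by (auto simp: ends_def)
qed

text \<open>The hypotheses are symmetric under exchanging the two sides and replacing
  \<open>S\<close> by \<open>v - S\<close>. As a locale they can be interpreted a second time that
  way, so each argument about the first side also serves the second.\<close>

locale ribbon_join =
  fixes G P V1 V2 E1 E2 v S
  assumes X: "vrg (G, P)"
    and V: "V1 \<union> V2 = vertices G" "V1 \<inter> V2 = {v}"
    and E: "E1 \<union> E2 = edges G" "E1 \<inter> E2 = {}"
    and ends: "\<And>e. e \<in> E1 \<Longrightarrow> ends G e \<subseteq> V1" "\<And>e. e \<in> E2 \<Longrightarrow> ends G e \<subseteq> V2"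
    and S: "S \<subseteq> v" "seg G ` S \<subseteq> S" "card {p \<in> S. arc G p \<notin> S} \<le> 2"
    and SE: "v \<inter> \<Union>E1 \<subseteq> S" "S \<inter> \<Union>E2 = {}"
    and blocks: "\<And>B. B \<in> P \<Longrightarrow> B \<inter> V1 \<noteq> {} \<Longrightarrow> B \<inter> V2 \<noteq> {} \<Longrightarrow> v \<in> B"
begin

definition "G1 = sub_ribbon G V1 E1"
definition "G2 = sub_ribbon G V2 E2"
definition "Q1 = restrict_partition P V1"
definition "Q2 = restrict_partition P V2"

lemma rb: "ribbon G"
  using X by (rule vrgD)

lemma v: "v \<in> vertices G" "v \<in> V1" "v \<in> V2"
  using V by auto

lemma Union_E: "\<Union>E1 \<subseteq> \<Union>V1" "\<Union>E2 \<subseteq> \<Union>V2"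
  using edge_subset_ends[OF rb] ends E(1) by blast+

lemma vrg_parts: "vrg (G1, Q1)" "vrg (G2, Q2)"
  unfolding G1_def G2_def Q1_def Q2_def
  using V E Union_E by (auto intro!: vrg_sub_ribbon X simp del: Union_iff)

lemma edges_parts: "edges G1 = E1" "edges G2 = E2"
  unfolding G1_def G2_def using E by (auto intro!: edges_sub_ribbon rb)

lemma pts_parts: "pts G1 = \<Union>V1" "pts G2 = \<Union>V2" "pts G = \<Union>V1 \<union> \<Union>V2" "\<Union>V1 \<inter> \<Union>V2 = v"
proof -
  show "pts G1 = \<Union>V1" "pts G2 = \<Union>V2" by (simp_all add: G1_def G2_def)
  have "pts G = \<Union>(V1 \<union> V2)" using partition_on_vertices[OF rb] V(1) by (simp add: partition_on_def)
  then show "pts G = \<Union>V1 \<union> \<Union>V2" by auto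
  have "w = w'" if "w \<in> V1" "w' \<in> V2" "x \<in> w" "x \<in> w'" for w w' x
    using partition_on_mem_eq[OF partition_on_vertices[OF rb]] V(1) that by blast
  then show "\<Union>V1 \<inter> \<Union>V2 = v" using V(2) by blast
qed

lemma sides:
  "x \<in> \<Union>V1 \<Longrightarrow> seg G x \<in> \<Union>V1" "x \<in> \<Union>V1 \<Longrightarrow> arc G x \<in> \<Union>V1"
  "x \<in> \<Union>V2 \<Longrightarrow> seg G x \<in> \<Union>V2" "x \<in> \<Union>V2 \<Longrightarrow> arc G x \<in> \<Union>V2"
  "x \<in> v \<Longrightarrow> seg G x \<in> v" "x \<in> v \<Longrightarrow> arc G x \<in> v"
  using vertex_closed(1,2)[OF rb] V by blast+

lemma seg_seg: "x \<in> pts G \<Longrightarrow> seg G (seg G x) = x" and arc_arc: "x \<in> pts G \<Longrightarrow> arc G (arc G x) = x"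
  using ribbonD(2,3)[OF rb] by (auto dest: pairing_onD)

text \<open>\<open>D\<close> is the first side of the join: the segments of \<open>v\<close>
  assigned to it and all its other vertices. \<open>K\<close> is the set of points at which an arc
  leads out of \<open>D\<close>.\<close>

definition "D = S \<union> (\<Union>V1 - v)"
definition "K = {p \<in> S. arc G p \<notin> S}"

lemma seg_S: "x \<in> S \<Longrightarrow> seg G x \<in> S"
  using S(2) by auto

lemma seg_vS: "x \<in> v - S \<Longrightarrow> seg G x \<in> v - S"
  using seg_S[of "seg G x"] seg_seg[of x] sides(5)[of x] vertex_closed(3)[OF rb v(1)] by auto

lemma D_parts: "D \<subseteq> \<Union>V1" "D \<subseteq> pts G" "\<Union>V1 - D = v - S" "pts G - D = (v - S) \<union> (\<Union>V2 - v)"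
  using pts_parts(3,4) S(1) v unfolding D_def by blast+

lemma K_subset: "K \<subseteq> D" "K \<subseteq> v" "x \<in> K \<Longrightarrow> arc G x \<in> v - S"
  using S(1) sides(6) by (auto simp: K_def D_def)

lemma finite_K: "finite D" "finite K"
  using ribbonD(1)[OF rb] D_parts(2) K_subset(1) by (meson finite_subset)+

text \<open>The arcs leading out of \<open>S\<close> are those leading out of \<open>v - S\<close>,
  seen from the other end. So the bound by two passes to the complementary side.\<close>

lemma K_dual: "{p \<in> v - S. arc G p \<notin> v - S} = arc G ` K"
proof
  show "arc G ` K \<subseteq> {p \<in> v - S. arc G p \<notin> v - S}"
    using K_subset(2,3) arc_arc vertex_closed(3)[OF rb v(1)] by (auto simp: K_def)
  show "{p \<in> v - S. arc G p \<notin> v - S} \<subseteq> arc G ` K"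
  proof
    fix p assume p: "p \<in> {p \<in> v - S. arc G p \<notin> v - S}"
    then have "arc G (arc G p) = p" using arc_arc vertex_closed(3)[OF rb v(1)] by auto
    moreover from this have "arc G p \<in> K" using p sides(6) by (auto simp: K_def)
    ultimately show "p \<in> arc G ` K" by (metis imageI)
  qed
qed

lemma dual: "ribbon_join G P V2 V1 E2 E1 v (v - S)"
proof
  show "card {p \<in> v - S. arc G p \<notin> v - S} \<le> 2"
    unfolding K_dual using card_image_le[OF finite_K(2), of "arc G"] S(3) by (simp add: K_def)
  show "seg G ` (v - S) \<subseteq> v - S" using seg_vS by auto
qed (use X V E ends SE blocks in auto)

lemma no_E2: "x \<in> D \<Longrightarrow> x \<notin> \<Union>E2"
  using Union_E(2) SE(2) pts_parts(4) unfolding D_def by blast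

lemma arc_D: "x \<in> D \<Longrightarrow> arc G x \<in> D \<or> x \<in> K"
proof (cases "x \<in> S")
  case False
  assume "x \<in> D"
  then have x: "x \<in> \<Union>V1 - v" using False by (simp add: D_def)
  then have "x \<in> pts G" using pts_parts(3) by auto
  then have "arc G x \<notin> v" using x sides(6)[of "arc G x"] arc_arc by auto
  then show ?thesis using x sides(2) by (auto simp: D_def)
qed (auto simp: K_def D_def)

lemma bd_rel_G1: "bd_rel G1 B = step (\<Union>V1) (turn G B) (arc G)"
proof -
  have "turn G1 B = turn G B" by (auto simp: turn_def G1_def)
  then show ?thesis by (simp add: bd_rel_def G1_def)
qed

context
  fixes A
  assumes A: "A \<subseteq> edges G"
begin

lemma turn_D: "x \<in> D \<Longrightarrow> turn G (A \<inter> E1) x = turn G A x"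
  using A no_E2[of x] E(1) unfolding turn_def by auto

lemma turn_vS: "x \<in> v - S \<Longrightarrow> turn G (A \<inter> E1) x = seg G x"
  using SE(1) unfolding turn_def by auto

text \<open>Edges at points of \<open>D\<close> belong to \<open>E1\<close>, whose corners on
  \<open>v\<close> lie in \<open>S\<close>, and \<open>S\<close> consists of whole segments. Hence
  the boundary can leave \<open>D\<close> only by the arcs at \<open>K\<close>.\<close>

lemma turn_mem_D:
  assumes "x \<in> D"
  shows "turn G A x \<in> D"
proof (cases "x \<in> \<Union>A")
  case True
  then obtain e where e: "e \<in> A" "x \<in> e" by auto
  then have "e \<in> E1" using no_E2[OF assms] A E(1) by auto
  moreover have "side G x \<in> e" using edge_closed(2)[OF rb] e A by auto
  ultimately have "side G x \<in> \<Union>E1" by auto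
  then have "side G x \<in> D" using Union_E(1) SE(1) unfolding D_def by blast
  then show ?thesis using True by (simp add: turn_def)
next
  case False
  have "seg G x \<in> D"
  proof (cases "x \<in> S")
    case True then show ?thesis using seg_S by (simp add: D_def)
  next
    case False
    then have x: "x \<in> \<Union>V1 - v" using assms by (simp add: D_def)
    then have "x \<in> pts G" using pts_parts(3) by auto
    then have "seg G x \<notin> v" using x sides(5)[of "seg G x"] seg_seg by auto
    then show ?thesis using x sides(1) by (auto simp: D_def)
  qed
  then show ?thesis using False by (simp add: turn_def)
qed

lemma sym_bd: "sym (bd_rel G A)" "sym (bd_rel G1 (A \<inter> E1))"
  using rb A vrg_parts(1) edges_parts(1) by (auto intro!: sym_bd_rel dest: vrgD)

lemma bd_rel_G1I: "x \<in> D \<Longrightarrow> (x, turn G A x) \<in> bd_rel G1 (A \<inter> E1)"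
  "x \<in> \<Union>V1 \<Longrightarrow> (x, arc G x) \<in> bd_rel G1 (A \<inter> E1)"
proof -
  show "(x, arc G x) \<in> bd_rel G1 (A \<inter> E1)" if "x \<in> \<Union>V1"
    unfolding bd_rel_G1 using that by (rule step_snd)
  show "(x, turn G A x) \<in> bd_rel G1 (A \<inter> E1)" if "x \<in> D"
    unfolding bd_rel_G1 turn_D[OF that, symmetric] using that D_parts(1) by (intro step_fst) auto
qed

text \<open>On the points of \<open>D\<close> the boundary is a union of circles and of at most one path, whose ends
  are the two points of \<open>K\<close>.\<close>

lemma K_connected:
  assumes "p \<in> K" "q \<in> K"
  shows "(p, q) \<in> (bd_rel G A)\<^sup>*" "(p, q) \<in> (bd_rel G1 (A \<inter> E1))\<^sup>*"
proof -
  define R where "R = {(x, turn G A x) | x. x \<in> D} \<union> {(x, arc G x) | x. x \<in> D - K}"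
  have p: "p \<in> D" using assms(1) K_subset(1) by auto
  have turn: "pairing_on D (turn G A)"
    using turn_mem_D pairing_onD(2,3)[OF pairing_on_turn[OF rb A]] D_parts(2)
    unfolding pairing_on_def by auto
  have "even (card (R\<^sup>* `` {p} \<inter> K))"
  proof (rule even_card_ends[where a = p, OF finite_K(1) turn])
    show "R\<^sup>* `` {p} = ({(x, turn G A x) | x. x \<in> D} \<union> {(x, arc G x) | x. x \<in> D - K})\<^sup>* `` {p}"
      by (simp add: R_def)
    fix x assume x: "x \<in> D - K"
    then show aa: "arc G (arc G x) = x" and "arc G x \<noteq> x"
      using D_parts(2) ribbonD(3)[OF rb] by (auto dest: pairing_onD)
    have "arc G x \<notin> K" using K_subset(3)[of "arc G x"] aa x by (auto simp: D_def)
    then show "arc G x \<in> D - K" using arc_D[of x] x by auto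
  qed (rule p)
  moreover have "p \<in> R\<^sup>* `` {p} \<inter> K" using assms(1) by auto
  then have "0 < card (R\<^sup>* `` {p} \<inter> K)" using finite_K(2) by (auto simp: card_gt_0_iff)
  \<comment> \<open>The component of \<open>p\<close> contains an even, positive number of points of
    \<open>K\<close>. That is at least two, and \<open>K\<close> has at most two points, so the
    component contains all of \<open>K\<close>.\<close>
  moreover have "2 \<le> n" if "even n" "0 < n" for n :: nat using that by presburger
  ultimately have "card K \<le> card (R\<^sup>* `` {p} \<inter> K)" using S(3) unfolding K_def by (meson order_trans)
  then have "R\<^sup>* `` {p} \<inter> K = K" using finite_K(2) by (intro card_seteq) auto
  then have "(p, q) \<in> R\<^sup>*" using assms(2) by auto
  moreover have "R \<subseteq> bd_rel G A" using D_parts(2) by (auto simp: R_def bd_rel_def step_def)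
  moreover have "R \<subseteq> bd_rel G1 (A \<inter> E1)"
    using bd_rel_G1I D_parts(1) unfolding R_def by blast
  ultimately show "(p, q) \<in> (bd_rel G A)\<^sup>*" "(p, q) \<in> (bd_rel G1 (A \<inter> E1))\<^sup>*"
    using rtrancl_mono by blast+
qed

text \<open>On \<open>v - S\<close> the first part has no edges, so its boundary follows
  \<open>v\<close> there until it meets \<open>K\<close>. The points of \<open>v - S\<close> not
  connected to \<open>c\<close> would be closed under \<open>seg\<close> and \<open>arc\<close>,
  hence make up a whole vertex circle, which contains \<open>c\<close>.\<close>

lemma outside_connected:
  assumes c: "c \<in> v" and K: "\<And>x. x \<in> K \<Longrightarrow> (x, c) \<in> (bd_rel G1 (A \<inter> E1))\<^sup>*" and x: "x \<in> v - S"
  shows "(x, c) \<in> (bd_rel G1 (A \<inter> E1))\<^sup>*"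
proof (rule ccontr)
  let ?B = "bd_rel G1 (A \<inter> E1)"
  let ?Z = "{y \<in> v - S. (y, c) \<notin> ?B\<^sup>*}"
  assume "(x, c) \<notin> ?B\<^sup>*"
  then have xZ: "x \<in> ?Z" using x by auto
  have closed: "seg G y \<in> ?Z \<and> arc G y \<in> ?Z" if y: "y \<in> ?Z" for y
  proof -
    have yV: "y \<in> \<Union>V1" using y v by auto
    have "(y, seg G y) \<in> ?B"
      unfolding bd_rel_G1 using step_fst[OF yV, of "turn G (A \<inter> E1)"] turn_vS[of y] y by auto
    then have "seg G y \<in> ?Z" using y seg_vS[of y] by (auto intro: converse_rtrancl_into_rtrancl)
    moreover have "(y, arc G y) \<in> ?B" using yV by (rule bd_rel_G1I)
    then have "(arc G y, c) \<notin> ?B\<^sup>*" using y by (auto intro: converse_rtrancl_into_rtrancl)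
    moreover from this have "arc G y \<notin> K" using K by auto
    moreover have "arc G (arc G y) = y" using y vertex_closed(3)[OF rb v(1)] arc_arc by auto
    ultimately show ?thesis using y sides(6)[of y] by (auto simp: K_def)
  qed
  have "vertex_of G x = v" using vertex_of_eq[OF rb v(1)] x by auto
  then have "(x, c) \<in> (step (pts G) (seg G) (arc G))\<^sup>*" using c by (auto simp: vertex_of_def)
  then have "c \<in> ?Z" using xZ by (rule rtrancl_closed) (use closed in \<open>auto elim!: stepE\<close>)
  then show False by auto
qed

text \<open>Collapse all points outside \<open>D\<close> to \<open>c\<close>. Links inside
  \<open>D\<close> exist in the whole graph as well, and a link leaving \<open>D\<close> is an arc
  at a point of \<open>K\<close>, which is connected to \<open>c\<close> by assumption.\<close>

lemma bd_rel_retract: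
  assumes K: "\<And>x. x \<in> K \<Longrightarrow> (x, c) \<in> (bd_rel G A)\<^sup>*" and xy: "(x, y) \<in> bd_rel G1 (A \<inter> E1)"
  defines "h \<equiv> \<lambda>x. if x \<in> D then x else c"
  shows "(h x, h y) \<in> (bd_rel G A)\<^sup>*"
proof -
  have *: "(h x, h y) \<in> (bd_rel G A)\<^sup>*" if x: "x \<in> D" and xy: "(x, y) \<in> bd_rel G1 (A \<inter> E1)" for x y
  proof (cases "y \<in> D")
    case True
    have "y = turn G A x \<or> y = arc G x"
      using xy turn_D[OF x] unfolding bd_rel_G1 by (auto elim!: stepE)
    then have "(x, y) \<in> bd_rel G A" using x D_parts(2) by (auto simp: bd_rel_def step_def)
    then show ?thesis using x True by (auto simp: h_def)
  next
    case False
    then have "y = arc G x"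
      using xy turn_D[OF x] turn_mem_D[OF x] unfolding bd_rel_G1 by (auto elim!: stepE)
    then show ?thesis using arc_D[OF x] False K x by (auto simp: h_def)
  qed
  show ?thesis
  proof (cases "x \<in> D \<or> y \<in> D")
    case True
    then show ?thesis
      using *[OF _ xy] *[OF _ symD[OF sym_bd(2) xy]] rtrancl_sym[OF sym_bd(1)] by blast
  qed (simp add: h_def)
qed

text \<open>Each of \<open>G1\<close> and \<open>G2\<close> has a copy of \<open>v\<close>, of which the points outside \<open>D\<close>, respectively inside
  \<open>D\<close>, carry no edge.  The maps \<open>h1\<close> and \<open>h2\<close> collapse these to \<open>c\<close>, which does not change the
  number of boundary components once the two copies of \<open>c\<close> are linked.\<close>

lemma num_bd_join:
  "num_bd G1 (A \<inter> E1) + num_bd G2 (A \<inter> E2) = num_bd G A + 1"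
proof -
  interpret dual: ribbon_join G P V2 V1 E2 E1 v "v - S" by (rule dual)
  let ?B = "bd_rel G A" and ?B1 = "bd_rel G1 (A \<inter> E1)" and ?B2 = "bd_rel G2 (A \<inter> E2)"
  have G2: "dual.G1 = G2" by (simp add: dual.G1_def G2_def)
  have vS: "v - (v - S) = S" using S(1) by auto
  have dD: "dual.D = pts G - D" unfolding dual.D_def D_parts(4) ..
  have dK: "dual.K = arc G ` K" unfolding dual.K_def by (rule K_dual)
  note dsym = dual.sym_bd(2)[OF A, unfolded G2]
  \<comment> \<open>If the boundary crosses between the sides, \<open>c\<close> must lie on the
    crossing component, so it is taken in \<open>K\<close>; if \<open>K\<close> is empty, any point
    of \<open>v\<close> will do.\<close>
  obtain c where c: "c \<in> v" "K \<noteq> {} \<Longrightarrow> c \<in> K"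
    using vertex_nonempty[OF rb v(1)] K_subset(2) by blast
  have cD: "c \<in> \<Union>V1" "c \<in> \<Union>V2" "c \<in> pts G" using c(1) v vertex_closed(3)[OF rb v(1)] by auto
  have K1: "(x, c) \<in> ?B\<^sup>*" "(x, c) \<in> ?B1\<^sup>*" if "x \<in> K" for x
    using K_connected that c(2) by blast+
  have K2: "(y, c) \<in> ?B\<^sup>*" "(y, c) \<in> ?B2\<^sup>*" if y: "y \<in> dual.K" for y
  proof -
    have "arc G c \<in> dual.K" using y c(2) unfolding dK by auto
    note con = dual.K_connected[OF A y this, unfolded G2]
    have "(c, arc G c) \<in> ?B2" using dual.bd_rel_G1I(2)[OF A cD(2)] unfolding G2 .
    then show "(y, c) \<in> ?B2\<^sup>*" using con(2) symD[OF dsym] by (meson rtrancl_into_rtrancl)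
    have "(c, arc G c) \<in> ?B" using cD(3) by (auto simp: bd_rel_def step_def)
    then show "(y, c) \<in> ?B\<^sup>*" using con(1) symD[OF sym_bd(1)] by (meson rtrancl_into_rtrancl)
  qed
  define W where "W = sum_rel ?B1 ?B2 \<union> {(2 * c, Suc (2 * c)), (Suc (2 * c), 2 * c)}"
  define g where "g x = (if x \<in> D then 2 * x else Suc (2 * x))" for x
  define h1 where "h1 x = (if x \<in> D then x else c)" for x
  define h2 where "h2 x = (if x \<in> dual.D then x else c)" for x
  have symW: "sym W" unfolding W_def using sym_sum_rel[OF sym_bd(2) dsym] by (auto simp: sym_def)
  have W1: "(2 * x, 2 * y) \<in> W\<^sup>*" if "(x, y) \<in> ?B1\<^sup>*" for x y
    using sum_rel_rtrancl_evens[OF that] unfolding W_def by (meson in_rtrancl_UnI)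
  have W2: "(Suc (2 * x), Suc (2 * y)) \<in> W\<^sup>*" if "(x, y) \<in> ?B2\<^sup>*" for x y
    using sum_rel_rtrancl_odds[OF that] unfolding W_def by (meson in_rtrancl_UnI)
  have Wc: "(2 * c, Suc (2 * c)) \<in> W\<^sup>*" "(Suc (2 * c), 2 * c) \<in> W\<^sup>*" unfolding W_def by auto
  have gc: "(g c, 2 * c) \<in> W\<^sup>*" "(g c, Suc (2 * c)) \<in> W\<^sup>*" using Wc by (auto simp: g_def)
  have gD: "g x = 2 * x" if "x \<in> D" for x using that by (simp add: g_def)
  have gD': "g x = Suc (2 * x)" if "x \<in> dual.D" for x using that unfolding dD by (simp add: g_def)
  \<comment> \<open>Arcs at \<open>K\<close> are the only direct links between the two sides. In
    \<open>W\<close> such an arc becomes a detour from \<open>x\<close> to the first copy of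
    \<open>c\<close>, over to the second copy, and on to the other end of the arc.\<close>
  have cross: "(g x, g (arc G x)) \<in> W\<^sup>*" if x: "x \<in> K" for x
  proof -
    have y: "arc G x \<in> dual.K" using x unfolding dK by auto
    then have "g (arc G x) = Suc (2 * arc G x)" using gD' dual.K_subset(1) by blast
    moreover have "g x = 2 * x" using x gD K_subset(1) by blast
    ultimately show ?thesis
      using W1[OF K1(2)[OF x]] Wc(1) W2[OF rtrancl_sym[OF dsym K2(2)[OF y]]]
      by (metis rtrancl_trans)
  qed
  have fin: "finite (pts G)" "finite (\<Union>V1)" "finite (\<Union>V2)"
    using ribbonD(1)[OF rb] pts_parts(3) by auto
  have "card (orbs (\<Union>V1) ?B1) + card (orbs (\<Union>V2) ?B2) = card (orbs (pts G) ?B) + 1"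
  proof (rule card_orbs_wedge[where c = c and T = D and ?h1.0 = h1 and ?h2.0 = h2 and ?R1.0 = ?B1
        and ?R2.0 = ?B2, folded W_def])
    show "pts G \<inter> D \<subseteq> \<Union>V1" "pts G - D \<subseteq> \<Union>V2" using D_parts(1) dual.D_parts(1) dD by auto
    have "(g x, g y) \<in> W\<^sup>*" if xy: "(x, y) \<in> ?B" for x y
    proof -
      have x: "x \<in> pts G" and "y = turn G A x \<or> y = arc G x"
        using xy by (auto simp: bd_rel_def step_def)
      then consider "y = turn G A x" "x \<in> D" | "y = turn G A x" "x \<in> dual.D" | "y = arc G x" unfolding dD by blast
      then show ?thesis
      proof cases
        case 1
        then show ?thesis using W1 bd_rel_G1I(1) turn_mem_D by (auto simp: gD)
      next
        case 2
        then show ?thesis using W2 dual.bd_rel_G1I(1)[OF A, unfolded G2] dual.turn_mem_D[OF A] by (auto simp: gD')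
      next
        case 3
        have xa: "arc G y = x" using 3 arc_arc[OF x] by simp
        have y: "y \<in> pts G" using 3 x ribbonD(3)[OF rb] by (auto dest: pairing_onD)
        \<comment> \<open>An arc with its ends on different sides has one of them in
          \<open>K\<close>.\<close>
        consider "x \<in> D" "y \<in> D" | "x \<in> dual.D" "y \<in> dual.D" | "x \<in> K" | "y \<in> K"
          using arc_D[of x] arc_D[of y, unfolded xa] x y 3[symmetric] dD by (cases "x \<in> D"; cases "y \<in> D") auto
        then show ?thesis
        proof cases
          case 1
          then have "(x, y) \<in> ?B1" using bd_rel_G1I(2)[of x] 3 D_parts(1) by blast
          then show ?thesis using W1 1 by (simp add: gD r_into_rtrancl)
        next
          case 2
          then have "(x, y) \<in> ?B2" using dual.bd_rel_G1I(2)[OF A, of x, unfolded G2] 3 dual.D_parts(1) by blast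
          then show ?thesis using W2 2 by (simp add: gD' r_into_rtrancl)
        next
          case 4
          then show ?thesis using rtrancl_sym[OF symW cross[of y]] xa by simp
        qed (use cross 3 in simp)
      qed
    qed
    then show "(if x \<in> D then 2 * x else Suc (2 * x), if y \<in> D then 2 * y else Suc (2 * y)) \<in> W\<^sup>*"
      if "(x, y) \<in> ?B" for x y
      using that unfolding g_def .
    show "(h1 x, h1 y) \<in> ?B\<^sup>*" if "(x, y) \<in> ?B1" for x y
      unfolding h1_def using K1(1) that by (rule bd_rel_retract)
    show "(h2 x, h2 y) \<in> ?B\<^sup>*" if "(x, y) \<in> ?B2" for x y
      unfolding h2_def using K2(1) that[folded G2] by (rule dual.bd_rel_retract[OF A])
    show "h1 c = h2 c" by (simp add: h1_def h2_def)
    show "h1 x = x" if "x \<in> D" for x using that by (simp add: h1_def)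
    show "h2 x = x" if "x \<in> pts G" "x \<notin> D" for x using that by (simp add: h2_def dD)
    show "h1 x \<in> pts G" "h2 x \<in> pts G" for x using cD(3) D_parts(2) dual.D_parts(2) by (auto simp: h1_def h2_def)
    have "(g (h1 x), 2 * x) \<in> W\<^sup>*" if x: "x \<in> \<Union>V1" for x
    proof (cases "x \<in> D")
      case False
      then have "x \<in> v - S" using x D_parts(3) by auto
      then have "(x, c) \<in> ?B1\<^sup>*" using outside_connected[OF c(1)] K1(2) by blast
      then have "(2 * c, 2 * x) \<in> W\<^sup>*" using W1 rtrancl_sym[OF sym_bd(2)] by blast
      then show ?thesis using gc(1) False by (auto simp: h1_def intro: rtrancl_trans)
    qed (simp add: h1_def gD)
    then show "(if h1 x \<in> D then 2 * h1 x else Suc (2 * h1 x), 2 * x) \<in> W\<^sup>*" if "x \<in> \<Union>V1" for x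
      using that unfolding g_def .
    have "(g (h2 x), Suc (2 * x)) \<in> W\<^sup>*" if x: "x \<in> \<Union>V2" for x
    proof (cases "x \<in> dual.D")
      case False
      then have "x \<in> v - (v - S)" using x dual.D_parts(3) by auto
      then have "(x, c) \<in> ?B2\<^sup>*" using dual.outside_connected[OF A c(1), unfolded G2] K2(2) by blast
      then have "(Suc (2 * c), Suc (2 * x)) \<in> W\<^sup>*" using W2 rtrancl_sym[OF dsym] by blast
      then show ?thesis using gc(2) False by (auto simp: h2_def intro: rtrancl_trans)
    qed (simp add: h2_def gD')
    then show "(if h2 x \<in> D then 2 * h2 x else Suc (2 * h2 x), Suc (2 * x)) \<in> W\<^sup>*" if "x \<in> \<Union>V2" for x
      using that unfolding g_def .
  qed (use fin sym_bd dsym cD in auto)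
  then show ?thesis by (simp add: num_bd_def pts_parts)
qed

text \<open>The same gluing at a point \<open>c\<close> of \<open>v\<close>. Nothing needs to be
  collapsed here, since all points of \<open>v\<close> are linked in both parts, so
  \<open>h1\<close> and \<open>h2\<close> are identities.\<close>

lemma num_blocks_join:
  "num_blocks G1 Q1 (A \<inter> E1) + num_blocks G2 Q2 (A \<inter> E2) = num_blocks G P A + 1"
proof -
  let ?B = "block_rel P A" and ?B1 = "block_rel Q1 (A \<inter> E1)" and ?B2 = "block_rel Q2 (A \<inter> E2)"
  obtain c where c: "c \<in> v" using vertex_nonempty[OF rb v(1)] by blast
  define W where "W = sum_rel ?B1 ?B2 \<union> {(2 * c, Suc (2 * c)), (Suc (2 * c), 2 * c)}"
  define g where "g x = (if x \<in> \<Union>V1 then 2 * x else Suc (2 * x))" for x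
  have symW: "sym W"
    unfolding W_def using sym_sum_rel[OF sym_block_rel sym_block_rel] by (auto simp: sym_def)
  have W1: "(2 * x, 2 * y) \<in> W" if "(x, y) \<in> ?B1" for x y
    using sum_relI(1)[OF that] by (auto simp: W_def)
  have W2: "(Suc (2 * x), Suc (2 * y)) \<in> W" if "(x, y) \<in> ?B2" for x y
    using sum_relI(2)[OF that] by (auto simp: W_def)
  have Wc: "(2 * c, Suc (2 * c)) \<in> W" "(Suc (2 * c), 2 * c) \<in> W" by (auto simp: W_def)
  have fin: "finite (pts G)" "finite (\<Union>V1)" "finite (\<Union>V2)"
    using ribbonD(1)[OF rb] pts_parts(3) by auto
  have B1: "(x, y) \<in> ?B1" if "B \<in> P" "w \<in> B" "w' \<in> B" "w \<in> V1" "w' \<in> V1" "x \<in> w" "y \<in> w'" for B w w' x y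
  proof -
    have "B \<inter> V1 \<in> Q1" using that by (auto simp: Q1_def restrict_partition_def)
    then show ?thesis using that by (intro block_rel_block[of "B \<inter> V1" Q1 w w']) auto
  qed
  have B2: "(x, y) \<in> ?B2" if "B \<in> P" "w \<in> B" "w' \<in> B" "w \<in> V2" "w' \<in> V2" "x \<in> w" "y \<in> w'" for B w w' x y
  proof -
    have "B \<inter> V2 \<in> Q2" using that by (auto simp: Q2_def restrict_partition_def)
    then show ?thesis using that by (intro block_rel_block[of "B \<inter> V2" Q2 w w']) auto
  qed
  obtain B0 where B0: "B0 \<in> P" "v \<in> B0" using v(1) vrgD(2)[OF X] by (auto simp: partition_on_def)
  have g1: "g x = 2 * x" if "x \<in> \<Union>V1" for x using that by (simp add: g_def)
  \<comment> \<open>Points of \<open>v\<close> occur in both copies and \<open>g\<close> selects the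
    first one; the second is connected to it through the two copies of \<open>c\<close>.\<close>
  have g2: "(Suc (2 * x), g x) \<in> W\<^sup>*" if "x \<in> \<Union>V2" for x
  proof (cases "x \<in> \<Union>V1")
    case True
    then have xv: "x \<in> v" using that pts_parts(4) by auto
    then have "(x, c) \<in> ?B2" "(c, x) \<in> ?B1" using B0 B1 B2 v c by blast+
    then show ?thesis unfolding g1[OF True] by (blast intro: rtrancl_3 W1 W2 Wc)
  qed (simp add: g_def)
  \<comment> \<open>A block that meets both sides contains \<open>v\<close>, so a link inside it
    splits at \<open>c\<close> into a link of each part.\<close>
  have mixed: "(g x, g y) \<in> W\<^sup>*" 
    if "B \<in> P" "w \<in> B" "w' \<in> B" "w \<in> V1" "w' \<in> V2" "x \<in> w" "y \<in> w'" for B w w' x y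
  proof -
    have "v \<in> B" using that blocks by blast
    then have "(x, c) \<in> ?B1" "(c, y) \<in> ?B2" using B1[of B w v x c] B2[of B v w' c y] that c v by auto
    then have "(2 * x, Suc (2 * y)) \<in> W\<^sup>*" by (blast intro: rtrancl_3 W1 W2 Wc)
    moreover have "x \<in> \<Union>V1" "y \<in> \<Union>V2" using that by auto
    ultimately show ?thesis using g1 g2 by (metis rtrancl_trans)
  qed
  have "card (orbs (\<Union>V1) ?B1) + card (orbs (\<Union>V2) ?B2) = card (orbs (pts G) ?B) + 1"
  proof (rule card_orbs_wedge[where c = c and T = "\<Union>V1" and ?h1.0 = id and ?h2.0 = id and ?R1.0 = ?B1
        and ?R2.0 = ?B2, folded W_def])
    show "(if x \<in> \<Union>V1 then 2 * x else Suc (2 * x), if y \<in> \<Union>V1 then 2 * y else Suc (2 * y)) \<in> W\<^sup>*"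
      if xy: "(x, y) \<in> ?B" for x y
    proof -
      have "(g x, g y) \<in> W\<^sup>*"
        using xy
      proof (cases rule: block_relE)
        case (block B w w')
        then have "w \<in> V1 \<union> V2" "w' \<in> V1 \<union> V2" using vrg_blockD[OF X] V(1) by auto
        then consider "w \<in> V1" "w' \<in> V1" | "w \<in> V2" "w' \<in> V2" | "w \<in> V1" "w' \<in> V2" | "w \<in> V2" "w' \<in> V1" by auto
        then show ?thesis
        proof cases
          case 1
          then have "(2 * x, 2 * y) \<in> W" using B1 block W1 by blast
          moreover have "x \<in> \<Union>V1" "y \<in> \<Union>V1" using 1 block by auto
          ultimately show ?thesis by (simp add: g1 r_into_rtrancl)
        next
          case 2
          then have "(Suc (2 * x), Suc (2 * y)) \<in> W" using B2 block W2 by blast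
          moreover have "x \<in> \<Union>V2" "y \<in> \<Union>V2" using 2 block by auto
          ultimately show ?thesis
            using g2[of x] g2[of y] rtrancl_sym[OF symW] by (meson r_into_rtrancl rtrancl_trans)
        next
          case 3
          then show ?thesis using mixed block by blast
        next
          case 4
          then have "(g y, g x) \<in> W\<^sup>*" using mixed[of B w' w y x] block by blast
          then show ?thesis by (rule rtrancl_sym[OF symW])
        qed
      next
        case (edge e)
        then have "e \<in> E1 \<or> e \<in> E2" using A E(1) by auto
        then show ?thesis
        proof
          assume e: "e \<in> E1"
          then have "(x, y) \<in> ?B1" using edge by (intro block_rel_edge[of e]) auto
          moreover have "x \<in> \<Union>V1" "y \<in> \<Union>V1" using e edge Union_E(1) by auto
          ultimately show ?thesis using W1 by (simp add: g1 r_into_rtrancl)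
        next
          assume e: "e \<in> E2"
          then have "(x, y) \<in> ?B2" using edge by (intro block_rel_edge[of e]) auto
          then have "(Suc (2 * x), Suc (2 * y)) \<in> W" by (rule W2)
          moreover have "x \<in> \<Union>V2" "y \<in> \<Union>V2" using e edge Union_E(2) by auto
          ultimately show ?thesis
            using g2[of x] g2[of y] rtrancl_sym[OF symW] by (meson r_into_rtrancl rtrancl_trans)
        qed
      qed
      then show ?thesis by (simp add: g_def)
    qed
    show "(id x, id y) \<in> ?B\<^sup>*" if xy: "(x, y) \<in> ?B1" for x y
    proof -
      from xy have "(x, y) \<in> ?B"
        by (cases rule: block_relE)
          (auto simp: Q1_def restrict_partition_def intro: block_rel_block block_rel_edge)
      then show ?thesis by auto
    qed
    show "(id x, id y) \<in> ?B\<^sup>*" if xy: "(x, y) \<in> ?B2" for x y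
    proof -
      from xy have "(x, y) \<in> ?B"
        by (cases rule: block_relE)
          (auto simp: Q2_def restrict_partition_def intro: block_rel_block block_rel_edge)
      then show ?thesis by auto
    qed
    show "(if id x \<in> \<Union>V1 then 2 * id x else Suc (2 * id x), 2 * x) \<in> W\<^sup>*" if "x \<in> \<Union>V1" for x
      using that by simp
    show "(if id x \<in> \<Union>V1 then 2 * id x else Suc (2 * id x), Suc (2 * x)) \<in> W\<^sup>*" if "x \<in> \<Union>V2" for x
      using rtrancl_sym[OF symW g2[OF that]] unfolding g_def id_apply by assumption
  qed (use fin sym_block_rel pts_parts(3) c v in auto)
  then show ?thesis by (simp add: num_blocks_def pts_parts)
qed

end

text \<open>The disjoint union has one boundary component and one class of blocks more than the
  join, both for \<open>A\<close> and for the empty subset; the surplus cancels in the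
  drops.\<close>

lemma same_ranks_union: "same_ranks (G, P) (disjoint_union (G1, Q1) (G2, Q2))"
proof -
  note rG1 = vrgD(1)[OF vrg_parts(1)] and rG2 = vrgD(1)[OF vrg_parts(2)]
  note u = vrg_union[OF vrg_parts]
  let ?K = "union_ribbon G1 G2" and ?R = "union_partition Q1 Q2"
  let ?\<theta> = "\<lambda>e. if e \<in> E1 then evens ` e else odds ` e"
  have img: "?\<theta> ` A = union_sets (A \<inter> E1) (A \<inter> E2)" if "A \<subseteq> edges G" for A
  proof -
    have "A = (A \<inter> E1) \<union> (A \<inter> E2)" using that E(1) by auto
    then have "?\<theta> ` A = ?\<theta> ` (A \<inter> E1) \<union> ?\<theta> ` (A \<inter> E2)" by (metis image_Un)
    also have "?\<theta> ` (A \<inter> E1) = (\<lambda>e. evens ` e) ` (A \<inter> E1)" by (auto intro!: image_cong)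
    also have "?\<theta> ` (A \<inter> E2) = (\<lambda>e. odds ` e) ` (A \<inter> E2)" using E(2) by (auto intro!: image_cong)
    finally show ?thesis by (simp add: union_sets_def)
  qed
  have finE: "finite (edges G)" using rb by (rule finite_edges)
  have ne: "{} \<notin> edges G" using partition_on_edges[OF rb] by (simp add: partition_on_def)
  have cardA: "card (?\<theta> ` A) = card A" if A: "A \<subseteq> edges G" for A
  proof -
    have fin: "finite A" using A finE by (rule finite_subset)
    have "card (?\<theta> ` A) = card (A \<inter> E1) + card (A \<inter> E2)"
      unfolding img[OF A] union_sets_def using fin ne A by (intro card_evens_odds_images) auto
    also have "\<dots> = card ((A \<inter> E1) \<union> (A \<inter> E2))" using fin E(2) by (intro card_Un_disjoint[symmetric]) auto
    also have "(A \<inter> E1) \<union> (A \<inter> E2) = A" using A E(1) by auto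
    finally show ?thesis .
  qed
  have imgE: "?\<theta> ` edges G = edges ?K"
  proof -
    have "edges G \<inter> E1 = E1" "edges G \<inter> E2 = E2" using E(1) by auto
    then show ?thesis unfolding img[OF order_refl] edges_union edges_parts by simp
  qed
  then have bij: "bij_betw ?\<theta> (edges G) (edges ?K)"
    using cardA[OF order_refl] finE by (simp add: bij_betw_def eq_card_imp_inj_on)
  have "rho ?K (?\<theta> ` A) = rho G A \<and> part_rank ?K ?R (?\<theta> ` A) = part_rank G P A"
    if A: "A \<subseteq> edges G" for A
  proof
    have sub: "?\<theta> ` A \<subseteq> edges ?K" using imgE A by blast
    have emp: "{} = union_sets {} {}" by (simp add: union_sets_def)
    have "num_bd ?K (?\<theta> ` A) = num_bd G A + 1"
      unfolding img[OF A] num_bd_union[OF rG1 rG2] by (rule num_bd_join[OF A])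
    moreover have "num_bd ?K {} = num_bd G {} + 1"
      using num_bd_join[of "{}"] num_bd_union[OF rG1 rG2, of "{}" "{}"] by (simp add: emp[symmetric])
    ultimately show "rho ?K (?\<theta> ` A) = rho G A" unfolding rho_eq cardA[OF A] by simp
    have "num_blocks ?K ?R (?\<theta> ` A) = num_blocks G P A + 1"
      unfolding img[OF A] num_blocks_union[OF rG1 rG2] by (rule num_blocks_join[OF A])
    moreover have "num_blocks ?K ?R {} = num_blocks G P {} + 1"
      using num_blocks_join[of "{}"] num_blocks_union[OF rG1 rG2, of Q1 Q2 "{}" "{}"]
      by (simp add: emp[symmetric])
    ultimately show "part_rank ?K ?R (?\<theta> ` A) = part_rank G P A"
      unfolding part_rank_eq[OF X A] part_rank_eq[OF u sub] by simp
  qed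
  then show ?thesis using bij u X unfolding same_ranks_def disjoint_union_eq by auto
qed

end

lemma is_joinE:
  assumes "vrg X" "is_join X X1 X2"
  obtains G P V1 V2 E1 E2 v S where "X = (G, P)" "ribbon_join G P V1 V2 E1 E2 v S"
    "X1 = (sub_ribbon G V1 E1, restrict_partition P V1)"
    "X2 = (sub_ribbon G V2 E2, restrict_partition P V2)"
proof -
  obtain G P where GP: "X = (G, P)" by fastforce
  from assms(2) obtain V1 V2 E1 E2 v S where
    "V1 \<union> V2 = vertices G \<and> V1 \<inter> V2 = {v} \<and>
     E1 \<union> E2 = edges G \<and> E1 \<inter> E2 = {} \<and>
     (\<forall>e\<in>E1. ends G e \<subseteq> V1) \<and> (\<forall>e\<in>E2. ends G e \<subseteq> V2) \<and>
     S \<subseteq> v \<and> seg G ` S \<subseteq> S \<and> card {p \<in> S. arc G p \<notin> S} \<le> 2 \<and>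
     v \<inter> \<Union>E1 \<subseteq> S \<and> S \<inter> \<Union>E2 = {} \<and>
     X1 = (sub_ribbon G V1 E1, restrict_partition P V1) \<and>
     X2 = (sub_ribbon G V2 E2, restrict_partition P V2) \<and>
     (\<forall>B\<in>P. B \<inter> V1 \<noteq> {} \<and> B \<inter> V2 \<noteq> {} \<longrightarrow> v \<in> B)"
    unfolding is_join_def GP by auto
  then show thesis
    using assms(1) GP by (intro that[of G P V1 V2 E1 E2 v S]) (auto simp: ribbon_join_def)
qed

lemma same_ranks_join:
  assumes "vrg X" "is_join X X1 X2"
  shows "same_ranks X (disjoint_union X1 X2)"
proof -
  obtain G P V1 V2 E1 E2 v S where GP: "X = (G, P)" and j: "ribbon_join G P V1 V2 E1 E2 v S"
    and Xs: "X1 = (sub_ribbon G V1 E1, restrict_partition P V1)"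
    "X2 = (sub_ribbon G V2 E2, restrict_partition P V2)"
    using assms by (rule is_joinE)
  interpret ribbon_join G P V1 V2 E1 E2 v S by (rule j)
  show ?thesis using same_ranks_union by (simp add: GP Xs G1_def G2_def Q1_def Q2_def)
qed

lemma same_ranks_equiv:
  assumes "vrg_equiv X Y"
  shows "same_ranks X Y"
  using assms
  by induction (auto intro: same_ranks_iso same_ranks_join same_ranks_edgeless same_ranks_sym same_ranks_trans)

section \<open>Ribbon graphs with one edge\<close>

lemma free_arcs_unique:
  assumes "(p, q) \<in> free_arcs G" "(p, r) \<in> free_arcs G"
  shows "r = q"
proof -
  have "r = q" if "(a, q) \<in> (walk G)\<^sup>*" "(a, r) \<in> (walk G)\<^sup>*" "q \<in> live G" "r \<in> live G" for a
    using that
  proof (induction rule: converse_rtrancl_induct)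
    case base
    then show ?case using walk_live by blast
  next
    case (step a b)
    then have "a \<in> pts G - live G" "b = arc G (seg G a)" by (auto simp: walk_def)
    then show ?case using step walk_nonlive[of a G r] by simp
  qed
  then show ?thesis using assms by (auto simp: free_arcs_iff)
qed

text \<open>Arcs together with segments outside \<open>live\<close> form paths whose loose ends are
  the live points. By parity the path of \<open>p\<close> has a live point \<open>q\<close> other
  than \<open>p\<close>, and as \<open>nearby\<close> is constant along the path, \<open>q\<close>
  is reached from \<open>p\<close> by a free arc and conversely.\<close>

lemma free_arcs_partner:
  assumes "ribbon G" "p \<in> live G"
  obtains q where "q \<in> live G" "q \<noteq> p" "(p, q) \<in> free_arcs G" "(q, p) \<in> free_arcs G" "q \<in> vertex_of G p"
proof -
  define R where "R = {(x, arc G x) | x. x \<in> pts G} \<union> {(x, seg G x) | x. x \<in> pts G - live G}"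
  let ?C = "R\<^sup>* `` {p}"
  have p: "p \<in> pts G" using assms ribbonD(4) by auto
  have "even (card (?C \<inter> live G))"
  proof (rule even_card_ends[OF ribbonD(1)[OF assms(1)] ribbonD(3)[OF assms(1)], where a = p and g = "seg G"])
    show "?C = ({(x, arc G x) | x. x \<in> pts G} \<union> {(x, seg G x) | x. x \<in> pts G - live G})\<^sup>* `` {p}"
      by (simp add: R_def)
  qed (use p seg_nonlive[OF assms(1)] ribbonD(2)[OF assms(1)] in \<open>auto dest: pairing_onD\<close>)
  then have "?C \<inter> live G \<noteq> {p}" by auto
  then obtain q where q: "q \<in> ?C" "q \<in> live G" "q \<noteq> p" using assms(2) by auto
  have "nearby G q = nearby G p \<and> q \<in> pts G"
    using q(1)[unfolded Image_singleton_iff]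
  proof (induction rule: rtrancl_induct)
    case (step y z)
    then consider "z = arc G y" | "z = seg G y" "y \<in> pts G - live G" by (auto simp: R_def)
    then show ?case
    proof cases
      case 1
      then show ?thesis using step nearby_arc[OF assms(1)] ribbonD(3)[OF assms(1)] by (auto dest: pairing_onD)
    next
      case 2
      then show ?thesis using step nearby_seg[OF assms(1)] seg_nonlive[OF assms(1)] by auto
    qed
  qed (use p in simp)
  then have n: "q \<in> nearby G p" "p \<in> nearby G q"
    using nearby_live[OF q(2)] nearby_live[OF assms(2)] by auto
  have "(p, q) \<in> free_arcs G" "(q, p) \<in> free_arcs G"
    using n nearby_live[OF q(2)] nearby_live[OF assms(2)] q(3) by auto
  then show thesis using that q n nearby_vertex_of[OF assms(1) p] by blast
qed

text \<open>The fixed-point-free involution that takes the place of \<open>arc\<close> once the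
  segments without edges are suppressed.\<close>

definition partner :: "ribbon_graph \<Rightarrow> nat \<Rightarrow> nat" where
  "partner G p = (THE q. (p, q) \<in> free_arcs G)"

lemma partner:
  assumes "ribbon G" "p \<in> live G"
  shows "(p, q) \<in> free_arcs G \<longleftrightarrow> q = partner G p" "partner G p \<in> live G" "partner G p \<noteq> p"
    "partner G (partner G p) = p" "partner G p \<in> vertex_of G p"
proof -
  obtain r where r: "r \<in> live G" "r \<noteq> p" "(p, r) \<in> free_arcs G" "(r, p) \<in> free_arcs G" "r \<in> vertex_of G p"
    using assms by (rule free_arcs_partner)
  have "partner G p = r" unfolding partner_def using r(3) free_arcs_unique by blast
  moreover have "partner G r = p" unfolding partner_def using r(4) free_arcs_unique by blast
  ultimately show "(p, q) \<in> free_arcs G \<longleftrightarrow> q = partner G p" "partner G p \<in> live G" "partner G p \<noteq> p"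
    "partner G (partner G p) = p" "partner G p \<in> vertex_of G p"
    using r free_arcs_unique by auto
qed

text \<open>The live points of a vertex are generated from one of them by \<open>seg\<close> and
  \<open>partner\<close>. The invariant along the vertex circle, also at points without an edge, is
  that some nearby live point belongs to \<open>L\<close>.\<close>

lemma vertex_of_live_closed:
  assumes "ribbon G" "L \<subseteq> live G" "p \<in> L" "q \<in> vertex_of G p" "q \<in> live G"
    and "\<And>x. x \<in> L \<Longrightarrow> seg G x \<in> L" "\<And>x. x \<in> L \<Longrightarrow> partner G x \<in> L"
  shows "q \<in> L"
proof -
  have near: "nearby G x = {x, partner G x}" if "x \<in> live G" for x
    using nearby_live[OF that] partner(1)[OF assms(1) that] by auto
  have mem_L: "x \<in> L" if "x \<in> live G" "r \<in> nearby G x" "r \<in> L" for x r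
    using that near[OF that(1)] assms(7)[of r] partner(4)[OF assms(1) that(1)] by auto
  have "(p, q) \<in> (step (pts G) (seg G) (arc G))\<^sup>*" using assms(4) by (simp add: vertex_of_def)
  then have "\<exists>r\<in>nearby G q. r \<in> L"
  proof (induction rule: rtrancl_induct)
    case base
    then show ?case using near[of p] assms(2,3) by auto
  next
    case (step y z)
    then obtain r where r: "r \<in> nearby G y" "r \<in> L" by blast
    from step(2) have y: "y \<in> pts G" and "z = seg G y \<or> z = arc G y" by (auto elim: stepE)
    then consider "z = arc G y" | "z = seg G y" "y \<notin> live G" | "z = seg G y" "y \<in> live G" by blast
    then show ?case
    proof cases
      case 1
      then show ?thesis using r nearby_arc[OF assms(1) y] by auto
    next
      case 2
      then show ?thesis using r nearby_seg[OF assms(1)] y by auto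
    next
      case 3
      then have "z \<in> L" using mem_L[OF _ r] assms(6) by auto
      moreover from this have "z \<in> nearby G z" using near assms(2) by auto
      ultimately show ?thesis by blast
    qed
  qed
  then show ?thesis using mem_L assms(5) by blast
qed

section \<open>Removing vertices without edges\<close>

lemma (in ribbon_join) is_join:
  "is_join (G, P) (sub_ribbon G V1 E1, restrict_partition P V1) (sub_ribbon G V2 E2, restrict_partition P V2)"
  unfolding is_join_def prod.case
  by (rule exI[of _ V1], rule exI[of _ V2], rule exI[of _ E1], rule exI[of _ E2], rule exI[of _ v],
      rule exI[of _ S]) (use V E ends S SE blocks in auto)

lemma vrg_equiv_vrg: "vrg_equiv X Y \<Longrightarrow> vrg X \<and> vrg Y"
  using same_ranks_equiv by (auto simp: same_ranks_def)

text \<open>A vertex \<open>w\<close> off the edge is cut away by a join at another vertex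
  \<open>v\<close>: the second part consists of \<open>v\<close> and \<open>w\<close> without edges
  and is dropped. Repetition ends since the number of vertices decreases.\<close>

lemma vrg_equiv_prune:
  assumes "vrg (G, P)" "edges G = {e}"
  shows "\<exists>H Q. vrg_equiv (G, P) (H, Q) \<and> edges H = {e} \<and> (\<forall>v\<in>vertices H. v \<inter> e \<noteq> {})"
  using assms
proof (induction "card (vertices G)" arbitrary: G P rule: less_induct)
  case less
  note X = less.prems(1) and rb = vrgD(1)[OF less.prems(1)] and pt = vrgD(2)[OF less.prems(1)]
  show ?case
  proof (cases "\<forall>v\<in>vertices G. v \<inter> e \<noteq> {}")
    case True
    moreover have "vrg_equiv (G, P) (G, P)" using X vrg_iso_refl by (rule vrg_equiv.iso[OF X])
    ultimately show ?thesis using less.prems(2) by blast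
  next
    case False
    then obtain w where w: "w \<in> vertices G" "w \<inter> e = {}" by blast
    have e: "e \<in> edges G" using less.prems(2) by simp
    obtain B where B: "B \<in> P" "w \<in> B" using w(1) pt by (auto simp: partition_on_def)
    have uniq: "C = B" if "C \<in> P" "w \<in> C" for C using partition_on_mem_eq[OF pt that(1) B(1) that(2) B(2)] .
    have eV: "ends G e \<subseteq> vertices G - {w}" using w by (auto simp: ends_def)
    have "ends G e \<noteq> {}" using contract_vertices(3)[OF rb e] e by (auto simp: edges_eq corners_def)
    \<comment> \<open>Every block meeting both parts must contain \<open>v\<close>. If the block of
      \<open>w\<close> has a further vertex, \<open>v\<close> is taken from it; if it is
      \<open>{w}\<close>, it misses the first part and any other vertex serves.\<close>
    then have "\<exists>v\<in>vertices G - {w}. B \<noteq> {w} \<longrightarrow> v \<in> B"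
    proof (cases "B = {w}")
      case False
      then obtain v where "v \<in> B" "v \<noteq> w" using B(2) by blast
      then show ?thesis using vrg_blockD[OF X B(1)] by blast
    qed (use eV in auto)
    then obtain v where v: "v \<in> vertices G - {w}" "B \<noteq> {w} \<Longrightarrow> v \<in> B" by blast
    let ?V = "vertices G - {w}"
    \<comment> \<open>All segments of \<open>v\<close> are given to the side of \<open>e\<close>, so
      the separating set is the whole of \<open>v\<close> and no arc leads out of it.\<close>
    have "ribbon_join G P ?V {v, w} {e} {} v v"
    proof
      show "vrg (G, P)" by fact
      show "?V \<union> {v, w} = vertices G" "?V \<inter> {v, w} = {v}" using v w by auto
      show "{e} \<union> {} = edges G" using less.prems(2) by simp
      show "seg G ` v \<subseteq> v" using vertex_closed(1)[OF rb] v by auto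
      have "{p \<in> v. arc G p \<notin> v} = {}" using vertex_closed(2)[OF rb] v by auto
      then show "card {p \<in> v. arc G p \<notin> v} \<le> 2" by (metis card.empty zero_le)
      fix C assume C: "C \<in> P" "C \<inter> ?V \<noteq> {}" "C \<inter> {v, w} \<noteq> {}"
      then show "v \<in> C" using uniq[of C] v(2) by (cases "v \<in> C") auto
    qed (use eV in auto)
    then interpret j: ribbon_join G P ?V "{v, w}" "{e}" "{}" v v .
    let ?X1 = "(sub_ribbon G ?V {e}, restrict_partition P ?V)"
    let ?X2 = "(sub_ribbon G {v, w} {}, restrict_partition P {v, w})"
    have vs: "vrg ?X1" "vrg ?X2" using j.vrg_parts by (simp_all add: j.G1_def j.G2_def j.Q1_def j.Q2_def)
    have "vrg_equiv (G, P) (disjoint_union ?X1 ?X2)" using X j.is_join by (rule vrg_equiv.join)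
    moreover have "edges (fst ?X2) = {}" by (simp add: edges_eq)
    then have "vrg_equiv (disjoint_union ?X1 ?X2) ?X1" by (rule vrg_equiv.edgeless[OF vs])
    ultimately have eq: "vrg_equiv (G, P) ?X1" by (rule vrg_equiv.trans)
    have "vertices (fst ?X1) = ?V" using vertices_sub_ribbon[OF rb] by simp
    moreover have "card ?V < card (vertices G)" using finite_vertices[OF rb] w(1) by (rule card_Diff1_less)
    ultimately have smaller: "card (vertices (sub_ribbon G ?V {e})) < card (vertices G)" by simp
    have "edges (sub_ribbon G ?V {e}) = {e}" using edges_sub_ribbon[OF rb] e by simp
    with smaller vs(1) obtain H Q where "vrg_equiv ?X1 (H, Q)" "edges H = {e}" "\<forall>v\<in>vertices H. v \<inter> e \<noteq> {}"
      using less.hyps by metis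
    then show ?thesis using vrg_equiv.trans[OF eq] by metis
  qed
qed

lemma orbs_single:
  assumes "sym R" "R \<subseteq> D \<times> D" "a \<in> D" "\<And>x. x \<in> D \<Longrightarrow> (a, x) \<in> R\<^sup>*"
  shows "orbs D R = {D}"
proof -
  have "R\<^sup>* `` {x} = D" if "x \<in> D" for x
  proof
    show "R\<^sup>* `` {x} \<subseteq> D" using that assms(2) orbs_subset[of R D "R\<^sup>* `` {x}"] by (auto simp: orbs_def)
    show "D \<subseteq> R\<^sup>* `` {x}"
      using assms(4) rtrancl_sym[OF assms(1) assms(4)[OF that]] by (auto intro: rtrancl_trans)
  qed
  then show ?thesis using assms(3) by (auto simp: orbs_def)
qed

lemma orbs_two:
  assumes "sym R" "D = A \<union> B" "a \<in> A" "b \<in> B" "\<And>x. x \<in> A \<Longrightarrow> (a, x) \<in> R\<^sup>*" "\<And>x. x \<in> B \<Longrightarrow> (b, x) \<in> R\<^sup>*"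
    and "\<And>x y. (x, y) \<in> R \<Longrightarrow> x \<in> A \<Longrightarrow> y \<in> A" "\<And>x y. (x, y) \<in> R \<Longrightarrow> x \<in> B \<Longrightarrow> y \<in> B"
  shows "orbs D R = {A, B}"
proof -
  have "R\<^sup>* `` {x} = A" if "x \<in> A" for x
  proof
    show "R\<^sup>* `` {x} \<subseteq> A" using rtrancl_closed[of x _ R A] that assms(7) by blast
    show "A \<subseteq> R\<^sup>* `` {x}"
      using assms(5) rtrancl_sym[OF assms(1) assms(5)[OF that]] by (auto intro: rtrancl_trans)
  qed
  moreover have "R\<^sup>* `` {x} = B" if "x \<in> B" for x
  proof
    show "R\<^sup>* `` {x} \<subseteq> B" using rtrancl_closed[of x _ R B] that assms(8) by blast
    show "B \<subseteq> R\<^sup>* `` {x}"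
      using assms(6) rtrancl_sym[OF assms(1) assms(6)[OF that]] by (auto intro: rtrancl_trans)
  qed
  ultimately show ?thesis using assms(2-4) by (auto simp: orbs_def)
qed

section \<open>The four standard graphs and their ranks\<close>

abbreviation "four \<equiv> {0, 1, 2, 3 :: nat}"

lemma flip_simps [simp]: "flip 0 = 1" "flip (Suc 0) = 0" "flip 2 = 3" "flip 3 = 2"
  by (simp_all add: flip_def)

lemma step_four: "step four f g = {(0, f 0), (1, f 1), (2, f 2), (3, f 3), (0, g 0), (1, g 1), (2, g 2), (3, g 3)}"
  by (auto simp: step_def)

lemma ribbon_standard: "ribbon nonloop_edge" "ribbon orientable_loop" "ribbon nonorientable_loop"
  by (auto simp: ribbon_def pairing_on_def nonloop_edge_def orientable_loop_def nonorientable_loop_def)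

lemma edges_standard: "edges nonloop_edge = {four}" "edges orientable_loop = {four}" "edges nonorientable_loop = {four}"
  by (auto simp: edges_def nonloop_edge_def orientable_loop_def nonorientable_loop_def)

lemma pts_standard: "pts nonloop_edge = four" "pts orientable_loop = four" "pts nonorientable_loop = four"
  by (simp_all add: nonloop_edge_def orientable_loop_def nonorientable_loop_def)

lemma vertices_nonloop: "vertices nonloop_edge = {{0, 1}, {2, 3}}"
proof -
  have R: "step (pts nonloop_edge) (seg nonloop_edge) (arc nonloop_edge) = {(0, 1), (1, 0), (2, 3), (3, 2)}"
    unfolding pts_standard step_four by (auto simp: nonloop_edge_def)
  show ?thesis
    unfolding vertices_eq unfolding R unfolding pts_standard
    by (rule orbs_two[where a = 0 and b = 2]) (auto simp: sym_def)
qed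

lemma vertices_loop_aux:
  assumes "ribbon G" "pts G = four" "seg G = flip" "arc G = id(1 := 2, 2 := 1, 3 := 0, 0 := 3)"
  shows "vertices G = {four}"
proof -
  let ?R = "step (pts G) (seg G) (arc G)"
  have R: "?R = {(0, 1), (1, 0), (2, 3), (3, 2), (0, 3), (1, 2), (2, 1), (3, 0)}"
    unfolding assms(2-4) step_four by auto
  have "(0, 1) \<in> ?R\<^sup>*" "(0, 3) \<in> ?R\<^sup>*" "(0, 2) \<in> ?R\<^sup>*"
  proof -
    have "(0, 3) \<in> ?R" "(3, 2) \<in> ?R" unfolding R by simp_all
    then show "(0, 2) \<in> ?R\<^sup>*" by (rule rtrancl_into_rtrancl[OF r_into_rtrancl])
    show "(0, 1) \<in> ?R\<^sup>*" "(0, 3) \<in> ?R\<^sup>*" unfolding R by (rule r_into_rtrancl, simp)+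
  qed
  then have "(0, x) \<in> ?R\<^sup>*" if "x \<in> pts G" for x using that unfolding assms(2) by blast
  moreover have "sym ?R" using ribbonD(2,3)[OF assms(1)] by (rule sym_step)
  moreover have "?R \<subseteq> pts G \<times> pts G" using ribbonD(2,3)[OF assms(1)] by (rule step_subset)
  moreover have "0 \<in> pts G" unfolding assms(2) by simp
  ultimately have "vertices G = {pts G}" unfolding vertices_eq by (intro orbs_single)
  then show ?thesis unfolding assms(2) .
qed

lemma vertices_loops: "vertices orientable_loop = {four}" "vertices nonorientable_loop = {four}"
proof -
  show "vertices orientable_loop = {four}"
    by (rule vertices_loop_aux[OF ribbon_standard(2) pts_standard(2)]) (simp_all add: orientable_loop_def)
  show "vertices nonorientable_loop = {four}"
    by (rule vertices_loop_aux[OF ribbon_standard(3) pts_standard(3)]) (simp_all add: nonorientable_loop_def)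
qed

lemma vrg_standard:
  "vrg (nonloop_edge, {{{0, 1}}, {{2, 3}}})" "vrg (nonloop_edge, {{{0, 1}, {2, 3}}})"
  "vrg (orientable_loop, {{four}})" "vrg (nonorientable_loop, {{four}})"
  using ribbon_standard
  by (auto simp: vrg_def vertices_nonloop vertices_loops partition_on_def disjoint_def)

lemma num_blocks_full:
  assumes "vrg (G, P)" "pts G = four" "edges G = {four}"
  shows "num_blocks G P {four} = 1"
proof -
  have "orbs (pts G) (block_rel P {four}) = {pts G}"
  proof (rule orbs_single[OF sym_block_rel block_rel_subset[OF assms(1)]])
    show "{four} \<subseteq> edges G" using assms(3) by simp
    show "0 \<in> pts G" using assms(2) by simp
    show "(0, x) \<in> (block_rel P {four})\<^sup>*" if "x \<in> pts G" for x
      using that assms(2) block_rel_edge[of four "{four}" 0 x P] by (intro r_into_rtrancl) auto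
  qed
  then show ?thesis by (simp add: num_blocks_def)
qed

lemma part_rank_full:
  assumes "vrg (G, P)" "pts G = four" "edges G = {four}"
  shows "part_rank G P {four} = card P - 1"
  using part_rank_eq[OF assms(1), of "{four}"] num_blocks_empty[OF assms(1)] num_blocks_full[OF assms] assms(3)
  by simp

lemma part_rank_standard:
  "part_rank nonloop_edge {{{0, 1}}, {{2, 3}}} {four} = 1" "part_rank nonloop_edge {{{0, 1}, {2, 3}}} {four} = 0"
  "part_rank orientable_loop {{four}} {four} = 0" "part_rank nonorientable_loop {{four}} {four} = 0"
  unfolding part_rank_full[OF vrg_standard(1) pts_standard(1) edges_standard(1)]
    part_rank_full[OF vrg_standard(2) pts_standard(1) edges_standard(1)]
    part_rank_full[OF vrg_standard(3) pts_standard(2) edges_standard(2)]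
    part_rank_full[OF vrg_standard(4) pts_standard(3) edges_standard(3)]
  by (simp_all add: doubleton_eq_iff)

lemma bd_rel_standard:
  "bd_rel nonloop_edge {four} = {(0, 2), (1, 3), (2, 0), (3, 1), (0, 1), (1, 0), (2, 3), (3, 2)}"
  "bd_rel orientable_loop {four} = {(0, 3), (1, 2), (2, 1), (3, 0)}"
  "bd_rel nonorientable_loop {four} = {(0, 2), (1, 3), (2, 0), (3, 1), (0, 3), (1, 2), (2, 1), (3, 0)}"
  unfolding bd_rel_def pts_standard step_four
  by (auto simp: turn_def nonloop_edge_def orientable_loop_def nonorientable_loop_def)

lemma num_bd_standard:
  "num_bd nonloop_edge {four} = 1" "num_bd orientable_loop {four} = 2" "num_bd nonorientable_loop {four} = 1"
proof -
  have "orbs four {(0, 2), (1, 3), (2, 0), (3, 1), (0, 1), (1, 0), (2, 3), (3, 2)} = {four}"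
    (is "orbs _ ?R = _")
  proof (rule orbs_single[where a = 0])
    have "(0, 2) \<in> ?R" "(2, 3) \<in> ?R" by simp_all
    then have "(0, 3) \<in> ?R\<^sup>*" by (rule rtrancl_into_rtrancl[OF r_into_rtrancl])
    moreover have "(0, 1) \<in> ?R\<^sup>*" "(0, 2) \<in> ?R\<^sup>*" by (rule r_into_rtrancl, simp)+
    ultimately show "(0, x) \<in> ?R\<^sup>*" if "x \<in> four" for x using that by blast
  qed (auto simp: sym_def)
  then show "num_bd nonloop_edge {four} = 1"
    unfolding num_bd_def bd_rel_standard pts_standard by simp
  have "orbs four {(0, 2), (1, 3), (2, 0), (3, 1), (0, 3), (1, 2), (2, 1), (3, 0)} = {four}"
    (is "orbs _ ?R = _")
  proof (rule orbs_single[where a = 0])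
    have "(0, 2) \<in> ?R" "(2, 1) \<in> ?R" by simp_all
    then have "(0, 1) \<in> ?R\<^sup>*" by (rule rtrancl_into_rtrancl[OF r_into_rtrancl])
    moreover have "(0, 3) \<in> ?R\<^sup>*" "(0, 2) \<in> ?R\<^sup>*" by (rule r_into_rtrancl, simp)+
    ultimately show "(0, x) \<in> ?R\<^sup>*" if "x \<in> four" for x using that by blast
  qed (auto simp: sym_def)
  then show "num_bd nonorientable_loop {four} = 1"
    unfolding num_bd_def bd_rel_standard pts_standard by simp
  have "orbs four {(0, 3), (1, 2), (2, 1), (3, 0)} = {{0, 3}, {1, 2}}"
    by (rule orbs_two[where a = 0 and b = 1]) (auto simp: sym_def)
  moreover have "{0, 3} \<noteq> {1, 2 :: nat}" by (simp add: doubleton_eq_iff)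
  ultimately show "num_bd orientable_loop {four} = 2"
    unfolding num_bd_def bd_rel_standard pts_standard by simp
qed

text \<open>The nonorientable loop has one vertex and a single boundary component, so its
  \<open>rho\<close> is half its number of edges; this is where half-integral exponents
  arise.\<close>

lemma rho_standard:
  "rho nonloop_edge {four} = 1" "rho orientable_loop {four} = 0" "rho nonorientable_loop {four} = 1 / 2"
  unfolding rho_eq num_bd_empty num_bd_standard vertices_nonloop vertices_loops
  by (simp_all add: doubleton_eq_iff)

text \<open>Without segments outside \<open>live\<close> the free arcs of \<open>H\<close> are its
  arcs, so the condition on free arcs reduces to carrying \<open>partner\<close> to
  \<open>arc\<close>.\<close>

lemma vrg_iso_standardI:
  assumes X: "vrg (G, P)" and Y: "vrg (H, Q)" and H: "pts H = live H"
    and \<psi>: "bij_betw \<psi> (live G) (live H)"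
    and comm: "\<And>p. p \<in> live G \<Longrightarrow> \<psi> (seg G p) = seg H (\<psi> p)" "\<And>p. p \<in> live G \<Longrightarrow> \<psi> (side G p) = side H (\<psi> p)"
      "\<And>p. p \<in> live G \<Longrightarrow> \<psi> (partner G p) = arc H (\<psi> p)"
    and \<phi>: "bij_betw \<phi> (vertices G) (vertices H)"
      "\<And>v. v \<in> vertices G \<Longrightarrow> \<psi> ` (v \<inter> live G) = \<phi> v"
      "(\<lambda>B. \<phi> ` B) ` P = Q"
  shows "vrg_iso (G, P) (H, Q)"
proof -
  have "\<phi> v \<inter> live H = \<phi> v" if "v \<in> vertices G" for v
  proof -
    have "\<phi> v \<in> vertices H" using \<phi>(1) that by (auto simp: bij_betw_def)
    then show ?thesis using vertex_closed(3)[OF vrgD(1)[OF Y]] H by auto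
  qed
  moreover have "(p, q) \<in> free_arcs G \<longleftrightarrow> (\<psi> p, \<psi> q) \<in> free_arcs H" if pq: "p \<in> live G" "q \<in> live G" for p q
  proof -
    have "walk H = {}" using H by (auto simp: walk_def)
    then have "(\<psi> p, \<psi> q) \<in> free_arcs H \<longleftrightarrow> \<psi> q = arc H (\<psi> p)"
      using \<psi> pq by (auto simp: free_arcs_iff bij_betw_def)
    also have "\<dots> \<longleftrightarrow> q = partner G p"
      using comm(3)[OF pq(1)] \<psi> pq partner(2)[OF vrgD(1)[OF X] pq(1)]
      by (metis bij_betw_imp_inj_on inj_onD)
    finally show ?thesis using partner(1)[OF vrgD(1)[OF X] pq(1)] by simp
  qed
  ultimately have "iso_data (G, P) (H, Q) \<phi> \<psi>"
    using assms unfolding iso_data_def by auto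
  then show ?thesis by (auto simp: vrg_iso_iff)
qed

section \<open>Classification of ribbon graphs with one edge\<close>

lemma one_edge_corners:
  assumes "ribbon G" "edges G = {e}"
  obtains a b c d where "e = {a, b, c, d}" "live G = {a, b, c, d}" "distinct [a, b, c, d]"
    "seg G a = b" "seg G b = a" "seg G c = d" "seg G d = c"
    "side G a = c" "side G c = a" "side G b = d" "side G d = b"
proof -
  have live: "live G = e" using partition_on_edges[OF assms(1)] assms(2) by (simp add: partition_on_def)
  have "e \<in> corners G ` live G" unfolding edges_eq[symmetric] using assms(2) by simp
  then obtain a where a: "a \<in> live G" "e = corners G a" by blast
  note s = pairing_onD[OF ribbonD(5)[OF assms(1)]] and t = pairing_onD[OF ribbonD(6)[OF assms(1)]]
  define b c d where "b = seg G a" and "c = side G a" and "d = seg G (side G a)"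
  have l: "b \<in> live G" "c \<in> live G" "d \<in> live G" using a s(1) t(1) by (simp_all add: b_def c_def d_def)
  have seg: "seg G a = b" "seg G b = a" "seg G c = d" "seg G d = c"
    using a s(3) l by (simp_all add: b_def c_def d_def)
  have side: "side G a = c" "side G c = a" using a t(3) by (simp_all add: c_def)
  have side': "side G b = d" using ribbonD(8)[OF assms(1) a(1)] by (simp add: b_def d_def)
  then have side'': "side G d = b" using t(3)[OF l(1)] by simp
  have "a \<noteq> b" "c \<noteq> d" "a \<noteq> c" "b \<noteq> d" using s(2) t(2) a l seg side side' by metis+
  moreover have "c \<noteq> b" using ribbonD(7)[OF assms(1) a(1)] by (simp add: b_def c_def)
  moreover have "a \<noteq> d" using seg calculation by metis
  ultimately have "distinct [a, b, c, d]" by auto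
  moreover have "e = {a, b, c, d}" using a(2) by (simp add: corners_def b_def c_def d_def)
  ultimately show thesis using that live seg side side' side'' by simp
qed

lemma seg_vertex_of: "ribbon G \<Longrightarrow> x \<in> pts G \<Longrightarrow> seg G x \<in> vertex_of G x"
  using vertex_closed(1) vertex_of_vertex vertex_of_mem by blast

lemma vertex_of_cong: "ribbon G \<Longrightarrow> x \<in> pts G \<Longrightarrow> y \<in> vertex_of G x \<Longrightarrow> vertex_of G y = vertex_of G x"
  using vertex_of_eq vertex_of_vertex by blast

text \<open>Once isolated vertices are pruned, only the free arcs on the four corners are
  undetermined, and four points admit three perfect matchings. One of them gives two vertices, which
  the partition may separate or not; the other two give the loops.\<close>

lemma one_edge_equiv_standard:
  assumes "vrg (G, P)" "edges G = {e}"
  shows "vrg_equiv (G, P) (nonloop_edge, {{{0, 1}}, {{2, 3}}}) \<or>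
    vrg_equiv (G, P) (nonloop_edge, {{{0, 1}, {2, 3}}}) \<or>
    vrg_equiv (G, P) (orientable_loop, {{four}}) \<or> vrg_equiv (G, P) (nonorientable_loop, {{four}})"
proof -
  obtain H Q where eq: "vrg_equiv (G, P) (H, Q)" and eH: "edges H = {e}"
    and meet: "\<And>v. v \<in> vertices H \<Longrightarrow> v \<inter> e \<noteq> {}"
    using vrg_equiv_prune[OF assms] by metis
  have Y: "vrg (H, Q)" using vrg_equiv_vrg[OF eq] by simp
  note rb = vrgD(1)[OF Y] and pt = vrgD(2)[OF Y]
  obtain a b c d where e: "e = {a, b, c, d}" and live: "live H = {a, b, c, d}" and dist: "distinct [a, b, c, d]"
    and seg: "seg H a = b" "seg H b = a" "seg H c = d" "seg H d = c"
    and side: "side H a = c" "side H c = a" "side H b = d" "side H d = b"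
    using rb eH by (rule one_edge_corners)
  have l: "a \<in> live H" "b \<in> live H" "c \<in> live H" "d \<in> live H" using live by auto
  have p: "a \<in> pts H" "b \<in> pts H" "c \<in> pts H" "d \<in> pts H" using l ribbonD(4)[OF rb] by auto
  let ?p = "partner H"
  note pa = partner(2-4)[OF rb l(1)] and pb = partner(2-4)[OF rb l(2)]
    and pc = partner(2-4)[OF rb l(3)] and pd = partner(2-4)[OF rb l(4)]
  have vb: "vertex_of H b = vertex_of H a" "vertex_of H d = vertex_of H c"
    using vertex_of_cong[OF rb] seg_vertex_of[OF rb] p seg by metis+
  have vs: "vertices H = {vertex_of H a, vertex_of H c}"
  proof
    show "{vertex_of H a, vertex_of H c} \<subseteq> vertices H" using vertex_of_vertex p by auto
    show "vertices H \<subseteq> {vertex_of H a, vertex_of H c}"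
    proof
      fix v assume v: "v \<in> vertices H"
      then obtain x where x: "x \<in> v" "x \<in> {a, b, c, d}" using meet e by blast
      then have "v = vertex_of H x" using vertex_of_eq[OF rb v] by simp
      then show "v \<in> {vertex_of H a, vertex_of H c}" using x(2) vb by auto
    qed
  qed
  define \<psi> where "\<psi> x = (if x = a then 0 else if x = b then 1 else if x = c then 2 else 3 :: nat)" for x
  \<comment> \<open>In \<open>orientable_loop\<close> the sides join 0 to 3 and 1 to 2, so the
    corners \<open>c\<close> and \<open>d\<close> trade the labels that they have under
    \<psi>.\<close>
  define \<psi>' where "\<psi>' x = (if x = a then 0 else if x = b then 1 else if x = c then 3 else 2 :: nat)" for x
  have \<psi>: "\<psi> a = 0" "\<psi> b = 1" "\<psi> c = 2" "\<psi> d = 3" using dist by (auto simp: \<psi>_def)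
  have \<psi>': "\<psi>' a = 0" "\<psi>' b = 1" "\<psi>' c = 3" "\<psi>' d = 2" using dist by (auto simp: \<psi>'_def)
  have bij: "bij_betw \<psi> (live H) four" "bij_betw \<psi>' (live H) four"
    unfolding bij_betw_def inj_on_def live using \<psi> \<psi>' by auto
  have iso: "vrg_iso (H, Q) Z \<Longrightarrow> vrg Z \<Longrightarrow> vrg_equiv (G, P) Z" for Z
    using eq Y vrg_equiv.iso vrg_equiv.trans by blast
  have loop: "vertices H = {vertex_of H a}" "Q = {{vertex_of H a}}" "vertex_of H a \<inter> live H = live H"
    if "?p a = c \<or> ?p a = d"
  proof -
    have "vertex_of H c = vertex_of H a"
      using that partner(5)[OF rb l(1)] vertex_of_cong[OF rb p(1)] vb by metis
    then show v1: "vertices H = {vertex_of H a}" using vs by simp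
    have "\<Union>Q = {vertex_of H a}" "{} \<notin> Q" using pt v1 by (auto simp: partition_on_def)
    then have "B = {vertex_of H a}" if "B \<in> Q" for B
      using that by (metis Union_upper subset_singletonD)
    moreover have "Q \<noteq> {}" using \<open>\<Union>Q = {vertex_of H a}\<close> by auto
    ultimately show "Q = {{vertex_of H a}}" by auto
    have "x \<in> vertex_of H a" if "x \<in> live H" for x
    proof -
      have "vertex_of H x = vertex_of H a" using that live vb \<open>vertex_of H c = vertex_of H a\<close> by auto
      then show ?thesis using vertex_of_mem[of x H] by simp
    qed
    then show "vertex_of H a \<inter> live H = live H" by blast
  qed
  \<comment> \<open>The isomorphism type is determined by which corner the free arc from \<open>a\<close> leads to.\<close>
  have cases: "?p a = b \<or> ?p a = c \<or> ?p a = d" using pa live by auto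
  then show ?thesis
  proof (elim disjE)
    assume ab: "?p a = b"
    then have ba: "?p b = a" using pa by simp
    have cd: "?p c = d"
    proof -
      have "?p c \<noteq> a" "?p c \<noteq> b" using pc ab ba dist by auto
      then show ?thesis using pc live by auto
    qed
    then have dc: "?p d = c" using pc by simp
    have "x \<in> {a, b}" if "x \<in> vertex_of H a" "x \<in> live H" for x
      by (rule vertex_of_live_closed[OF rb _ _ that]) (use live seg ab ba in auto)
    then have va: "vertex_of H a \<inter> live H = {a, b}"
      using l vertex_of_mem[of a H] vertex_of_mem[of b H] vb by auto
    have "x \<in> {c, d}" if "x \<in> vertex_of H c" "x \<in> live H" for x
      by (rule vertex_of_live_closed[OF rb _ _ that]) (use live seg cd dc in auto)
    then have vc: "vertex_of H c \<inter> live H = {c, d}"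
      using l vertex_of_mem[of c H] vertex_of_mem[of d H] vb by auto
    let ?u = "vertex_of H a" and ?w = "vertex_of H c"
    have uw: "?u \<noteq> ?w" using va vc dist by auto
    define \<phi> where "\<phi> v = (if v = ?u then {0, 1} else {2, 3 :: nat})" for v
    have \<phi>: "\<phi> ?u = {0, 1}" "\<phi> ?w = {2, 3}" using uw by (auto simp: \<phi>_def)
    have ne: "{0, 1} \<noteq> {2, 3 :: nat}" by (simp add: doubleton_eq_iff)
    have Q: "Q = {{?u}, {?w}} \<or> Q = {{?u, ?w}}"
    proof -
      have UQ: "\<Union>Q = {?u, ?w}" "{} \<notin> Q" using pt vs by (auto simp: partition_on_def)
      obtain B where B: "B \<in> Q" "?u \<in> B" using UQ by blast
      obtain C where C: "C \<in> Q" "?w \<in> C" using UQ by blast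
      have QBC: "Q = {B, C}"
      proof
        show "{B, C} \<subseteq> Q" using B C by simp
        show "Q \<subseteq> {B, C}"
        proof
          fix D assume D: "D \<in> Q"
          then obtain x where "x \<in> D" using UQ(2) by (metis all_not_in_conv)
          moreover from this have "x \<in> {?u, ?w}" unfolding UQ(1)[symmetric] using D by (rule UnionI[rotated])
          ultimately have "?u \<in> D \<or> ?w \<in> D" by auto
          then show "D \<in> {B, C}"
            using partition_on_mem_eq[OF pt D B(1) _ B(2)] partition_on_mem_eq[OF pt D C(1) _ C(2)] by auto
        qed
      qed
      have sub: "B \<subseteq> {?u, ?w}" "C \<subseteq> {?u, ?w}" unfolding UQ(1)[symmetric] using B C by blast+
      show ?thesis
      proof (cases "B = C")
        case True
        then have "B = {?u, ?w}" using sub B C by blast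
        then show ?thesis using QBC True by simp
      next
        case False
        then have "?w \<notin> B" "?u \<notin> C"
          using partition_on_mem_eq[OF pt B(1) C(1)] B(2) C(2) by blast+
        then have "B = {?u}" "C = {?w}" using sub B C by blast+
        then show ?thesis using QBC by simp
      qed
    qed
    have std: "vrg_iso (H, Q) (nonloop_edge, R)" if "(\<lambda>B. \<phi> ` B) ` Q = R" "vrg (nonloop_edge, R)" for R
    proof (rule vrg_iso_standardI[OF Y that(2), where \<psi> = \<psi> and \<phi> = \<phi>])
      show "bij_betw \<phi> (vertices H) (vertices nonloop_edge)"
        unfolding vs vertices_nonloop bij_betw_def inj_on_def using \<phi> ne by auto
      show "\<psi> ` (v \<inter> live H) = \<phi> v" if "v \<in> vertices H" for v
        using that va vc \<phi> \<psi> unfolding vs by auto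
      fix x assume "x \<in> live H"
      then have "x \<in> {a, b, c, d}" using live by simp
      then show "\<psi> (seg H x) = seg nonloop_edge (\<psi> x)" "\<psi> (side H x) = side nonloop_edge (\<psi> x)"
        "\<psi> (?p x) = arc nonloop_edge (\<psi> x)"
        using \<psi> seg side ab ba cd dc by (auto simp: nonloop_edge_def)
    qed (use bij that in \<open>auto simp: nonloop_edge_def\<close>)
    from Q show ?thesis
    proof
      assume "Q = {{?u}, {?w}}"
      then have "(\<lambda>B. \<phi> ` B) ` Q = {{{0, 1}}, {{2, 3}}}" using \<phi> by simp
      then show ?thesis using iso[OF std] vrg_standard by blast
    next
      assume "Q = {{?u, ?w}}"
      then have "(\<lambda>B. \<phi> ` B) ` Q = {{{0, 1}, {2, 3}}}" using \<phi> by simp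
      then show ?thesis using iso[OF std] vrg_standard by blast
    qed
  next
    assume ac: "?p a = c"
    then have ca: "?p c = a" using pa by simp
    have bd: "?p b = d"
    proof -
      have "?p b \<noteq> a" "?p b \<noteq> c" using pb ac ca dist by auto
      then show ?thesis using pb live by auto
    qed
    then have db: "?p d = b" using pb by simp
    note loop = loop[OF disjI1, OF ac]
    have "vrg_iso (H, Q) (orientable_loop, {{four}})"
    proof (rule vrg_iso_standardI[OF Y vrg_standard(3), where \<psi> = \<psi>' and \<phi> = "\<lambda>v. four"])
      show "\<psi>' ` (v \<inter> live H) = four" if "v \<in> vertices H" for v
        using that loop bij(2) by (simp add: bij_betw_def)
      show "bij_betw (\<lambda>v. four) (vertices H) (vertices orientable_loop)"
        by (simp add: loop vertices_loops bij_betw_def)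
      fix x assume "x \<in> live H"
      then have "x \<in> {a, b, c, d}" using live by simp
      then show "\<psi>' (seg H x) = seg orientable_loop (\<psi>' x)" "\<psi>' (side H x) = side orientable_loop (\<psi>' x)"
        "\<psi>' (?p x) = arc orientable_loop (\<psi>' x)"
        using \<psi>' seg side ac ca bd db by (auto simp: orientable_loop_def)
    qed (use bij loop in \<open>auto simp: orientable_loop_def\<close>)
    then show ?thesis using iso vrg_standard by blast
  next
    assume ad: "?p a = d"
    then have da: "?p d = a" using pa by simp
    have bc: "?p b = c"
    proof -
      have "?p b \<noteq> a" "?p b \<noteq> d" using pb ad da dist by auto
      then show ?thesis using pb live by auto
    qed
    then have cb: "?p c = b" using pb by simp
    note loop = loop[OF disjI2, OF ad]
    have "vrg_iso (H, Q) (nonorientable_loop, {{four}})"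
    proof (rule vrg_iso_standardI[OF Y vrg_standard(4), where \<psi> = \<psi> and \<phi> = "\<lambda>v. four"])
      show "\<psi> ` (v \<inter> live H) = four" if "v \<in> vertices H" for v
        using that loop bij(1) by (simp add: bij_betw_def)
      show "bij_betw (\<lambda>v. four) (vertices H) (vertices nonorientable_loop)"
        by (simp add: loop vertices_loops bij_betw_def)
      fix x assume "x \<in> live H"
      then have "x \<in> {a, b, c, d}" using live by simp
      then show "\<psi> (seg H x) = seg nonorientable_loop (\<psi> x)" "\<psi> (side H x) = side nonorientable_loop (\<psi> x)"
        "\<psi> (?p x) = arc nonorientable_loop (\<psi> x)"
        using \<psi> seg side ad da bc cb by (auto simp: nonorientable_loop_def)
    qed (use bij loop in \<open>auto simp: nonorientable_loop_def\<close>)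
    then show ?thesis using iso vrg_standard by blast
  qed
qed

section \<open>The convolution exponential\<close>

text \<open>The monomial of the overview for the spanning subgraph with edges \<open>A\<close>,
  formed with square roots \<open>s\<close> and \<open>t\<close>. With the graph fixed and
  \<open>A\<close> varying, deletion of edges merely shrinks \<open>A\<close>.\<close>

definition weight :: "'k::field_char_0 \<Rightarrow> 'k \<Rightarrow> 'k \<Rightarrow> part_ribbon_graph \<Rightarrow> nat set set \<Rightarrow> 'k" where
  "weight z s t X A = z ^ part_rank (fst X) (snd X) A
     * half_power s (of_nat (card A) - rho (fst X) A)
     * half_power t (rho (fst X) A - of_nat (part_rank (fst X) (snd X) A))"

text \<open>With exponents of this form the half-integral power is an ordinary power of
  \<open>s\<close>, and so multiplicative in the exponent even for \<open>s = 0\<close>.\<close>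

lemma half_power_half: "half_power s (of_nat i / 2) = s ^ i"
  by (simp add: half_power_def)

lemma rho_empty [simp]: "rho G {} = 0"
  by (simp add: rho_eq)

lemma part_rank_empty: "vrg (G, P) \<Longrightarrow> part_rank G P {} = 0"
  by (simp add: part_rank_eq)

lemma weight_empty: "vrg X \<Longrightarrow> weight z s t X {} = 1"
  by (cases X) (simp add: weight_def part_rank_empty half_power_def)

lemma weight_spanning: "weight z s t (spanning G A, P) B = weight z s t (G, P) B"
  by (simp add: weight_def rho_spanning part_rank_spanning)

text \<open>A complete invariant of the classes with one edge: rank and \<open>rho\<close> together
  separate the four of them.\<close>

definition one_edge_ranks :: "part_ribbon_graph \<Rightarrow> nat set \<Rightarrow> nat \<times> rat" where
  "one_edge_ranks X e = (part_rank (fst X) (snd X) {e}, rho (fst X) {e})"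

lemma one_edge_ranks_standard:
  "one_edge_ranks (nonloop_edge, {{{0, 1}}, {{2, 3}}}) four = (1, 1)"
  "one_edge_ranks (nonloop_edge, {{{0, 1}, {2, 3}}}) four = (0, 1)"
  "one_edge_ranks (orientable_loop, {{four}}) four = (0, 0)"
  "one_edge_ranks (nonorientable_loop, {{four}}) four = (0, 1 / 2)"
  unfolding one_edge_ranks_def fst_conv snd_conv part_rank_standard rho_standard by simp_all

lemma same_ranks_edgesD:
  assumes "same_ranks X Y"
  shows "card (edges (fst X)) = card (edges (fst Y))" "edges (fst X) = {} \<longleftrightarrow> edges (fst Y) = {}"
proof -
  obtain \<theta> where "bij_betw \<theta> (edges (fst X)) (edges (fst Y))" using assms by (auto simp: same_ranks_def)
  then show "card (edges (fst X)) = card (edges (fst Y))" "edges (fst X) = {} \<longleftrightarrow> edges (fst Y) = {}"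
    using bij_betw_same_card by (auto simp: bij_betw_def)
qed

lemma one_edge_ranks_equiv:
  assumes "vrg_equiv X Y" "edges (fst X) = {e}" "edges (fst Y) = {f}"
  shows "one_edge_ranks X e = one_edge_ranks Y f"
proof -
  obtain \<theta> where \<theta>: "bij_betw \<theta> {e} {f}"
    "\<forall>A\<subseteq>{e}. rho (fst Y) (\<theta> ` A) = rho (fst X) A \<and>
          part_rank (fst Y) (snd Y) (\<theta> ` A) = part_rank (fst X) (snd X) A"
    using same_ranks_equiv[OF assms(1)] assms(2,3) by (auto simp: same_ranks_def)
  have "\<theta> ` {e} = {f}" using \<theta>(1) by (simp add: bij_betw_def)
  then show ?thesis using \<theta>(2)[rule_format, of "{e}"] by (simp add: one_edge_ranks_def)
qed

abbreviation "std_b \<equiv> (nonloop_edge, {{{0, 1}}, {{2, 3 :: nat}}})"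
abbreviation "std_l \<equiv> (nonloop_edge, {{{0, 1}, {2, 3 :: nat}}})"
abbreviation "std_o \<equiv> (orientable_loop, {{four}})"
abbreviation "std_n \<equiv> (nonorientable_loop, {{four}})"

lemma exactly_one_of_four:
  fixes r :: "nat \<times> rat"
  assumes "b \<Longrightarrow> r = (1, 1)" "l \<Longrightarrow> r = (0, 1)" "k \<Longrightarrow> r = (0, 0)" "n \<Longrightarrow> r = (0, 1 / 2)"
    and "b \<or> l \<or> k \<or> n"
  shows "r \<in> {(1, 1), (0, 1), (0, 0), (0, 1 / 2)}" "b \<longleftrightarrow> r = (1, 1)" "l \<longleftrightarrow> r = (0, 1)"
    "k \<longleftrightarrow> r = (0, 0)" "n \<longleftrightarrow> r = (0, 1 / 2)"
  using assms by auto

text \<open>Invariance of the ranks gives one direction. Conversely, the classification offers four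
  classes whose values are distinct, so the value singles out the class.\<close>

lemma one_edge_equiv_iff:
  assumes "vrg X" "edges (fst X) = {e}"
  shows "one_edge_ranks X e \<in> {(1, 1), (0, 1), (0, 0), (0, 1 / 2)}" (is ?member)
    "vrg_equiv X std_b \<longleftrightarrow> one_edge_ranks X e = (1, 1)" (is ?b)
    "vrg_equiv X std_l \<longleftrightarrow> one_edge_ranks X e = (0, 1)" (is ?l)
    "vrg_equiv X std_o \<longleftrightarrow> one_edge_ranks X e = (0, 0)" (is ?o)
    "vrg_equiv X std_n \<longleftrightarrow> one_edge_ranks X e = (0, 1 / 2)" (is ?n)
proof -
  obtain G P where X: "X = (G, P)" by fastforce
  have ranks: "vrg_equiv X std_b \<Longrightarrow> one_edge_ranks X e = (1, 1)"
    "vrg_equiv X std_l \<Longrightarrow> one_edge_ranks X e = (0, 1)"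
    "vrg_equiv X std_o \<Longrightarrow> one_edge_ranks X e = (0, 0)"
    "vrg_equiv X std_n \<Longrightarrow> one_edge_ranks X e = (0, 1 / 2)"
    unfolding one_edge_ranks_standard[symmetric]
    by (erule one_edge_ranks_equiv[OF _ assms(2)], simp only: fst_conv edges_standard)+
  have "vrg_equiv X std_b \<or> vrg_equiv X std_l \<or> vrg_equiv X std_o \<or> vrg_equiv X std_n"
    unfolding X using assms unfolding X fst_conv by (rule one_edge_equiv_standard)
  note iff = exactly_one_of_four[OF ranks this]
  show ?member by (rule iff(1))
  show ?b by (rule iff(2))
  show ?l by (rule iff(3))
  show ?o by (rule iff(4))
  show ?n by (rule iff(5))
qed

text \<open>Deleting all other edges does not change the ranks of \<open>{e}\<close>, and leaves a
  graph with one edge.\<close>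

lemma one_edge_ranks_cases:
  assumes "vrg (G, P)" "e \<in> edges G"
  shows "one_edge_ranks (G, P) e \<in> {(1, 1), (0, 1), (0, 0), (0, 1 / 2)}"
proof -
  have "vrg (spanning G {e}, P)" using assms by (intro vrg_spanning) auto
  moreover have "edges (fst (spanning G {e}, P)) = {e}"
    using edges_spanning[OF vrgD(1)[OF assms(1)], of "{e}"] assms(2) by simp
  ultimately have "one_edge_ranks (spanning G {e}, P) e \<in> {(1, 1), (0, 1), (0, 0), (0, 1 / 2)}"
    by (rule one_edge_equiv_iff(1))
  then show ?thesis by (simp add: one_edge_ranks_def rho_spanning part_rank_spanning)
qed

text \<open>Both quantities are additive under contraction of an edge. On one edge the pair
  \<open>1 - rho\<close>, \<open>rho - r\<close> is (0, 0), (0, 1), (1, 0) or (1/2, 1/2), so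
  nonnegative half-integers result by induction.\<close>

lemma rank_exponents:
  assumes "vrg X" "A \<subseteq> edges (fst X)"
  shows "\<exists>i j :: nat. of_nat (card A) - rho (fst X) A = of_nat i / 2 \<and>
    rho (fst X) A - of_nat (part_rank (fst X) (snd X) A) = of_nat j / 2"
  using assms
proof (induction "card A" arbitrary: X A)
  case 0
  obtain G P where X: "X = (G, P)" by fastforce
  have "A = {}" using 0 finite_subset[OF 0(3)] finite_edges vrgD(1) X by fastforce
  then show ?case using 0(2) by (auto simp: X part_rank_empty intro!: exI[of _ 0])
next
  case (Suc n)
  obtain G P where X: "X = (G, P)" by fastforce
  have V: "vrg (G, P)" and rb: "ribbon G" using Suc(3) X vrgD by auto
  have A: "A \<subseteq> edges G" using Suc(4) X by simp
  then have fin: "finite A" using finite_subset finite_edges[OF rb] by blast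
  obtain e B where e: "A = insert e B" "e \<notin> B" "card B = n"
    using card_eq_SucD[OF Suc(2)[symmetric]] by blast
  have eG: "e \<in> edges G" and B: "B \<subseteq> edges G - {e}" using A e by auto
  let ?Y = "(contract_ribbon e G, contract_partition e G P)"
  have "\<exists>i j :: nat. of_nat (card B) - rho (fst ?Y) B = of_nat i / 2 \<and>
      rho (fst ?Y) B - of_nat (part_rank (fst ?Y) (snd ?Y) B) = of_nat j / 2"
    using vrg_contract[OF V eG] B edges_contract[OF rb eG] e(3)
    by (intro Suc(1)) auto
  then obtain i j :: nat where ij: "of_nat (card B) - rho (contract_ribbon e G) B = of_nat i / 2"
    "rho (contract_ribbon e G) B - of_nat (part_rank (contract_ribbon e G) (contract_partition e G P) B) = of_nat j / 2"
    by auto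
  obtain k l :: nat where kl: "1 - rho G {e} = of_nat k / 2" "rho G {e} - of_nat (part_rank G P {e}) = of_nat l / 2"
  proof -
    have "\<exists>k l :: nat. 1 - rho G {e} = of_nat k / 2 \<and> rho G {e} - of_nat (part_rank G P {e}) = of_nat l / 2"
      using one_edge_ranks_cases[OF V eG] unfolding one_edge_ranks_def
      by (auto intro: exI[of _ 0] exI[of _ 1] exI[of _ 2])
    then show thesis using that by blast
  qed
  have "finite B" using fin e by simp
  then have "of_nat (card A) = (of_nat (card B) + 1 :: rat)" using e by simp
  then have "of_nat (card A) - rho G A = of_nat (i + k) / 2"
    using rho_contract[OF rb eG B] ij(1) kl(1) e(1) by (simp add: field_simps)
  moreover have "of_nat (part_rank G P A) =
      (of_nat (part_rank (contract_ribbon e G) (contract_partition e G P) B) + of_nat (part_rank G P {e}) :: rat)"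
    unfolding e(1) part_rank_contract[OF V eG B, symmetric] by simp
  then have "rho G A - of_nat (part_rank G P A) = of_nat (j + l) / 2"
    using rho_contract[OF rb eG B] ij(2) kl(2) e(1) by (simp add: field_simps)
  ultimately show ?case by (auto simp: X simp del: of_nat_add)
qed

text \<open>Cardinality, \<open>rho\<close> and rank are all additive here. As the exponents are
  natural numbers, powers add without any restriction on \<open>z\<close>, \<open>s\<close> and
  \<open>t\<close>; this matters because the variables \<open>x\<close> may be zero.\<close>

lemma weight_contract:
  assumes X: "vrg X" and A: "A \<subseteq> edges (fst X)"
  defines "Y \<equiv> for_edges contract A X"
  assumes B: "B \<subseteq> edges (fst Y)"
  shows "weight z s t X (B \<union> A) = weight z s t X A * weight z s t Y B"
proof -
  note c = contraction_ofD[OF for_edges_contract[OF X A, folded Y_def]]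
  have rb: "ribbon (fst X)" using X by (simp add: vrg_def)
  have "finite A" "finite B"
    using A B c(2) finite_edges[OF rb] by (auto intro: finite_subset)
  moreover have "A \<inter> B = {}" using B c(2) by auto
  ultimately have card: "card (B \<union> A) = card B + card A" by (simp add: card_Un_disjoint Int_commute)
  obtain i j :: nat where ij: "of_nat (card A) - rho (fst X) A = of_nat i / 2"
    "rho (fst X) A - of_nat (part_rank (fst X) (snd X) A) = of_nat j / 2"
    using rank_exponents[OF X A] by blast
  obtain k l :: nat where kl: "of_nat (card B) - rho (fst Y) B = of_nat k / 2"
    "rho (fst Y) B - of_nat (part_rank (fst Y) (snd Y) B) = of_nat l / 2"
    using rank_exponents[OF c(1) B] by blast
  have r: "rho (fst X) (B \<union> A) = rho (fst Y) B + rho (fst X) A"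
    "part_rank (fst X) (snd X) (B \<union> A) = part_rank (fst Y) (snd Y) B + part_rank (fst X) (snd X) A"
    using c(3,4)[OF B] by simp_all
  have e: "of_nat (card (B \<union> A)) - rho (fst X) (B \<union> A) = of_nat (k + i) / 2"
    "rho (fst X) (B \<union> A) - of_nat (part_rank (fst X) (snd X) (B \<union> A)) = of_nat (l + j) / 2"
    using ij kl unfolding card r by (simp_all add: field_simps)
  show ?thesis
    unfolding weight_def e unfolding ij kl half_power_half r(2) by (simp add: power_add)
qed

section \<open>Functionals and convolution on basis elements\<close>

lemma vrg_equiv_refl: "vrg X \<Longrightarrow> vrg_equiv X X"
  using vrg_equiv.iso vrg_iso_refl by blast

lemma abs_vrg_class_eq_iff:
  assumes "vrg X" "vrg Y"
  shows "abs_vrg_class X = abs_vrg_class Y \<longleftrightarrow> vrg_equiv X Y"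
  using Quotient_rel[OF Quotient_vrg_class, of X Y] vrg_equiv_refl assms by blast

lemma rep_abs_vrg_class:
  assumes "vrg X"
  shows "vrg_equiv (rep_vrg_class (abs_vrg_class X)) X" "vrg (rep_vrg_class (abs_vrg_class X))"
proof -
  show "vrg_equiv (rep_vrg_class (abs_vrg_class X)) X"
    using Quotient_rep_abs[OF Quotient_vrg_class vrg_equiv_refl[OF assms]] by simp
  then show "vrg (rep_vrg_class (abs_vrg_class X))" using vrg_equiv_vrg by blast
qed

lemma linear_extension_superset:
  assumes "finite S" "Poly_Mapping.keys h \<subseteq> S"
  shows "linear_extension g h = (\<Sum>c\<in>S. Poly_Mapping.lookup h c * g c)"
  unfolding linear_extension_def using assms
  by (intro sum.mono_neutral_left) (auto simp: in_keys_iff)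

lemma linear_extension_single: "linear_extension g (Poly_Mapping.single c 1) = g c"
  by (simp add: linear_extension_def)

lemma linear_extension_add: "linear_extension g (h + k) = linear_extension g h + linear_extension g k"
proof -
  let ?S = "Poly_Mapping.keys h \<union> Poly_Mapping.keys k"
  have "Poly_Mapping.keys (h + k) \<subseteq> ?S" by (rule Poly_Mapping.keys_add)
  then show ?thesis
    using linear_extension_superset[of ?S h g] linear_extension_superset[of ?S k g]
      linear_extension_superset[of ?S "h + k" g]
    by (simp add: lookup_add sum.distrib distrib_right)
qed

text \<open>Different edge subsets may produce the same pair of classes, so a coproduct is evaluated
  by additivity and not term by term over its keys.\<close>

lemma linear_extension_sum:
  "linear_extension g (\<Sum>i\<in>I. h i) = (\<Sum>i\<in>I. linear_extension g (h i))"
  by (induction I rule: infinite_finite_induct) (simp_all add: linear_extension_add, simp_all add: linear_extension_def)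

text \<open>The subsets are those of the chosen representative \<open>Y\<close> of the class.
  Results have to be carried back to \<open>X\<close> by \<open>same_ranks\<close>.\<close>

lemma convolution_basis:
  assumes "vrg X"
  defines "Y \<equiv> rep_vrg_class (abs_vrg_class X)"
  shows "convolution f g (vrg_basis X) =
    (\<Sum>A\<in>Pow (edges (fst Y)). f (vrg_basis (spanning (fst Y) A, snd Y)) * g (vrg_basis (for_edges contract A Y)))"
proof -
  have rb: "ribbon (fst Y)" using rep_abs_vrg_class(2)[OF assms(1)] by (simp add: Y_def vrg_def)
  have "coproduct (vrg_basis X :: vrg_class \<Rightarrow>\<^sub>0 'a) =
      (\<Sum>A\<in>Pow (edges (fst Y)). Poly_Mapping.single
        (abs_vrg_class (for_edges delete (edges (fst Y) - A) Y), abs_vrg_class (for_edges contract A Y)) 1)"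
    by (simp add: coproduct_def vrg_basis_def Y_def Let_def)
  also have "\<dots> = (\<Sum>A\<in>Pow (edges (fst Y)). Poly_Mapping.single
        (abs_vrg_class (spanning (fst Y) A, snd Y), abs_vrg_class (for_edges contract A Y)) 1)"
    using for_edges_delete[OF rb, where P = "snd Y"] by (intro sum.cong) auto
  finally show ?thesis
    by (simp add: convolution_def tensor_mult_def linear_extension_sum linear_extension_single vrg_basis_def)
qed

text \<open>On the four classes with one edge the weight is \<open>z1\<close>,
  \<open>t\<^sup>2\<close>, \<open>s\<^sup>2\<close> and \<open>s * t\<close>; this explains the
  coefficient of the nonorientable loop.\<close>

lemma delta_basis:
  assumes X: "vrg X" and st: "s\<^sup>2 = z2" "t\<^sup>2 = z3"
  shows "delta z1 z2 z3 s t (vrg_basis X) =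
    (if card (edges (fst X)) = 1 then weight z1 s t X (edges (fst X)) else 0)"
proof -
  have ind: "indicator_functional Z (vrg_basis X) = (if vrg_equiv X Z then 1 else 0)" if "vrg Z" for Z
    by (simp add: indicator_functional_def vrg_basis_def linear_extension_single abs_vrg_class_eq_iff[OF X that])
  have d: "delta z1 z2 z3 s t (vrg_basis X) =
      z1 * (if vrg_equiv X std_b then 1 else 0) + z2 * (if vrg_equiv X std_o then 1 else 0)
      + s * t * (if vrg_equiv X std_n then 1 else 0) + z3 * (if vrg_equiv X std_l then 1 else 0)"
    unfolding delta_def delta_b_def delta_o_def delta_n_def delta_l_def
    by (simp only: ind[OF vrg_standard(1)] ind[OF vrg_standard(2)] ind[OF vrg_standard(3)] ind[OF vrg_standard(4)])
  show ?thesis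
  proof (cases "card (edges (fst X)) = 1")
    case True
    then obtain e where e: "edges (fst X) = {e}" by (auto simp: card_1_singleton_iff)
    note iff = one_edge_equiv_iff[OF X e]
    have w: "weight z1 s t X {e} = (case one_edge_ranks X e of (r, q) \<Rightarrow>
        z1 ^ r * half_power s (1 - q) * half_power t (q - of_nat r))"
      by (simp add: weight_def one_edge_ranks_def)
    have h: "half_power u 0 = 1" "half_power u 1 = u\<^sup>2" "half_power u (1 / 2) = u" for u :: 'a
      using half_power_half[of u 0] half_power_half[of u 2] half_power_half[of u 1] by simp_all
    from iff(1) show ?thesis
      unfolding d iff(2-5) e w
      by (elim insertE; simp add: h st)
  next
    case False
    have no: "\<not> vrg_equiv X Z" if "edges (fst Z) = {four}" for Z
      using same_ranks_edgesD(1)[OF same_ranks_equiv, of X Z] False that by auto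
    have "\<not> vrg_equiv X std_b" "\<not> vrg_equiv X std_o" "\<not> vrg_equiv X std_n" "\<not> vrg_equiv X std_l"
      by (rule no, simp only: fst_conv edges_standard)+
    then show ?thesis unfolding d using False by simp
  qed
qed

lemma weight_same_ranks:
  assumes "same_ranks X Y"
  obtains \<theta> where "bij_betw \<theta> (edges (fst X)) (edges (fst Y))"
    "\<forall>(z :: 'k::field_char_0) s t. \<forall>A\<subseteq>edges (fst X). weight z s t Y (\<theta> ` A) = weight z s t X A"
proof -
  obtain \<theta> where \<theta>: "bij_betw \<theta> (edges (fst X)) (edges (fst Y))"
    "\<And>A. A \<subseteq> edges (fst X) \<Longrightarrow> rho (fst Y) (\<theta> ` A) = rho (fst X) A \<and>
          part_rank (fst Y) (snd Y) (\<theta> ` A) = part_rank (fst X) (snd X) A"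
    using assms by (auto simp: same_ranks_def)
  have "card (\<theta> ` A) = card A" if "A \<subseteq> edges (fst X)" for A
    using \<theta>(1) that by (intro card_image) (auto simp: bij_betw_def elim: inj_on_subset)
  then have "weight z s t Y (\<theta> ` A) = weight z s t X A" if "A \<subseteq> edges (fst X)" for z s t :: 'k and A
    using that \<theta>(2) by (simp add: weight_def)
  then show thesis using that[OF \<theta>(1)] by blast
qed

lemma weight_edges_same_ranks:
  fixes z :: "'k::field_char_0"
  assumes "same_ranks X Y"
  shows "weight z s t X (edges (fst X)) = weight z s t Y (edges (fst Y))"
proof -
  obtain \<theta> where \<theta>: "bij_betw \<theta> (edges (fst X)) (edges (fst Y))"
    "\<forall>(z :: 'k) s t. \<forall>A\<subseteq>edges (fst X). weight z s t Y (\<theta> ` A) = weight z s t X A"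
    using assms by (rule weight_same_ranks[where ?'k = 'k])
  then show ?thesis using \<theta>(2)[rule_format, of "edges (fst X)"] by (simp add: bij_betw_def)
qed

section \<open>Convolution powers and the exponential\<close>

lemma counit_basis:
  assumes "vrg X"
  shows "counit (vrg_basis X) = (if edges (fst X) = {} then 1 else 0)"
  using same_ranks_edgesD(2)[OF same_ranks_equiv[OF rep_abs_vrg_class(1)[OF assms]]]
  by (simp add: counit_def vrg_basis_def linear_extension_single)

text \<open>In the product of \<open>delta\<close> with its \<open>k\<close>-th power only subsets
  with one edge contribute. By multiplicativity each contributes \<open>fact k\<close> times the
  full weight, and there are \<open>Suc k\<close> of them, which builds up the factorial.\<close>

lemma conv_power_basis:
  assumes "vrg X" and st: "s\<^sup>2 = z2" "t\<^sup>2 = z3"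
  shows "conv_power (delta z1 z2 z3 s t) k (vrg_basis X) =
    (if card (edges (fst X)) = k then fact k * weight z1 s t X (edges (fst X)) else 0)"
  using assms(1)
proof (induction k arbitrary: X)
  case 0
  have "finite (edges (fst X))" using 0 finite_edges by (simp add: vrg_def)
  then show ?case using 0 by (auto simp: counit_basis weight_empty)
next
  case (Suc k)
  define Y where "Y = rep_vrg_class (abs_vrg_class X)"
  have Y: "vrg Y" and YX: "same_ranks Y X"
    using rep_abs_vrg_class[OF Suc.prems] same_ranks_equiv by (simp_all add: Y_def)
  have rb: "ribbon (fst Y)" using Y by (simp add: vrg_def)
  let ?E = "edges (fst Y)" and ?w = "weight z1 s t"
  have fin: "finite ?E" using rb by (rule finite_edges)
  have "delta z1 z2 z3 s t (vrg_basis (spanning (fst Y) A, snd Y)) *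
      conv_power (delta z1 z2 z3 s t) k (vrg_basis (for_edges contract A Y)) =
      (if card A = 1 \<and> card ?E = Suc k then fact k * ?w Y ?E else 0)" if A: "A \<in> Pow ?E" for A
  proof -
    let ?Z = "for_edges contract A Y"
    have A: "A \<subseteq> ?E" using A by simp
    note c = contraction_ofD[OF for_edges_contract[OF Y A]]
    have "vrg (spanning (fst Y) A, snd Y)" using Y A by (intro vrg_spanning) auto
    then have 1: "delta z1 z2 z3 s t (vrg_basis (spanning (fst Y) A, snd Y)) =
        (if card A = 1 then ?w Y A else 0)"
      using edges_spanning[OF rb A] by (simp add: delta_basis st weight_spanning)
    have 2: "conv_power (delta z1 z2 z3 s t) k (vrg_basis ?Z) =
        (if card (?E - A) = k then fact k * ?w ?Z (?E - A) else 0)"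
      using Suc.IH[OF c(1)] by (simp add: c(2))
    have "?w Y ?E = ?w Y A * ?w ?Z (?E - A)"
      using weight_contract[OF Y A, of "?E - A"] A c(2) by (simp add: Un_absorb2)
    moreover have "card (?E - A) = card ?E - card A" "card A \<le> card ?E"
      using A fin by (auto intro: card_Diff_subset card_mono finite_subset)
    ultimately show ?thesis unfolding 1 2 by auto
  qed
  then have "conv_power (delta z1 z2 z3 s t) (Suc k) (vrg_basis X) =
      (\<Sum>A\<in>Pow ?E. if card A = 1 \<and> card ?E = Suc k then fact k * ?w Y ?E else 0)"
    unfolding conv_power.simps convolution_basis[OF Suc.prems] Y_def[symmetric] by (intro sum.cong) simp_all
  also have "\<dots> = (if card ?E = Suc k then fact (Suc k) * ?w Y ?E else 0)"
  proof (cases "card ?E = Suc k")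
    case True
    have "(\<Sum>A\<in>Pow ?E. if card A = 1 \<and> card ?E = Suc k then fact k * ?w Y ?E else 0) =
        (\<Sum>A\<in>Pow ?E. if card A = 1 then fact k * ?w Y ?E else 0)"
      using True by simp
    also have "\<dots> = (\<Sum>A\<in>{A \<in> Pow ?E. card A = 1}. fact k * ?w Y ?E)"
      by (rule sum.inter_filter[symmetric]) (use fin in simp)
    also have "{A \<in> Pow ?E. card A = 1} = {A. A \<subseteq> ?E \<and> card A = 1}" by auto
    also have "(\<Sum>A\<in>{A. A \<subseteq> ?E \<and> card A = 1}. fact k * ?w Y ?E) = of_nat (Suc k) * (fact k * ?w Y ?E)"
      using n_subsets[OF fin, of 1] True by simp
    finally show ?thesis using True by (simp add: fact_Suc mult.assoc del: of_nat_Suc)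
  qed simp
  also have "card ?E = card (edges (fst X))" using same_ranks_edgesD(1)[OF YX] .
  also have "?w Y ?E = ?w X (edges (fst X))" using YX by (rule weight_edges_same_ranks)
  finally show ?case .
qed

text \<open>Only the term with \<open>k\<close> equal to the number of edges survives, and its
  factorial cancels the denominator.\<close>

lemma conv_exp_basis:
  assumes "vrg X" and st: "s\<^sup>2 = z2" "t\<^sup>2 = z3"
  shows "conv_exp (delta z1 z2 z3 s t) (vrg_basis X) = weight z1 s t X (edges (fst X))"
proof -
  let ?n = "card (edges (fst X))" and ?w = "weight z1 s t X (edges (fst X))"
  have "conv_exp (delta z1 z2 z3 s t) (vrg_basis X) = Sum_any (\<lambda>k. if ?n = k then ?w else 0)"
    unfolding conv_exp_def conv_power_basis[OF assms] by (intro arg_cong[where f = Sum_any]) auto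
  also have "\<dots> = (\<Sum>k\<in>{?n}. if ?n = k then ?w else 0)"
    by (rule Sum_any.expand_superset) auto
  finally show ?thesis by simp
qed

text \<open>The exponents depend on \<open>X\<close> and \<open>A\<close> alone, so a quotient of
  two weights is the weight at the quotients of the variables.\<close>

lemma weight_monomial:
  assumes "vrg X" "A \<subseteq> edges (fst X)"
  shows "\<exists>r i j. \<forall>(z :: 'k::field_char_0) s t. weight z s t X A = z ^ r * s ^ i * t ^ j"
proof -
  obtain i j :: nat where ij: "of_nat (card A) - rho (fst X) A = of_nat i / 2"
    "rho (fst X) A - of_nat (part_rank (fst X) (snd X) A) = of_nat j / 2"
    using rank_exponents[OF assms] by blast
  show ?thesis unfolding weight_def ij half_power_half by blast
qed

lemma weight_divide:
  fixes x :: "'k::field_char_0"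
  assumes "vrg X" "A \<subseteq> edges (fst X)"
  shows "weight (x / y) (s / u) (t / v) X A = weight x s t X A / weight y u v X A"
proof -
  obtain r i j where "\<forall>(z :: 'k) s t. weight z s t X A = z ^ r * s ^ i * t ^ j"
    using weight_monomial[OF assms] by blast
  then show ?thesis by (simp add: power_divide)
qed

lemma weight_nonzero:
  assumes "vrg X" "A \<subseteq> edges (fst X)" "y \<noteq> 0" "u \<noteq> 0" "v \<noteq> 0"
  shows "weight y u v X A \<noteq> 0"
  using weight_monomial[OF assms(1,2)] assms(3-5) by (metis mult_eq_0_iff power_not_zero)

text \<open>The summand is the \<open>x\<close>-weight of \<open>A\<close> times the
  \<open>y\<close>-weight of the contraction by \<open>A\<close>. The latter is the full
  \<open>y\<close>-weight divided by that of \<open>A\<close>, which is nonzero, so the full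
  \<open>y\<close>-weight comes out as a common factor. The remaining sum is moved from the
  representative to \<open>X\<close> along the bijection of edges.\<close>

lemma convolution_conv_exp_basis:
  fixes x1 :: "'k::field_char_0"
  assumes X: "vrg X" and ab: "sx2\<^sup>2 = x2" "sx3\<^sup>2 = x3" "sy2\<^sup>2 = y2" "sy3\<^sup>2 = y3"
    and nz: "y1 \<noteq> 0" "y2 \<noteq> 0" "y3 \<noteq> 0"
  shows "convolution (conv_exp (delta x1 x2 x3 sx2 sx3)) (conv_exp (delta y1 y2 y3 sy2 sy3)) (vrg_basis X) =
    weight y1 sy2 sy3 X (edges (fst X)) *
      (\<Sum>A\<in>Pow (edges (fst X)). weight (x1 / y1) (sx2 / sy2) (sx3 / sy3) X A)"
proof -
  define Y where "Y = rep_vrg_class (abs_vrg_class X)"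
  have Y: "vrg Y" and YX: "same_ranks Y X"
    using rep_abs_vrg_class[OF X] same_ranks_equiv by (simp_all add: Y_def)
  have rb: "ribbon (fst Y)" using Y by (simp add: vrg_def)
  have nz': "sy2 \<noteq> 0" "sy3 \<noteq> 0" using ab nz by auto
  let ?E = "edges (fst Y)" and ?wx = "weight x1 sx2 sx3" and ?wy = "weight y1 sy2 sy3"
    and ?wq = "weight (x1 / y1) (sx2 / sy2) (sx3 / sy3)"
  have "conv_exp (delta x1 x2 x3 sx2 sx3) (vrg_basis (spanning (fst Y) A, snd Y)) *
      conv_exp (delta y1 y2 y3 sy2 sy3) (vrg_basis (for_edges contract A Y)) = ?wy Y ?E * ?wq Y A"
    if "A \<in> Pow ?E" for A
  proof -
    let ?Z = "for_edges contract A Y"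
    have A: "A \<subseteq> ?E" using that by simp
    note c = contraction_ofD[OF for_edges_contract[OF Y A]]
    have "vrg (spanning (fst Y) A, snd Y)" using Y A by (intro vrg_spanning) auto
    then have 1: "conv_exp (delta x1 x2 x3 sx2 sx3) (vrg_basis (spanning (fst Y) A, snd Y)) = ?wx Y A"
      using edges_spanning[OF rb A] by (simp add: conv_exp_basis ab weight_spanning)
    have 2: "conv_exp (delta y1 y2 y3 sy2 sy3) (vrg_basis ?Z) = ?wy ?Z (?E - A)"
      using c(2) by (simp add: conv_exp_basis[OF c(1)] ab)
    have "?wy Y ?E = ?wy Y A * ?wy ?Z (?E - A)"
      using weight_contract[OF Y A, of "?E - A"] A c(2) by (simp add: Un_absorb2)
    then show ?thesis
      unfolding 1 2 weight_divide[OF Y A] using weight_nonzero[OF Y A nz(1) nz'] by simp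
  qed
  then have "convolution (conv_exp (delta x1 x2 x3 sx2 sx3)) (conv_exp (delta y1 y2 y3 sy2 sy3)) (vrg_basis X) =
      (\<Sum>A\<in>Pow ?E. ?wy Y ?E * ?wq Y A)"
    unfolding convolution_basis[OF X] Y_def[symmetric] by (intro sum.cong) simp_all
  also have "\<dots> = ?wy Y ?E * (\<Sum>A\<in>Pow ?E. ?wq Y A)" by (simp add: sum_distrib_left)
  also have "?wy Y ?E = ?wy X (edges (fst X))" using YX by (rule weight_edges_same_ranks)
  also have "(\<Sum>A\<in>Pow ?E. ?wq Y A) = (\<Sum>A\<in>Pow (edges (fst X)). ?wq X A)"
  proof -
    obtain \<theta> where \<theta>: "bij_betw \<theta> ?E (edges (fst X))"
      "\<forall>(z :: 'k) s t. \<forall>A\<subseteq>?E. weight z s t X (\<theta> ` A) = weight z s t Y A"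
      using YX by (rule weight_same_ranks[where ?'k = 'k])
    have "(\<Sum>A\<in>Pow (edges (fst X)). ?wq X A) = (\<Sum>A\<in>Pow ?E. ?wq X (\<theta> ` A))"
      using sum.reindex_bij_betw[OF bij_betw_Pow[OF \<theta>(1)], of "?wq X"] by simp
    also have "\<dots> = (\<Sum>A\<in>Pow ?E. ?wq Y A)" using \<theta>(2) by (intro sum.cong) auto
    finally show ?thesis ..
  qed
  finally show ?thesis .
qed

theorem theorem3p38:
  fixes G :: ribbon_graph and P :: "nat set set set"
    and x1 x2 x3 y1 y2 y3 sx2 sx3 sy2 sy3 :: "'k::field_char_0"
  assumes "vrg (G, P)"
    and "sx2\<^sup>2 = x2" and "sx3\<^sup>2 = x3" and "sy2\<^sup>2 = y2" and "sy3\<^sup>2 = y3"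
    and "y1 \<noteq> 0" and "y2 \<noteq> 0" and "y3 \<noteq> 0"
  defines "\<delta>\<^sub>a \<equiv> delta x1 x2 x3 sx2 sx3" and "\<delta>\<^sub>b \<equiv> delta y1 y2 y3 sy2 sy3"
    and "E \<equiv> edges G"
  shows "convolution (conv_exp \<delta>\<^sub>a) (conv_exp \<delta>\<^sub>b) (vrg_basis (G, P)) =
    y1 ^ part_rank G P E
    * half_power sy2 (of_nat (card E) - rho G E)
    * half_power sy3 (rho G E - of_nat (part_rank G P E))
    * (\<Sum>A\<in>Pow E. (x1 / y1) ^ part_rank G P A
        * half_power (sx2 / sy2) (of_nat (card A) - rho G A)
        * half_power (sx3 / sy3) (rho G A - of_nat (part_rank G P A)))"
  using convolution_conv_exp_basis[OF assms(1-8), of x1]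
  by (simp add: weight_def \<delta>\<^sub>a_def \<delta>\<^sub>b_def E_def)

end
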